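(* Let $G=\mathrm{GL}_n(\mathbb{C})$, $P=P_n(\mathbb{C})$ its mirabolic subgroup, and let $f=\mathrm{pr}(\xi)\in\mathfrak{g}^*$, where $\xi=\mathrm{diag}(\xi_1,\dots,\xi_m)$ is in Jordan form with $\xi_j=\mathrm{diag}(J_{k_{j1}}^{l_{j1}}(a_j),\dots,J_{k_{jr_j}}^{l_{jr_j}}(a_j))$ of size $n_j$, $a_1,\dots,a_m\in\mathbb{C}$ pairwise distinct, $k_{j1}<\dots<k_{jr_j}$, and all $k_{ji},l_{ji}\geq1$ (every $G$-coadjoint orbit contains such an $f$). Then the moment map $\mathrm{p}:\mathcal{O}_f\to\mathfrak{p}^*$ sends different $P$-orbits of $\mathcal{O}_f$ to different $P$-orbits of $\mathfrak{p}^*$; the image $\mathrm{p}(\mathcal{O}_f)$ contains a unique dense $P$-orbit, namely $\Omega=P\cdot\mathrm{p}(g_{I^o}\cdot f)$; and $\mathrm{p}$ is proper over $\Omega$ (i.e. $\mathrm{p}^{-1}(\Omega)\to\Omega$ is proper). The reduced space $\mathrm{p}^{-1}(\Omega)/P$ of the unique open dense orbit $\Omega$ is a singleton.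
   Context: $P_n(\mathbb{C})$ is the group of matrices in $\mathrm{GL}_n(\mathbb{C})$ with last row $(0,\dots,0,1)$; its Lie algebra $\mathfrak{p}$ consists of the $n\times n$ matrices with zero last row; $\mathfrak{g}=\mathfrak{gl}_n(\mathbb{C})$. Duals are $\mathbb{C}$-linear. Coadjoint action: $(g\cdot f)(X)=f(g^{-1}Xg)$; $\mathcal{O}_f=G\cdot f$. $\mathrm{pr}:\mathfrak{g}\to\mathfrak{g}^*$ is $\mathrm{pr}(X)(Y)=\mathrm{tr}(XY)$. The moment map $\mathrm{p}$ is restriction of linear forms from $\mathfrak{g}$ to $\mathfrak{p}$. $J_k(a)$ is the $k\times k$ lower triangular Jordan block ($a$ on the diagonal, $1$ on the subdiagonal) and $J_k^l(a)$ is the block diagonal matrix with $l$ copies of $J_k(a)$. $I^o=\{n_1,n_1+n_2,\dots,n_1+\dots+n_m=n\}$, and $g_{I^o}=\begin{pmatrix}I_{n-1}&0\\ \beta&1\end{pmatrix}$, where $\beta=(x_1,\dots,x_{n-1})$ has $x_i=1$ if $i\in I^o$ and $x_i=0$ otherwise. Density and openness of $\Omega$ refer to $\mathrm{p}(\mathcal{O}_f)$. *)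

theory Defs
  imports
    "Jordan_Normal_Form.Jordan_Normal_Form"
    "HOL-Algebra.Group_Action"
    "HOL-Analysis.Function_Topology"
begin

definition GL :: "nat \<Rightarrow> complex mat monoid" where
  "GL n = units_of (ring_mat TYPE(complex) n ())"

definition mirabolic :: "nat \<Rightarrow> complex mat monoid" where
  "mirabolic n = (GL n)\<lparr>carrier := {g \<in> carrier (GL n). row g (n - 1) = unit_vec n (n - 1)}\<rparr>"

abbreviation gl :: "nat \<Rightarrow> complex mat set" where
  "gl n \<equiv> carrier_mat n n"

definition mirabolic_lie :: "nat \<Rightarrow> complex mat set" where
  "mirabolic_lie n = {X \<in> gl n. row X (n - 1) = 0\<^sub>v n}"

text \<open>Complex-linear forms on a linear subspace \<open>V\<close> of \<open>gl n\<close>. They are extensional functions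
  (\<open>undefined\<close> outside \<open>V\<close>), so that equality of forms is equality of functions.\<close>

definition linear_dual :: "complex mat set \<Rightarrow> (complex mat \<Rightarrow> complex) set" where
  "linear_dual V = {f \<in> extensional V.
     (\<forall>X\<in>V. \<forall>Y\<in>V. f (X + Y) = f X + f Y) \<and> (\<forall>c. \<forall>X\<in>V. f (c \<cdot>\<^sub>m X) = c * f X)}"

text \<open>The topology of pointwise convergence; as \<open>V\<close> is finite-dimensional, this is the usual
  (Euclidean) vector space topology of the dual.\<close>

definition dual_topology :: "complex mat set \<Rightarrow> (complex mat \<Rightarrow> complex) topology" where
  "dual_topology V = subtopology (product_topology (\<lambda>_. euclidean) V) (linear_dual V)"

text \<open>The coadjoint action of \<open>GL n\<close> on the dual of \<open>V = gl n\<close>, and of \<open>mirabolic n\<close> on the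
  dual of \<open>V = mirabolic_lie n\<close>.\<close>

definition coadjoint ::
    "nat \<Rightarrow> complex mat set \<Rightarrow> complex mat \<Rightarrow> (complex mat \<Rightarrow> complex) \<Rightarrow> complex mat \<Rightarrow> complex" where
  "coadjoint n V g f = (\<lambda>X\<in>V. f (inv\<^bsub>GL n\<^esub> g * X * g))"

definition mat_trace :: "complex mat \<Rightarrow> complex" where
  "mat_trace A = (\<Sum>i<dim_row A. A $$ (i, i))"

definition pr :: "nat \<Rightarrow> complex mat \<Rightarrow> complex mat \<Rightarrow> complex" where
  "pr n X = (\<lambda>Y\<in>gl n. mat_trace (X * Y))"

definition moment_map :: "nat \<Rightarrow> (complex mat \<Rightarrow> complex) \<Rightarrow> complex mat \<Rightarrow> complex" where
  "moment_map n h = restrict h (mirabolic_lie n)"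

text \<open>A list \<open>[(a\<^sub>1, [(k\<^sub>1\<^sub>1, l\<^sub>1\<^sub>1), \<dots>]), \<dots>, (a\<^sub>m, [(k\<^sub>m\<^sub>1, l\<^sub>m\<^sub>1), \<dots>])]\<close> encodes a matrix in Jordan form:
  for the eigenvalue \<open>a\<^sub>j\<close>, each pair \<open>(k, l)\<close> stands for \<open>l\<close> Jordan blocks of size \<open>k\<close>.\<close>

type_synonym jordan_data = "(complex \<times> (nat \<times> nat) list) list"

definition part_size :: "(nat \<times> nat) list \<Rightarrow> nat" where
  "part_size kls = (\<Sum>(k, l)\<leftarrow>kls. k * l)"

definition part_sizes :: "jordan_data \<Rightarrow> nat list" where
  "part_sizes bs = map (\<lambda>(a, kls). part_size kls) bs"

definition is_jordan_data :: "nat \<Rightarrow> jordan_data \<Rightarrow> bool" where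
  "is_jordan_data n bs \<longleftrightarrow> bs \<noteq> [] \<and> distinct (map fst bs) \<and>
     (\<forall>(a, kls) \<in> set bs. kls \<noteq> [] \<and> sorted_wrt (<) (map fst kls) \<and>
        (\<forall>(k, l) \<in> set kls. k \<ge> 1 \<and> l \<ge> 1)) \<and>
     sum_list (part_sizes bs) = n"

text \<open>The Jordan blocks of the library are upper triangular, hence the transposition.\<close>

definition lower_jordan_block :: "nat \<Rightarrow> complex \<Rightarrow> complex mat" where
  "lower_jordan_block k a = transpose_mat (jordan_block k a)"

definition jordan_blocks :: "nat \<Rightarrow> nat \<Rightarrow> complex \<Rightarrow> complex mat" where
  "jordan_blocks k l a = diag_block_mat (replicate l (lower_jordan_block k a))"

definition jordan_part :: "complex \<Rightarrow> (nat \<times> nat) list \<Rightarrow> complex mat" where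
  "jordan_part a kls = diag_block_mat (map (\<lambda>(k, l). jordan_blocks k l a) kls)"

definition jordan_form :: "jordan_data \<Rightarrow> complex mat" where
  "jordan_form bs = diag_block_mat (map (\<lambda>(a, kls). jordan_part a kls) bs)"

definition index_set :: "jordan_data \<Rightarrow> nat set" where
  "index_set bs = {sum_list (take j (part_sizes bs)) |j. 1 \<le> j \<and> j \<le> length bs}"

text \<open>\<open>index_set\<close> consists of 1-based indices, whereas matrix entries are indexed from 0.\<close>

definition g_index :: "nat \<Rightarrow> nat set \<Rightarrow> complex mat" where
  "g_index n I = mat n n (\<lambda>(i, j).
     if i = j then 1 else if i = n - 1 \<and> Suc j \<in> I then 1 else 0)"

end

theory Submission
  imports Defs "Jordan_Normal_Form.Jordan_Normal_Form_Existence"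
begin

text \<open>Writing forms as \<open>pr n A\<close>, the coadjoint action becomes conjugation, the moment map forgets the
  last column of \<open>A\<close>, and the mirabolic group is the stabiliser of the last row \<open>\<phi>\<close> of the identity.

  Injectivity on orbits: let \<open>A\<close> and \<open>A'\<close> be similar with equal first \<open>n - 1\<close> columns. For every Jordan
  block \<open>C\<close> of \<open>A\<close>, the rows \<open>\<phi>Z\<close> with \<open>A Z = Z C\<close> form a space invariant under \<open>C\<close>, and so do the rows
  \<open>\<phi>Z\<close> with \<open>A' Z = Z C\<close>. Both have the same dimension, because \<open>A\<close> and \<open>A'\<close> agree on the kernel of
  \<open>\<phi>\<close>; as the invariant subspaces of a single Jordan block form a chain, they are equal. Assembling the
  blocks yields intertwiners in both directions that fix \<open>\<phi>\<close>, and a generic combination with a given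
  invertible intertwiner makes them invertible.

  Open orbit: let \<open>m\<close> be the minimal polynomial of the orbit and \<open>d\<close> its degree. The open orbit
  consists of those \<open>A\<close> for which \<open>\<phi>, \<phi>A, \<dots>, \<phi>A\<^sup>d\<^sup>-\<^sup>1\<close> are linearly independent, a condition on the first
  \<open>n - 1\<close> columns \<open>B\<close> of \<open>A\<close> only. If \<open>u\<close> is a column with \<open>\<phi>B\<^sup>iu = 0\<close> for \<open>i < d - 1\<close> and
  \<open>\<phi>B\<^sup>d\<^sup>-\<^sup>1u = 1\<close>, then \<open>m(A) = 0\<close> forces the last column of \<open>A\<close> to be \<open>- m(B) u\<close>. Hence the moment map is a
  homeomorphism over the open orbit.\<close>

section \<open>Divided differences of matrix polynomials\<close>

text \<open>The obstacle is to make an intertwiner invertible and to let it fix \<phi> at the same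
  time: the constructions that control the last row may give singular matrices, while a given
  conjugating matrix \<open>h\<close> is invertible but moves \<phi>. It is overcome with two
  auxiliary matrices, an intertwiner \<open>Z\<close> fixing \<phi> and a matrix \<open>X\<close>
  that commutes with \<open>A\<close> and has the last row of \<open>h\<close>; for suitable
  \<open>s\<close> the quotient of \<open>h + s Z\<close> by \<open>X + s\<close> has both
  properties. On the open orbit \<open>X\<close> and \<open>Z\<close> are divided differences of the
  minimal polynomial, in general they come from Jordan chains.

  The matrix \<open>g_index\<close> enters because its last row adds up the bottom rows of the
  eigenvalue parts, each of which runs through a Jordan block of maximal size. This one row
  therefore detects whether a polynomial annihilates the Jordan form, so that it has
  \<open>d\<close> independent iterates.

  The row \<phi> is carried as the square matrix \<open>last_unit n\<close>, which keeps all
  products square.\<close>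

lemmas assoc_square = assoc_mult_mat[where n\<^sub>1 = n and n\<^sub>2 = n and n\<^sub>3 = n and n\<^sub>4 = n for n]
lemmas distrib_square = add_mult_distrib_mat[where nr = n and n = n and nc = n for n]
  mult_add_distrib_mat[where nr = n and n = n and nc = n for n]

lemma mult_carrier_square [simp]:
  "A \<in> carrier_mat n n \<Longrightarrow> B \<in> carrier_mat n n \<Longrightarrow> A * B \<in> carrier_mat n n"
  by simp

lemma zero_mult_square [simp]:
  "A \<in> carrier_mat n n \<Longrightarrow> 0\<^sub>m n n * A = 0\<^sub>m n n"
  "A \<in> carrier_mat n n \<Longrightarrow> A * 0\<^sub>m n n = 0\<^sub>m n n"
  by (auto intro: left_mult_zero_mat right_mult_zero_mat)

lemma one_mult_square [simp]:
  "A \<in> carrier_mat n n \<Longrightarrow> 1\<^sub>m n * A = (A :: complex mat)"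
  "A \<in> carrier_mat n n \<Longrightarrow> A * 1\<^sub>m n = A"
  by simp_all

lemma smult_one_mat [simp]: "(1 :: complex) \<cdot>\<^sub>m A = A"
  by (auto intro!: eq_matI)

lemma smult_zero_square: "A \<in> carrier_mat n n \<Longrightarrow> (0 :: complex) \<cdot>\<^sub>m A = 0\<^sub>m n n"
  by (auto intro!: eq_matI)

lemma pow_mat_0_square: "A \<in> carrier_mat n n \<Longrightarrow> A ^\<^sub>m 0 = 1\<^sub>m n"
  by simp

declare pow_mat.simps(1) [simp del]

lemma pow_mat_Suc_left:
  "A \<in> carrier_mat n n \<Longrightarrow> A * A ^\<^sub>m k = A ^\<^sub>m k * A"
  by (induction k) (simp_all add: pow_mat_0_square[of _ n] assoc_square[of _ n, symmetric])

lemma pow_mat_intertwine: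
  fixes A :: "complex mat"
  assumes [simp]: "A \<in> carrier_mat n n" "B \<in> carrier_mat n n" "Z \<in> carrier_mat n n"
    and Z: "Z * A = B * Z"
  shows "Z * A ^\<^sub>m k = B ^\<^sub>m k * Z"
proof (induction k)
  case (Suc k)
  have "Z * A ^\<^sub>m Suc k = (Z * A ^\<^sub>m k) * A"
    by (simp add: assoc_square[of _ n])
  also have "\<dots> = B ^\<^sub>m k * (Z * A)"
    by (simp add: Suc assoc_square[of _ n])
  also have "\<dots> = B ^\<^sub>m Suc k * Z"
    by (simp add: Z assoc_square[of _ n])
  finally show ?case .
qed (simp add: pow_mat_0_square[of _ n])

fun mat_poly :: "nat \<Rightarrow> complex mat \<Rightarrow> complex list \<Rightarrow> complex mat" where
  "mat_poly n A [] = 0\<^sub>m n n"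
| "mat_poly n A (c # cs) = c \<cdot>\<^sub>m 1\<^sub>m n + A * mat_poly n A cs"

text \<open>For a polynomial \<open>p\<close> with coefficient list \<open>cs\<close>, \<open>divdiff n A B X cs\<close> is the sum of
  \<open>p\<^sub>k A\<^sup>i X B\<^sup>j\<close> over all \<open>i + j = k - 1\<close>, i.e. the noncommutative divided difference of \<open>p\<close>.\<close>

fun divdiff :: "nat \<Rightarrow> complex mat \<Rightarrow> complex mat \<Rightarrow> complex mat \<Rightarrow> complex list \<Rightarrow> complex mat" where
  "divdiff n A B X [] = 0\<^sub>m n n"
| "divdiff n A B X (c # cs) = A * divdiff n A B X cs + X * mat_poly n B cs"

lemma mat_poly_carrier [simp]: "A \<in> carrier_mat n n \<Longrightarrow> mat_poly n A cs \<in> carrier_mat n n"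
  by (induction cs) simp_all

lemma divdiff_carrier [simp]:
  "A \<in> carrier_mat n n \<Longrightarrow> B \<in> carrier_mat n n \<Longrightarrow> X \<in> carrier_mat n n \<Longrightarrow>
    divdiff n A B X cs \<in> carrier_mat n n"
  by (induction cs) simp_all

lemma smult_one_mult [simp]:
  "A \<in> carrier_mat n n \<Longrightarrow> c \<cdot>\<^sub>m 1\<^sub>m n * A = c \<cdot>\<^sub>m (A :: complex mat)"
  "A \<in> carrier_mat n n \<Longrightarrow> A * (c \<cdot>\<^sub>m 1\<^sub>m n) = c \<cdot>\<^sub>m (A :: complex mat)"
  by (simp_all add: mult_smult_assoc_mat[of _ n n _ n] mult_smult_distrib[of _ n n _ n])

lemma mat_poly_intertwine:
  assumes [simp]: "A \<in> carrier_mat n n" "B \<in> carrier_mat n n" "Z \<in> carrier_mat n n"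
    and Z: "Z * A = B * Z"
  shows "Z * mat_poly n A cs = mat_poly n B cs * Z"
proof (induction cs)
  case (Cons c cs)
  have "Z * (A * mat_poly n A cs) = B * mat_poly n B cs * Z"
    by (simp add: assoc_square[of _ n, symmetric] Z) (simp add: assoc_square[of _ n] Cons)
  then show ?case
    by (simp add: distrib_square[of _ n])
qed simp

text \<open>The sum over \<open>i + j = k - 1\<close> telescopes: \<open>A D - D B\<close> leaves
  only the extreme terms \<open>A^k X\<close> and \<open>X B^k\<close>. If the polynomial kills both
  \<open>A\<close> and \<open>B\<close>, the divided difference is an intertwiner for every choice
  of \<open>X\<close>.\<close>

lemma divdiff_commutator:
  assumes [simp]: "A \<in> carrier_mat n n" "B \<in> carrier_mat n n" "X \<in> carrier_mat n n"
  shows "A * divdiff n A B X cs + X * mat_poly n B cs = divdiff n A B X cs * B + mat_poly n A cs * X"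
proof (induction cs)
  case (Cons c cs)
  let ?D = "divdiff n A B X cs" and ?p = "mat_poly n A cs" and ?q = "mat_poly n B cs"
  have comm: "B * ?q = ?q * B"
    by (rule mat_poly_intertwine) simp_all
  have "A * divdiff n A B X (c # cs) + X * mat_poly n B (c # cs)
      = A * (A * ?D + X * ?q) + (c \<cdot>\<^sub>m X + X * ?q * B)"
    by (simp add: distrib_square[of _ n] comm assoc_square[of _ n])
  also have "\<dots> = A * (?D * B + ?p * X) + (c \<cdot>\<^sub>m X + X * ?q * B)"
    by (simp add: Cons)
  also have "\<dots> = (A * ?D + X * ?q) * B + (c \<cdot>\<^sub>m X + A * ?p * X)"
    by (simp add: distrib_square[of _ n] assoc_square[of _ n] comm_add_mat[of _ n n] assoc_add_mat[of _ n n])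
       (auto intro!: eq_matI)
  also have "\<dots> = divdiff n A B X (c # cs) * B + mat_poly n A (c # cs) * X"
    by (simp add: distrib_square[of _ n])
  finally show ?case .
qed simp

text \<open>The noncommutative version of dividing \<open>p(A) - p(B)\<close> by
  \<open>A - B\<close>. It turns the vanishing of \<open>p(A)\<close> into an equation for the
  difference \<open>A - B\<close>.\<close>

lemma divdiff_minus:
  assumes [simp]: "A \<in> carrier_mat n n" "B \<in> carrier_mat n n" "X \<in> carrier_mat n n"
    and AB: "A = B + X"
  shows "mat_poly n A cs = divdiff n A B X cs + mat_poly n B cs"
proof (induction cs)
  case (Cons c cs)
  let ?D = "divdiff n A B X cs" and ?q = "mat_poly n B cs"
  have "A * ?q = B * ?q + X * ?q"
    by (subst AB) (simp add: distrib_square[of _ n])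
  then have "mat_poly n A (c # cs) = c \<cdot>\<^sub>m 1\<^sub>m n + (A * ?D + (B * ?q + X * ?q))"
    by (simp add: Cons distrib_square[of _ n])
  also have "\<dots> = divdiff n A B X (c # cs) + mat_poly n B (c # cs)"
    using carrier_matD[OF mult_carrier_square[of A n ?D]] carrier_matD[OF mult_carrier_square[of B n ?q]]
      carrier_matD[OF mult_carrier_square[of X n ?q]]
    by (intro eq_matI) (simp_all del: index_mult_mat)
  finally show ?case .
qed simp

section \<open>Cyclic rows, encoded by a dual vector\<close>

definition last_unit :: "nat \<Rightarrow> complex mat" where
  "last_unit n = mat n n (\<lambda>(i, j). if i = n - 1 \<and> j = n - 1 then 1 else 0)"

lemma last_unit_carrier [simp]: "last_unit n \<in> carrier_mat n n"
  by (simp add: last_unit_def)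

text \<open>As \<open>last_unit n\<close> is the product of the last column and the last row \<open>\<phi>\<close> of the identity,
  this says that \<open>\<phi> A\<^sup>i u\<close> vanishes for \<open>i < d - 1\<close> and is \<open>1\<close> for \<open>i = d - 1\<close>, where
  \<open>u\<close> is the last column of \<open>U\<close>.\<close>

definition cyclic :: "nat \<Rightarrow> nat \<Rightarrow> complex mat \<Rightarrow> complex mat \<Rightarrow> bool" where
  "cyclic n d A U \<longleftrightarrow> U \<in> carrier_mat n n \<and>
     (\<forall>i<d. last_unit n * A ^\<^sub>m i * U = (if i = d - 1 then last_unit n else 0\<^sub>m n n))"

text \<open>The two matrices differ in the last column only, and that column acts on a vector
  through its last coordinate. For \<open>A^j u\<close> with \<open>j < d - 1\<close> this
  coordinate is zero, so the difference is never noticed.\<close>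

lemma cyclic_same_columns:
  assumes [simp]: "A \<in> carrier_mat n n" "V \<in> carrier_mat n n" and U: "cyclic n d A U"
  shows "cyclic n d (A + V * last_unit n) U"
proof -
  let ?E = "last_unit n" and ?B = "A + V * last_unit n"
  have [simp]: "U \<in> carrier_mat n n" using U by (simp add: cyclic_def)
  \<comment> \<open>Powers are moved from \<open>?B\<close> to \<open>A\<close> one factor at a
    time, starting next to \<open>U\<close>; hence the second exponent \<open>j\<close>.\<close>
  have *: "?E * ?B ^\<^sub>m i * (A ^\<^sub>m j * U) = ?E * (A ^\<^sub>m (i + j) * U)" if "i + j < d" for i j
    using that
  proof (induction i arbitrary: j)
    case (Suc i)
    have z: "?E * (A ^\<^sub>m j * U) = 0\<^sub>m n n"
      using U Suc.prems by (auto simp: cyclic_def assoc_square[of _ n])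
    have "?B * (A ^\<^sub>m j * U) = A * (A ^\<^sub>m j * U)"
      by (simp add: distrib_square[of _ n] assoc_square[of _ n] z)
    also have "\<dots> = A ^\<^sub>m Suc j * U"
      by (simp add: assoc_square[of _ n, symmetric] pow_mat_Suc_left[of _ n])
    finally have "?E * ?B ^\<^sub>m Suc i * (A ^\<^sub>m j * U) = ?E * ?B ^\<^sub>m i * (A ^\<^sub>m Suc j * U)"
      by (simp add: assoc_square[of _ n])
    with Suc.IH[of "Suc j"] Suc.prems show ?case
      by (simp del: pow_mat.simps)
  qed (simp add: pow_mat_0_square[of _ n])
  show ?thesis
    using U *[of _ 0] by (auto simp: cyclic_def assoc_square[of _ n] pow_mat_0_square[of _ n])
qed

lemma cyclic_conjugate:
  assumes [simp]: "A \<in> carrier_mat n n" "B \<in> carrier_mat n n" "q \<in> carrier_mat n n"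
    and q: "q * A = B * q" "last_unit n * q = last_unit n" and U: "cyclic n d A U"
  shows "cyclic n d B (q * U)"
proof -
  have [simp]: "U \<in> carrier_mat n n" using U by (simp add: cyclic_def)
  have "last_unit n * B ^\<^sub>m i * (q * U) = last_unit n * A ^\<^sub>m i * U" for i
    using pow_mat_intertwine[OF _ _ _ q(1), of n i, symmetric] q(2)
    by (simp add: assoc_square[of _ n]) (simp add: assoc_square[of _ n, symmetric])
  then show ?thesis using U by (simp add: cyclic_def)
qed

text \<open>In the expansion into terms \<open>A^i U Y B^l\<close>, the factor
  \<open>last_unit n * A^j\<close> kills all those with \<open>i + j < d - 1\<close>. The length of
  \<open>cs\<close> leaves \<open>i + j = d - 1\<close> only to the leading coefficient, and there
  without a factor \<open>B\<close>. The exponent \<open>j\<close> carries the induction; the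
  application has \<open>j = 0\<close>.\<close>

lemma cyclic_divdiff_left:
  assumes [simp]: "A \<in> carrier_mat n n" "B \<in> carrier_mat n n" "Y \<in> carrier_mat n n"
    and U: "cyclic n d A U" and cs: "length cs + j = Suc d" "j < d" "last cs = 1"
  shows "last_unit n * A ^\<^sub>m j * divdiff n A B (U * Y) cs = last_unit n * Y"
  using cs
proof (induction cs arbitrary: j)
  case (Cons c cs)
  let ?E = "last_unit n" and ?D = "divdiff n A B (U * Y) cs"
  have [simp]: "U \<in> carrier_mat n n" using U by (simp add: cyclic_def)
  have split: "?E * A ^\<^sub>m j * divdiff n A B (U * Y) (c # cs)
    = ?E * A ^\<^sub>m Suc j * ?D + (?E * A ^\<^sub>m j * U) * (Y * mat_poly n B cs)"
    by (simp add: distrib_square[of _ n] assoc_square[of _ n])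
  show ?case
  proof (cases "j = d - 1")
    case True
    with Cons.prems have "length cs = 1" by simp
    then have "cs = [1]" using Cons.prems(3) by (cases cs) auto
    moreover have "?E * A ^\<^sub>m j * U = ?E" using True Cons.prems(2) U by (simp add: cyclic_def)
    ultimately show ?thesis
      by (subst split) simp
  next
    case False
    then have z: "?E * A ^\<^sub>m j * U = 0\<^sub>m n n" using Cons.prems(2) U by (simp add: cyclic_def)
    have "cs \<noteq> []" using False Cons.prems by auto
    then have "?E * A ^\<^sub>m Suc j * ?D = ?E * Y"
      using False Cons.prems by (intro Cons.IH) auto
    with z show ?thesis by (subst split) simp
  qed
qed auto

text \<open>The degree is at most \<open>d - 1 - j\<close>, so between \<phi> \<open>B^j\<close> and
  \<open>u\<close> only a coefficient that reaches the power \<open>d - 1\<close>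
  contributes.\<close>

lemma cyclic_mat_poly:
  assumes [simp]: "B \<in> carrier_mat n n" and U: "cyclic n d B U" and cs: "length cs + j \<le> d"
  shows "last_unit n * B ^\<^sub>m j * (mat_poly n B cs * U)
    = (if cs \<noteq> [] \<and> length cs + j = d then last cs else 0) \<cdot>\<^sub>m last_unit n"
  using cs
proof (induction cs arbitrary: j)
  case Nil
  have "U \<in> carrier_mat n n" using U by (simp add: cyclic_def)
  then show ?case by (simp add: smult_zero_square[of _ n])
next
  case (Cons c cs)
  let ?E = "last_unit n" and ?p = "mat_poly n B cs"
  have [simp]: "U \<in> carrier_mat n n" using U by (simp add: cyclic_def)
  have "?E * B ^\<^sub>m j * (mat_poly n B (c # cs) * U)
     = c \<cdot>\<^sub>m (?E * B ^\<^sub>m j * U) + ?E * B ^\<^sub>m Suc j * (?p * U)"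
    by (simp add: distrib_square[of _ n] assoc_square[of _ n] mult_smult_distrib[of _ n n _ n])
  also have "?E * B ^\<^sub>m Suc j * (?p * U) = (if cs \<noteq> [] \<and> length cs + Suc j = d then last cs else 0) \<cdot>\<^sub>m ?E"
    using Cons.prems by (intro Cons.IH) simp
  also have "?E * B ^\<^sub>m j * U = (if j = d - 1 then ?E else 0\<^sub>m n n)"
    using U Cons.prems by (simp add: cyclic_def)
  finally show ?case
    using Cons.prems by (cases cs) (auto simp: smult_zero_square[of _ n])
qed

text \<open>A term \<open>A^i V (last_unit n) B^j U\<close> survives only for
  \<open>j = d - 1\<close>; with at most \<open>d + 1\<close> coefficients this forces
  \<open>i = 0\<close> and the leading coefficient.\<close>

lemma cyclic_divdiff_right:
  assumes [simp]: "A \<in> carrier_mat n n" "B \<in> carrier_mat n n" "V \<in> carrier_mat n n"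
    and U: "cyclic n d B U" and cs: "length cs \<le> Suc d" "0 < d"
  shows "divdiff n A B (V * last_unit n) cs * U
    = (if length cs = Suc d then last cs else 0) \<cdot>\<^sub>m (V * last_unit n)"
  using cs
proof (induction cs)
  case Nil
  have "U \<in> carrier_mat n n" using U by (simp add: cyclic_def)
  then show ?case by (simp add: smult_zero_square[of _ n])
next
  case (Cons c cs)
  let ?E = "last_unit n" and ?D = "divdiff n A B (V * last_unit n) cs" and ?p = "mat_poly n B cs"
  have [simp]: "U \<in> carrier_mat n n" using U by (simp add: cyclic_def)
  have "divdiff n A B (V * ?E) (c # cs) * U = A * (?D * U) + V * (?E * B ^\<^sub>m 0 * (?p * U))"
    by (simp add: distrib_square[of _ n] assoc_square[of _ n] pow_mat_0_square[of _ n])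
  also have "?D * U = 0\<^sub>m n n"
    using Cons by (simp add: smult_zero_square[of _ n])
  also have "?E * B ^\<^sub>m 0 * (?p * U) = (if cs \<noteq> [] \<and> length cs + 0 = d then last cs else 0) \<cdot>\<^sub>m ?E"
    using Cons.prems by (intro cyclic_mat_poly[OF _ U]) auto
  finally show ?case
    using Cons.prems by (auto simp: mult_smult_distrib[of _ n n _ n] smult_zero_square[of _ n])
qed

lemma add_eq_zero_mat:
  assumes "X \<in> carrier_mat nr nc" "Y \<in> carrier_mat nr nc" "0\<^sub>m nr nc = X + (Y :: complex mat)"
  shows "X = - Y"
proof (rule eq_matI)
  fix i j assume "i < dim_row (- Y)" "j < dim_col (- Y)"
  with assms(1,2) arg_cong[OF assms(3), of "\<lambda>M. M $$ (i, j)"]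
  show "X $$ (i, j) = (- Y) $$ (i, j)"
    by (auto simp: add_eq_0_iff2)
qed (use assms in auto)

text \<open>Multiplying \<open>0 = m(A) = D + m(B)\<close> by \<open>U\<close> on the right
  collapses the divided difference \<open>D\<close> to \<open>A - B\<close>, and the rest involves
  \<open>B\<close> alone. In the application \<open>B\<close> is \<open>A\<close> with its last
  column set to zero.\<close>

lemma last_column_reconstruct:
  assumes [simp]: "A \<in> carrier_mat n n" "B \<in> carrier_mat n n" "V \<in> carrier_mat n n"
    and AB: "A = B + V * last_unit n" and U: "cyclic n d B U"
    and m: "mat_poly n A m = 0\<^sub>m n n" "length m = Suc d" "last m = 1" "0 < d"
  shows "V * last_unit n = - (mat_poly n B m * U)"
proof -
  let ?D = "divdiff n A B (V * last_unit n) m"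
  have [simp]: "U \<in> carrier_mat n n" using U by (simp add: cyclic_def)
  have "0\<^sub>m n n = ?D + mat_poly n B m"
    using divdiff_minus[OF _ _ _ AB, of n m] m(1) by simp
  then have "0\<^sub>m n n * U = ?D * U + mat_poly n B m * U"
    by (simp add: distrib_square[of _ n])
  also have "?D * U = V * last_unit n"
    using cyclic_divdiff_right[OF _ _ _ U, of A V m] m by simp
  finally have *: "0\<^sub>m n n = V * last_unit n + mat_poly n B m * U" by simp
  then show ?thesis
    by (intro add_eq_zero_mat[of _ n n]) auto
qed

section \<open>Intertwiners fixing the last row\<close>

lemma finite_det_add_smult_one:
  assumes "X \<in> carrier_mat n n"
  shows "finite {s :: complex. det (X + s \<cdot>\<^sub>m 1\<^sub>m n) = 0}"
proof -
  have "finite {k. poly (char_poly X) k = 0}"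
    using degree_monic_char_poly[OF assms] by (metis poly_roots_finite coeff_0 zero_neq_one)
  then have "finite (uminus ` {k. poly (char_poly X) k = 0})" by simp
  moreover have "{s. det (X + s \<cdot>\<^sub>m 1\<^sub>m n) = 0} \<subseteq> uminus ` {k. poly (char_poly X) k = 0}"
  proof safe
    fix s assume "det (X + s \<cdot>\<^sub>m 1\<^sub>m n) = 0"
    then have "eigenvalue X (- s)"
      using assms unfolding eigenvalue_det[OF assms] char_matrix_def by auto
    then have "poly (char_poly X) (- s) = 0"
      unfolding eigenvalue_root_char_poly[OF assms] .
    then show "s \<in> uminus ` {k. poly (char_poly X) k = 0}"
      by (intro image_eqI[of _ _ "- s"]) auto
  qed
  ultimately show ?thesis by (rule finite_subset[rotated])
qed


lemma finite_det_one_add_smult: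
  assumes X: "X \<in> carrier_mat n n"
  shows "finite {s :: complex. det (1\<^sub>m n + s \<cdot>\<^sub>m X) = 0}"
proof (rule finite_subset)
  let ?F = "{s. det (X + s \<cdot>\<^sub>m 1\<^sub>m n) = 0}"
  show "finite (insert 0 (inverse ` ?F))"
    by (intro finite.insertI finite_imageI finite_det_add_smult_one X)
  show "{s. det (1\<^sub>m n + s \<cdot>\<^sub>m X) = 0} \<subseteq> insert 0 (inverse ` ?F)"
  proof
    fix s assume "s \<in> {s. det (1\<^sub>m n + s \<cdot>\<^sub>m X) = 0}"
    then have s: "det (1\<^sub>m n + s \<cdot>\<^sub>m X) = 0" by simp
    show "s \<in> insert 0 (inverse ` ?F)"
    proof (cases "s = 0")
      case False
      have *: "1\<^sub>m n + s \<cdot>\<^sub>m X = s \<cdot>\<^sub>m (X + inverse s \<cdot>\<^sub>m 1\<^sub>m n)"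
      proof (rule eq_matI)
        fix i j assume "i < dim_row (s \<cdot>\<^sub>m (X + inverse s \<cdot>\<^sub>m 1\<^sub>m n))"
          "j < dim_col (s \<cdot>\<^sub>m (X + inverse s \<cdot>\<^sub>m 1\<^sub>m n))"
        then show "(1\<^sub>m n + s \<cdot>\<^sub>m X) $$ (i, j) = (s \<cdot>\<^sub>m (X + inverse s \<cdot>\<^sub>m 1\<^sub>m n)) $$ (i, j)"
          using X False by (simp add: distrib_left)
      qed (use X in simp_all)
      have "det (1\<^sub>m n + s \<cdot>\<^sub>m X) = s ^ n * det (X + inverse s \<cdot>\<^sub>m 1\<^sub>m n)"
        by (subst *, subst det_smult) (use X in simp)
      with s False have "inverse s \<in> ?F" by simp
      then have "inverse (inverse s) \<in> inverse ` ?F" by (rule imageI)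
      then show ?thesis by simp
    qed simp
  qed
qed

lemma det_nonzero_inverse:
  assumes "A \<in> carrier_mat n n" "det A \<noteq> (0 :: complex)"
  obtains B where "B \<in> carrier_mat n n" "A * B = 1\<^sub>m n" "B * A = 1\<^sub>m n"
  using det_non_zero_imp_unit[OF assms, of "()"] by (auto simp: Units_def ring_mat_def)

lemma inverse_det_nonzero:
  assumes "A \<in> carrier_mat n n" "B \<in> carrier_mat n n" "A * B = 1\<^sub>m n"
  shows "det A \<noteq> (0 :: complex)"
  using det_mult[OF assms(1,2)] assms(3) by auto

text \<open>\<open>X + s \<sqdot> 1\<close> and \<open>h + s \<sqdot> Z\<close> have the same last row for every scalar \<open>s\<close>, and both are
  invertible for almost every \<open>s\<close>.\<close>

lemma intertwiner_fixing_last_row: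
  assumes [simp]: "A \<in> carrier_mat n n" "B \<in> carrier_mat n n" "h \<in> carrier_mat n n"
      "Z \<in> carrier_mat n n" "X \<in> carrier_mat n n"
    and h: "det h \<noteq> 0" "h * A = B * h"
    and Z: "Z * A = B * Z" "last_unit n * Z = last_unit n"
    and X: "X * A = A * X" "last_unit n * X = last_unit n * h"
  obtains q where "q \<in> carrier_mat n n" "det q \<noteq> 0" "q * A = B * q" "last_unit n * q = last_unit n"
proof -
  let ?E = "last_unit n"
  obtain h' where [simp]: "h' \<in> carrier_mat n n" and h': "h * h' = 1\<^sub>m n" "h' * h = 1\<^sub>m n"
    using det_nonzero_inverse[OF _ h(1), of n] by auto
  have "finite ({s. det (X + s \<cdot>\<^sub>m 1\<^sub>m n) = 0} \<union> {s. det (1\<^sub>m n + s \<cdot>\<^sub>m (h' * Z)) = 0})"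
    by (intro finite_UnI finite_det_add_smult_one finite_det_one_add_smult) simp_all
  then obtain s where s: "det (X + s \<cdot>\<^sub>m 1\<^sub>m n) \<noteq> 0" "det (1\<^sub>m n + s \<cdot>\<^sub>m (h' * Z)) \<noteq> 0"
    using ex_new_if_finite[OF infinite_UNIV_char_0] by blast
  define X' where "X' = X + s \<cdot>\<^sub>m 1\<^sub>m n"
  define Z' where "Z' = h + s \<cdot>\<^sub>m Z"
  have [simp]: "X' \<in> carrier_mat n n" "Z' \<in> carrier_mat n n" by (simp_all add: X'_def Z'_def)
  have "Z' = h * (1\<^sub>m n + s \<cdot>\<^sub>m (h' * Z))"
    by (simp add: Z'_def distrib_square[of _ n] mult_smult_distrib[of _ n n _ n]
        assoc_square[of _ n, symmetric] h')
  then have dZ: "det Z' \<noteq> 0" using h(1) s(2) by (simp add: det_mult[of _ n])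
  obtain X'' where [simp]: "X'' \<in> carrier_mat n n" and X'': "X' * X'' = 1\<^sub>m n" "X'' * X' = 1\<^sub>m n"
    using det_nonzero_inverse[of X' n] s(1) by (auto simp: X'_def)
  have comm: "X' * A = A * X'" "Z' * A = B * Z'" "?E * X' = ?E * Z'"
    by (simp_all add: X'_def Z'_def distrib_square[of _ n] mult_smult_distrib[of _ n n _ n]
        mult_smult_assoc_mat[of _ n n _ n] X Z h)
  \<comment> \<open>The witness is \<open>Z' * X''\<close> with \<open>X''\<close> the inverse of
    \<open>X'\<close>: the inverse commutes with \<open>A\<close> as \<open>X'\<close> does, and the
    equality of the last rows of \<open>Z'\<close> and \<open>X'\<close> makes the quotient fix
    \<phi>.\<close>
  have "X'' * A = X'' * (A * X') * X''" by (simp add: assoc_square[of _ n] X'')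
  also have "\<dots> = X'' * X' * A * X''" by (simp only: comm(1)[symmetric]) (simp add: assoc_square[of _ n])
  finally have comm'': "X'' * A = A * X''" by (simp add: X'')
  have "Z' * X'' * A = B * (Z' * X'')"
    by (simp add: assoc_square[of _ n] comm'') (simp add: assoc_square[of _ n, symmetric] comm)
  moreover have "?E * (Z' * X'') = ?E * X' * X''"
    by (simp add: comm assoc_square[of _ n, symmetric])
  then have "?E * (Z' * X'') = ?E" by (simp add: assoc_square[of _ n] X'')
  moreover have "det (Z' * X'') \<noteq> 0"
    using dZ inverse_det_nonzero[OF _ _ X''(2)] by (simp add: det_mult[of _ n])
  ultimately show thesis by (intro that[of "Z' * X''"]) auto
qed

text \<open>As \<open>m\<close> kills both matrices, the boundary terms of the commutator identity
  vanish. The free parameter \<open>Y\<close> prescribes the last row of the intertwiner.\<close>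

lemma cyclic_divdiff_intertwine:
  assumes [simp]: "A \<in> carrier_mat n n" "B \<in> carrier_mat n n" "Y \<in> carrier_mat n n"
    and U: "cyclic n d B U"
    and m: "mat_poly n A m = 0\<^sub>m n n" "mat_poly n B m = 0\<^sub>m n n" "length m = Suc d" "last m = 1" "0 < d"
  defines "Z \<equiv> divdiff n B A (U * Y) m"
  shows "Z \<in> carrier_mat n n" "Z * A = B * Z" "last_unit n * Z = last_unit n * Y"
proof -
  have [simp]: "U \<in> carrier_mat n n" using U by (simp add: cyclic_def)
  show Z [simp]: "Z \<in> carrier_mat n n" by (simp add: Z_def)
  show "Z * A = B * Z"
    using divdiff_commutator[of B n A "U * Y" m] m(1,2)
    by (simp add: Z_def[symmetric])
  show "last_unit n * Z = last_unit n * Y"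
    using cyclic_divdiff_left[OF _ _ _ U, of A Y m 0] m(3-5)
    by (simp add: Z_def pow_mat_0_square[of _ n])
qed

text \<open>Both intertwiners required by the previous construction are divided differences of a common
  annihilating polynomial.\<close>

lemma cyclic_similar:
  assumes [simp]: "A \<in> carrier_mat n n" "B \<in> carrier_mat n n" "h \<in> carrier_mat n n"
    and h: "det h \<noteq> 0" "h * A = B * h"
    and UA: "cyclic n d A UA" and UB: "cyclic n d B UB"
    and m: "mat_poly n A m = 0\<^sub>m n n" "length m = Suc d" "last m = 1" "0 < d"
  obtains q where "q \<in> carrier_mat n n" "det q \<noteq> 0" "q * A = B * q" "last_unit n * q = last_unit n"
proof -
  obtain h' where [simp]: "h' \<in> carrier_mat n n" and h': "h * h' = 1\<^sub>m n" "h' * h = 1\<^sub>m n"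
    using det_nonzero_inverse[OF _ h(1), of n] by auto
  have "mat_poly n B m * h * h' = h * mat_poly n A m * h'"
    using mat_poly_intertwine[OF _ _ _ h(2)] by simp
  then have mB: "mat_poly n B m = 0\<^sub>m n n"
    using m(1) by (simp add: assoc_square[of _ n] h')
  \<comment> \<open>\<open>Y = 1\<close> yields an intertwiner fixing \<phi>, and
    \<open>Y = h\<close> a matrix that commutes with \<open>A\<close> and has the last row of
    \<open>h\<close>.\<close>
  note Z = cyclic_divdiff_intertwine[of A n B "1\<^sub>m n", OF _ _ _ UB m(1) mB m(2-4)]
  note X = cyclic_divdiff_intertwine[of A n A h, OF _ _ _ UA m(1) m(1) m(2-4)]
  show thesis
    by (rule intertwiner_fixing_last_row[of A n B h "divdiff n B A (UB * 1\<^sub>m n) m" "divdiff n A A (UA * h) m"])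
       (use Z X h that in auto)
qed

section \<open>Similar matrices with equal first columns\<close>

lemma mat_poly_mult_index:
  assumes [simp]: "A \<in> carrier_mat n n" "R \<in> carrier_mat n n" and ij: "i < n" "j < n"
  shows "(R * mat_poly n A cs) $$ (i, j) = (\<Sum>t<length cs. cs ! t * (R * A ^\<^sub>m t) $$ (i, j))"
  using assms(2)
proof (induction cs arbitrary: R)
  case (Cons c cs)
  note [simp] = Cons.prems
  let ?p = "mat_poly n A cs"
  have "R * mat_poly n A (c # cs) = c \<cdot>\<^sub>m R + R * A * ?p"
    by (simp add: distrib_square[of _ n] assoc_square[of _ n])
  then have "(R * mat_poly n A (c # cs)) $$ (i, j) = c * R $$ (i, j) + (R * A * ?p) $$ (i, j)"
    using ij carrier_matD[OF mult_carrier_square[of "R * A" n ?p]] carrier_matD[OF Cons.prems]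
    by (simp del: index_mult_mat mat_poly.simps)
  also have "(R * A * ?p) $$ (i, j) = (\<Sum>t<length cs. cs ! t * (R * A ^\<^sub>m Suc t) $$ (i, j))"
    by (subst Cons.IH) (simp_all del: index_mult_mat(1) pow_mat.simps
        add: assoc_square[of _ n] pow_mat_Suc_left[of _ n] pow_mat.simps(2))
  finally show ?case
    by (simp del: index_mult_mat(1) pow_mat.simps sum.lessThan_Suc
        add: sum.lessThan_Suc_shift pow_mat_0_square[of _ n])
qed (use ij in simp)

lemma ex_annihilating_poly:
  assumes A: "A \<in> carrier_mat n n"
  shows "\<exists>cs. (\<exists>c\<in>set cs. c \<noteq> 0) \<and> mat_poly n A cs = 0\<^sub>m n n"
proof -
  define N where "N = n * n"
  \<comment> \<open>Column \<open>j\<close> holds the \<open>n * n\<close> entries of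
    \<open>A^j\<close>. The extra zero row makes the matrix square and singular; the entries of a
    kernel vector are the coefficients of the relation.\<close>
  define W where "W = mat (Suc N) (Suc N)
    (\<lambda>(i, j). if i < N then (A ^\<^sub>m j) $$ (i div n, i mod n) else 0)"
  have W: "W \<in> carrier_mat (Suc N) (Suc N)" by (simp add: W_def)
  have "det W = 0"
  proof -
    have "(\<Prod>i = 0..<Suc N. W $$ (i, p i)) = 0" if "p permutes {0..<Suc N}" for p
    proof (rule prod_zero)
      show "\<exists>a\<in>{0..<Suc N}. W $$ (a, p a) = 0"
        using permutes_in_image[OF that, of N] by (intro bexI[of _ N]) (auto simp: W_def)
    qed simp
    then show ?thesis by (auto simp: det_def'[OF W] simp del: prod.op_ivl_Suc intro!: sum.neutral)
  qed
  then obtain v where v: "v \<in> carrier_vec (Suc N)" "v \<noteq> 0\<^sub>v (Suc N)" "W *\<^sub>v v = 0\<^sub>v (Suc N)"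
    using det_0_iff_vec_prod_zero[OF W] by blast
  have "mat_poly n A (list_of_vec v) = 0\<^sub>m n n"
  proof (rule eq_matI)
    fix i j assume "i < dim_row (0\<^sub>m n n :: complex mat)" "j < dim_col (0\<^sub>m n n :: complex mat)"
    then have ij: "i < n" "j < n" by auto
    let ?k = "i * n + j"
    have "(i + 1) * n \<le> n * n" using ij by (intro mult_right_mono) auto
    then have k: "?k < N" using ij by (simp add: N_def algebra_simps)
    have "0 = (W *\<^sub>v v) $ ?k" using v k by simp
    also have "\<dots> = (\<Sum>t<Suc N. v $ t * (A ^\<^sub>m t) $$ (i, j))"
      using k ij v(1) by (simp add: W_def scalar_prod_def row_def atLeast0LessThan mult.commute
          del: sum.lessThan_Suc)
    also have "\<dots> = (1\<^sub>m n * mat_poly n A (list_of_vec v)) $$ (i, j)"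
      using v(1) A ij by (subst mat_poly_mult_index[OF A]) (auto simp: list_of_vec_index simp del: sum.lessThan_Suc index_mult_mat(1))
    finally show "mat_poly n A (list_of_vec v) $$ (i, j) = 0\<^sub>m n n $$ (i, j)"
      using A ij by simp
  qed (use mat_poly_carrier[OF A] in auto)
  moreover have "\<exists>c\<in>set (list_of_vec v). c \<noteq> 0"
  proof (rule ccontr)
    assume "\<not> ?thesis"
    then have "v = 0\<^sub>v (Suc N)" using v(1) by (intro eq_vecI) (auto simp: set_list_of_vec vec_set_def)
    with v show False by simp
  qed
  ultimately show ?thesis by blast
qed

lemma smult_one_mult_vec: "x \<in> carrier_vec n \<Longrightarrow> (c \<cdot>\<^sub>m 1\<^sub>m n) *\<^sub>v x = c \<cdot>\<^sub>v (x :: complex vec)"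
  by (simp add: vec_eq_iff row_smult)

lemma zero_mult_vec: "x \<in> carrier_vec n \<Longrightarrow> 0\<^sub>m m n *\<^sub>v x = 0\<^sub>v m"
  "x \<in> carrier_vec n \<Longrightarrow> 0 \<cdot>\<^sub>v x = (0\<^sub>v n :: complex vec)"
  by (auto simp: vec_eq_iff)

text \<open>Take a nontrivial polynomial relation \<open>p(H) y = 0\<close>. Injectivity cancels
  factors \<open>H\<close> until the constant coefficient is nonzero; then the relation can be
  solved for \<open>y\<close>, which becomes \<open>H\<close> applied to a vector of
  \<open>S\<close>.\<close>

lemma injective_on_subspace_imp_surjective:
  fixes H :: "complex mat"
  assumes H: "H \<in> carrier_mat n n" and S: "S \<subseteq> carrier_vec n"
    and add: "\<And>x y. x \<in> S \<Longrightarrow> y \<in> S \<Longrightarrow> x + y \<in> S"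
    and smult: "\<And>c x. x \<in> S \<Longrightarrow> c \<cdot>\<^sub>v x \<in> S"
    and closed: "\<And>x. x \<in> S \<Longrightarrow> H *\<^sub>v x \<in> S"
    and inj: "\<And>x. x \<in> S \<Longrightarrow> H *\<^sub>v x = 0\<^sub>v n \<Longrightarrow> x = 0\<^sub>v n"
    and y: "y \<in> S"
  shows "\<exists>x\<in>S. H *\<^sub>v x = y"
proof -
  note carr = subsetD[OF S]
  have split: "mat_poly n H (c # cs) *\<^sub>v y = c \<cdot>\<^sub>v y + H *\<^sub>v (mat_poly n H cs *\<^sub>v y)" for c cs
    using H carr[OF y] mat_poly_carrier[OF H, of cs]
    by (simp add: add_mult_distrib_mat_vec[of _ n n] assoc_mult_mat_vec[of _ n n _ n] smult_one_mult_vec)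
  have poly: "mat_poly n H cs *\<^sub>v y \<in> S" for cs
  proof (induction cs)
    case Nil
    have "mat_poly n H [] *\<^sub>v y = (0 :: complex) \<cdot>\<^sub>v y" using carr[OF y] by (auto intro!: eq_vecI)
    then show ?case using smult[OF y] by simp
  next
    case (Cons c cs)
    then show ?case unfolding split by (intro add smult y closed)
  qed
  have *: "\<exists>x\<in>S. H *\<^sub>v x = y" if "\<exists>c\<in>set cs. c \<noteq> 0" "mat_poly n H cs *\<^sub>v y = 0\<^sub>v n" for cs
    using that
  proof (induction cs)
    case (Cons c cs)
    let ?z = "mat_poly n H cs *\<^sub>v y"
    have eq: "c \<cdot>\<^sub>v y + H *\<^sub>v ?z = 0\<^sub>v n" using Cons.prems(2) split by simp
    have z: "?z \<in> carrier_vec n" "H *\<^sub>v ?z \<in> carrier_vec n"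
      using carr poly[of cs] H by auto
    show ?case
    proof (cases "c = 0")
      case True
      have "H *\<^sub>v ?z = 0\<^sub>v n"
        using eq z carr[OF y] True by (simp add: zero_mult_vec)
      then have "?z = 0\<^sub>v n" using inj poly by blast
      with Cons True show ?thesis by auto
    next
      case False
      have "H *\<^sub>v ((- inverse c) \<cdot>\<^sub>v ?z) = (- inverse c) \<cdot>\<^sub>v (H *\<^sub>v ?z)"
        using H z by (simp add: mult_mat_vec)
      also have "\<dots> = y"
      proof (rule eq_vecI)
        fix i assume "i < dim_vec y"
        then have i: "i < n" using carr[OF y] by auto
        have "(c \<cdot>\<^sub>v y + H *\<^sub>v ?z) $ i = 0" using eq i by simp
        then have "c * y $ i + (H *\<^sub>v ?z) $ i = 0"
          using i carr[OF y] z H by (simp del: index_mult_mat_vec)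
        then have "(H *\<^sub>v ?z) $ i = - (c * y $ i)" by (simp add: add_eq_0_iff)
        then show "(- inverse c \<cdot>\<^sub>v (H *\<^sub>v ?z)) $ i = y $ i"
          using i z(2) H False by (simp del: index_mult_mat_vec)
      qed (use carr[OF y] H in auto)
      finally show ?thesis using smult[OF poly] by blast
    qed
  qed simp
  obtain cs where "\<exists>c\<in>set cs. c \<noteq> 0" "mat_poly n H cs = 0\<^sub>m n n"
    using ex_annihilating_poly[OF H] by blast
  then show ?thesis using *[of cs] carr[OF y] by (simp add: zero_mult_vec)
qed

section \<open>Sequences of last coordinates on kernels of powers\<close>

definition pow_kernel :: "nat \<Rightarrow> nat \<Rightarrow> complex mat \<Rightarrow> complex vec set" where
  "pow_kernel n k M = {x \<in> carrier_vec n. M ^\<^sub>m k *\<^sub>v x = 0\<^sub>v n}"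

text \<open>The numbers \<phi> \<open>M^j x\<close>. For \<open>M = A - a\<close> and
  \<open>x\<close> in the kernel of \<open>M^k\<close>, the vectors \<open>M^j x\<close> form a
  Jordan chain, and the sequence read backwards is the last row of the matrix whose columns are that
  chain.\<close>

definition last_seq :: "nat \<Rightarrow> complex mat \<Rightarrow> complex vec \<Rightarrow> nat \<Rightarrow> complex" where
  "last_seq n M x j = (M ^\<^sub>m j *\<^sub>v x) $ (n - 1)"

lemma pow_mult_vec_Suc:
  assumes "M \<in> carrier_mat n n" "x \<in> carrier_vec n"
  shows "M ^\<^sub>m j *\<^sub>v (M *\<^sub>v x) = M ^\<^sub>m Suc j *\<^sub>v x" "M *\<^sub>v (M ^\<^sub>m j *\<^sub>v x) = M ^\<^sub>m Suc j *\<^sub>v x"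
  using assms by (simp_all add: assoc_mult_mat_vec[of _ n n _ n, symmetric] pow_mat_Suc_left[of _ n])

lemma last_seq_linear:
  assumes "0 < n" "M \<in> carrier_mat n n" "x \<in> carrier_vec n" "y \<in> carrier_vec n"
  shows "last_seq n M (x + y) j = last_seq n M x j + last_seq n M y j"
    and "last_seq n M (c \<cdot>\<^sub>v x) j = c * last_seq n M x j"
  using assms pow_carrier_mat[of M n j]
  by (simp_all add: last_seq_def mult_add_distrib_mat_vec[of _ n n] mult_mat_vec[of _ n n] del: index_mult_mat_vec)

lemma pow_kernel_subspace:
  assumes "M \<in> carrier_mat n n" "x \<in> pow_kernel n k M"
  shows "y \<in> pow_kernel n k M \<Longrightarrow> x + y \<in> pow_kernel n k M"
    and "c \<cdot>\<^sub>v x \<in> pow_kernel n k M"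
    and "M *\<^sub>v x \<in> pow_kernel n k M"
proof -
  have x: "x \<in> carrier_vec n" "M ^\<^sub>m k *\<^sub>v x = 0\<^sub>v n" using assms by (auto simp: pow_kernel_def)
  note Mk = pow_carrier_mat[OF assms(1), of k]
  show "x + y \<in> pow_kernel n k M" if "y \<in> pow_kernel n k M"
    using that x Mk by (auto simp: pow_kernel_def mult_add_distrib_mat_vec[of _ n n])
  show "c \<cdot>\<^sub>v x \<in> pow_kernel n k M"
    using x Mk by (auto simp: pow_kernel_def mult_mat_vec[of _ n n])
  have "M ^\<^sub>m k *\<^sub>v (M *\<^sub>v x) = M *\<^sub>v 0\<^sub>v n"
    using assms(1) x pow_mult_vec_Suc[of M n x k] by simp
  then show "M *\<^sub>v x \<in> pow_kernel n k M"
    using assms(1) x by (auto simp: pow_kernel_def)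
qed

lemma last_seq_shift:
  assumes "M \<in> carrier_mat n n" "x \<in> carrier_vec n"
  shows "last_seq n M (M *\<^sub>v x) j = last_seq n M x (Suc j)"
  using assms by (simp add: last_seq_def pow_mult_vec_Suc[of M n x j])

lemma last_seq_pow_kernel:
  assumes "0 < n" "M \<in> carrier_mat n n" "x \<in> pow_kernel n k M" "k \<le> j"
  shows "last_seq n M x j = 0"
proof -
  have x: "x \<in> carrier_vec n" "M ^\<^sub>m k *\<^sub>v x = 0\<^sub>v n" using assms by (auto simp: pow_kernel_def)
  have "M ^\<^sub>m (k + i) *\<^sub>v x = 0\<^sub>v n" for i
  proof (induction i)
    case (Suc i)
    have "M ^\<^sub>m (k + Suc i) *\<^sub>v x = M *\<^sub>v (M ^\<^sub>m (k + i) *\<^sub>v x)"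
      using pow_mult_vec_Suc(2)[OF assms(2) x(1), of "k + i"] by simp
    then show ?case using assms(2) by (simp add: Suc vec_eq_iff)
  qed (use x in simp)
  from this[of "j - k"] show ?thesis using assms(1,4) by (simp add: last_seq_def)
qed

text \<open>The sequences \<open>last_seq n M y\<close> with \<open>y\<close> in the kernel form a subspace that is closed under the
  left shift. Such a subspace consists of all sequences supported below some \<open>l\<close>, so that it is
  determined by its dimension.\<close>

lemma last_seq_attains_below:
  assumes n: "0 < n" and M: "M \<in> carrier_mat n n" and x: "x \<in> pow_kernel n k M"
    and "l = 0 \<or> last_seq n M x (l - 1) \<noteq> 0" "\<And>j. l \<le> j \<Longrightarrow> last_seq n M x j = 0"
  shows "\<exists>y\<in>pow_kernel n k M. \<forall>j. last_seq n M y j = (if j < l then t j else 0)"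
  using x assms(4,5)
proof (induction l arbitrary: x t)
  case 0
  then show ?case by (intro bexI[of _ x]) auto
next
  case (Suc l)
  have carr: "x \<in> carrier_vec n" using Suc.prems by (simp add: pow_kernel_def)
  \<comment> \<open>The multiple \<open>c\<close> of \<open>x\<close> settles index
    \<open>l\<close>. The indices below are left to the induction hypothesis for
    \<open>M *\<^sub>v x\<close>, whose sequence is that of \<open>x\<close> shifted to the
    left.\<close>
  define c where "c = t l / last_seq n M x l"
  have "\<exists>y\<in>pow_kernel n k M. \<forall>j. last_seq n M y j = (if j < l then t j - c * last_seq n M x j else 0)"
    using Suc.prems
    by (intro Suc.IH[of "M *\<^sub>v x"])
       (auto simp: last_seq_shift[OF M carr] pow_kernel_subspace[OF M] gr0_conv_Suc)
  then obtain y where y: "y \<in> pow_kernel n k M"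
    "\<And>j. last_seq n M y j = (if j < l then t j - c * last_seq n M x j else 0)" by blast
  have y': "y \<in> carrier_vec n" using y by (simp add: pow_kernel_def)
  have "c * last_seq n M x l = t l" using Suc.prems by (simp add: c_def)
  then have "last_seq n M (y + c \<cdot>\<^sub>v x) j = (if j < Suc l then t j else 0)" for j
    using Suc.prems(3)[of j] carr y' 
    by (auto simp: last_seq_linear[OF n M] y(2) less_Suc_eq)
  then show ?case
    using y Suc.prems by (intro bexI[of _ "y + c \<cdot>\<^sub>v x"] pow_kernel_subspace[OF M]) auto
qed

text \<open>A vector with zero last coordinate does not see the last column, where alone the
  matrices differ. The vanishing of the whole sequence says that every iterate of \<open>x\<close>
  is such a vector.\<close>

lemma pow_mult_vec_same_columns:
  assumes n: "0 < n" and [simp]: "M \<in> carrier_mat n n" "M' \<in> carrier_mat n n"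
    and same: "\<And>i j. i < n \<Longrightarrow> j < n - 1 \<Longrightarrow> M' $$ (i, j) = M $$ (i, j)"
    and x: "x \<in> carrier_vec n" and z: "\<And>j. last_seq n M' x j = 0"
  shows "M' ^\<^sub>m j *\<^sub>v x = M ^\<^sub>m j *\<^sub>v x"
proof (induction j)
  case (Suc j)
  let ?y = "M' ^\<^sub>m j *\<^sub>v x"
  have y: "?y \<in> carrier_vec n" "?y $ (n - 1) = 0"
    using mult_mat_vec_carrier[OF pow_carrier_mat[OF assms(3)] x] z[of j] by (auto simp: last_seq_def)
  have "M' *\<^sub>v ?y = M *\<^sub>v ?y"
  proof (rule eq_vecI)
    fix i assume "i < dim_vec (M *\<^sub>v ?y)"
    then have i: "i < n" using carrier_matD[OF assms(2)] by simp
    have "row M' i \<bullet> ?y = row M i \<bullet> ?y"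
      unfolding scalar_prod_def
    proof (rule sum.cong)
      fix j assume "j \<in> {0..<dim_vec ?y}"
      then have "j < n" using carrier_vecD[OF y(1)] by simp
      then show "row M' i $ j * ?y $ j = row M i $ j * ?y $ j"
        using same[OF i, of j] y(2) i carrier_matD[OF assms(2)] carrier_matD[OF assms(3)]
        by (cases "j = n - 1") auto
    qed simp
    then show "(M' *\<^sub>v ?y) $ i = (M *\<^sub>v ?y) $ i"
      using i carrier_matD[OF assms(2)] carrier_matD[OF assms(3)] by simp
  qed (use carrier_matD[OF assms(2)] carrier_matD[OF assms(3)] in simp)
  then show ?case
    using Suc pow_mult_vec_Suc(2)[OF assms(2) x, of j] pow_mult_vec_Suc(2)[OF assms(3) x, of j]
    by (simp del: pow_mat.simps)
qed (use x in \<open>simp add: pow_mat_0_square[of _ n]\<close>)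

lemma mult_mat_vec_zero: "A \<in> carrier_mat m n \<Longrightarrow> A *\<^sub>v 0\<^sub>v n = (0\<^sub>v m :: complex vec)"
  by (intro eq_vecI) auto

lemma add_minus_vec_swap:
  "x \<in> carrier_vec n \<Longrightarrow> y \<in> carrier_vec n \<Longrightarrow> z \<in> carrier_vec n \<Longrightarrow>
    x + (y - z) = x + (- 1) \<cdot>\<^sub>v z + (y :: complex vec)"
  by (intro eq_vecI) auto

text \<open>\<open>l\<close> is one more than the largest index at which some sequence is nonzero,
  or 0 if there is none. It exists because no sequence reaches index \<open>k\<close>, and it is the
  dimension of the space of sequences.\<close>

lemma last_seq_bound:
  assumes n: "0 < n" and M: "M \<in> carrier_mat n n"
  obtains l where "\<And>y j. y \<in> pow_kernel n k M \<Longrightarrow> l \<le> j \<Longrightarrow> last_seq n M y j = 0"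
    and "\<And>t. \<exists>y\<in>pow_kernel n k M. \<forall>j. last_seq n M y j = (if j < l then t j else 0)"
proof -
  define T where "T = {j. \<exists>y\<in>pow_kernel n k M. last_seq n M y j \<noteq> 0}"
  have "T \<subseteq> {..<k}"
    using last_seq_pow_kernel[OF n M] by (force simp: T_def not_le[symmetric])
  then have fin: "finite T" by (rule finite_subset) simp
  show thesis
  proof (cases "T = {}")
    case True
    have "0\<^sub>v n \<in> pow_kernel n k M"
      using pow_carrier_mat[OF M, of k] by (auto simp: pow_kernel_def mult_mat_vec_zero)
    with True show thesis by (intro that[of 0]) (auto simp: T_def)
  next
    case False
    then obtain y where y: "y \<in> pow_kernel n k M" "last_seq n M y (Max T) \<noteq> 0"
      using Max_in[OF fin] by (auto simp: T_def)
    have z: "last_seq n M y j = 0" if "y \<in> pow_kernel n k M" "Suc (Max T) \<le> j" for y j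
      using Max_ge[OF fin, of j] that by (auto simp: T_def)
    show thesis
      using last_seq_attains_below[OF n M y(1), of "Suc (Max T)"] y z by (intro that[of "Suc (Max T)"]) auto
  qed
qed

text \<open>\<open>\<Gamma>\<close> is a linear right inverse, on sequences supported below
  \<open>l\<close>, of the map from vectors to sequences; its columns are preimages of the unit
  sequences.\<close>

lemma last_seq_mat_mult_vec:
  assumes n: "0 < n" and M: "M \<in> carrier_mat n n"
    and \<gamma>: "\<And>i. i < l \<Longrightarrow> \<gamma> i \<in> pow_kernel n k M"
      "\<And>i j. i < l \<Longrightarrow> last_seq n M (\<gamma> i) j = (if j = i then 1 else 0)"
    and s: "s \<in> carrier_vec l"
  defines "\<Gamma> \<equiv> mat n l (\<lambda>(r, i). \<gamma> i $ r)"
  shows "\<Gamma> *\<^sub>v s \<in> pow_kernel n k M"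
    and "last_seq n M (\<Gamma> *\<^sub>v s) j = (if j < l then s $ j else 0)"
proof -
  have \<Gamma>: "\<Gamma> \<in> carrier_mat n l" by (simp add: \<Gamma>_def)
  have carr: "\<gamma> i \<in> carrier_vec n" "M ^\<^sub>m k *\<^sub>v \<gamma> i = 0\<^sub>v n" if "i < l" for i using that \<gamma>(1) by (auto simp: pow_kernel_def)
  have col: "col \<Gamma> i = \<gamma> i" if "i < l" for i
    using that carrier_vecD[OF carr(1)[OF that]] by (auto simp: \<Gamma>_def)
  note Mj = pow_carrier_mat[OF M]
  have entry: "(M ^\<^sub>m j * \<Gamma>) $$ (r, i) = (M ^\<^sub>m j *\<^sub>v \<gamma> i) $ r" if "r < n" "i < l" for j r i
    using that carrier_matD[OF Mj[of j]] carrier_matD[OF \<Gamma>] by (simp add: col)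
  have mult: "M ^\<^sub>m j *\<^sub>v (\<Gamma> *\<^sub>v s) = (M ^\<^sub>m j * \<Gamma>) *\<^sub>v s" for j
    using Mj \<Gamma> s by (simp add: assoc_mult_mat_vec[of _ n n _ l])
  have "M ^\<^sub>m k * \<Gamma> = 0\<^sub>m n l"
    using entry[of _ _ k] carrier_matD[OF Mj[of k]] carrier_matD[OF \<Gamma>]
    by (intro eq_matI) (simp_all add: carr del: index_mult_mat(1))
  then show "\<Gamma> *\<^sub>v s \<in> pow_kernel n k M"
    using s \<Gamma> by (simp add: pow_kernel_def mult zero_mult_vec)
  have "last_seq n M (\<Gamma> *\<^sub>v s) j = (\<Sum>i<l. (M ^\<^sub>m j * \<Gamma>) $$ (n - 1, i) * s $ i)"
    unfolding last_seq_def mult using n s carrier_matD[OF \<Gamma>] carrier_matD[OF Mj[of j]]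
    by (simp add: scalar_prod_def atLeast0LessThan del: index_mult_mat(1))
  also have "\<dots> = (\<Sum>i<l. (if j = i then 1 else 0) * s $ i)"
    using entry[of "n - 1"] n \<gamma>(2) by (intro sum.cong) (simp_all add: last_seq_def del: index_mult_mat(1))
  also have "\<dots> = (if j < l then s $ j else 0)"
    by (simp add: if_distrib[of "\<lambda>x. x * _"] cong: if_cong)
  finally show "last_seq n M (\<Gamma> *\<^sub>v s) j = (if j < l then s $ j else 0)" .
qed

text \<open>The vectors with zero sequence are common to both kernels, since the iterates under
  \<open>M\<close> and \<open>M'\<close> agree on them, and \<open>g\<close> makes the kernels
  equally large. So the spaces of sequences have equal dimension, hence equal thresholds;
  \<open>l \<le> l'\<close> is the inequality that permits the transfer from \<open>M\<close> to
  \<open>M'\<close>.\<close>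

lemma last_seq_transfer:
  assumes n: "0 < n" and M: "M \<in> carrier_mat n n" and M': "M' \<in> carrier_mat n n"
    and same: "\<And>i j. i < n \<Longrightarrow> j < n - 1 \<Longrightarrow> M' $$ (i, j) = M $$ (i, j)"
    and g: "g \<in> carrier_mat n n" "det g \<noteq> 0" "g * M = M' * g"
    and x: "x \<in> pow_kernel n k M"
  shows "\<exists>x'\<in>pow_kernel n k M'. \<forall>j. last_seq n M' x' j = last_seq n M x j"
proof -
  obtain l where l: "\<And>y j. y \<in> pow_kernel n k M \<Longrightarrow> l \<le> j \<Longrightarrow> last_seq n M y j = 0"
    "\<And>t. \<exists>y\<in>pow_kernel n k M. \<forall>j. last_seq n M y j = (if j < l then t j else 0)"
    using last_seq_bound[OF n M] by blast
  obtain l' where l': "\<And>y j. y \<in> pow_kernel n k M' \<Longrightarrow> l' \<le> j \<Longrightarrow> last_seq n M' y j = 0"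
    "\<And>t. \<exists>y\<in>pow_kernel n k M'. \<forall>j. last_seq n M' y j = (if j < l' then t j else 0)"
    using last_seq_bound[OF n M'] by blast
  have "l \<le> l'"
  proof (rule ccontr)
    assume "\<not> l \<le> l'"
    then have less: "l' < l" by simp
    have "\<exists>y\<in>pow_kernel n k M. i < l \<longrightarrow> (\<forall>j. last_seq n M y j = (if j = i then 1 else 0))" for i
    proof -
      obtain y where "y \<in> pow_kernel n k M"
        "\<forall>j. last_seq n M y j = (if j < l then if j = i then 1 else 0 else 0)"
        using l(2)[of "\<lambda>j. if j = i then 1 else 0"] by blast
      then show ?thesis by (intro bexI[of _ y]) auto
    qed
    then obtain \<gamma> where \<gamma>: "\<And>i. \<gamma> i \<in> pow_kernel n k M"
      "\<And>i j. i < l \<Longrightarrow> last_seq n M (\<gamma> i) j = (if j = i then 1 else 0)" by metis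
    have "\<exists>y\<in>pow_kernel n k M'. i < l' \<longrightarrow> (\<forall>j. last_seq n M' y j = (if j = i then 1 else 0))" for i
    proof -
      obtain y where "y \<in> pow_kernel n k M'"
        "\<forall>j. last_seq n M' y j = (if j < l' then if j = i then 1 else 0 else 0)"
        using l'(2)[of "\<lambda>j. if j = i then 1 else 0"] by blast
      then show ?thesis by (intro bexI[of _ y]) auto
    qed
    then obtain b where b: "\<And>i. b i \<in> pow_kernel n k M'"
      "\<And>i j. i < l' \<Longrightarrow> last_seq n M' (b i) j = (if j = i then 1 else 0)" by metis
    \<comment> \<open>The map \<open>y \<mapsto> y + (\<Gamma> - B) S y\<close> embeds the kernel of \<open>M'\<^sup>k\<close> into that of \<open>M\<^sup>k\<close> and misses
      \<open>\<gamma> l'\<close>. As \<open>g\<close> identifies the two kernels, this is impossible for reasons of dimension.\<close>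
    define \<Gamma> where "\<Gamma> = mat n l' (\<lambda>(r, i). \<gamma> i $ r)"
    define B where "B = mat n l' (\<lambda>(r, i). b i $ r)"
    \<comment> \<open>\<open>S y\<close> lists the first \<open>l'\<close> terms of the sequence of
      \<open>y\<close>. Then \<open>D\<close> subtracts from \<open>y\<close> a vector of the kernel
      of \<open>M'^k\<close> with the same sequence and adds a vector of the kernel of
      \<open>M^k\<close> with that sequence.\<close>
    define S where "S = mat l' n (\<lambda>(i, c). (M' ^\<^sub>m i) $$ (n - 1, c))"
    define D where "D = 1\<^sub>m n + (\<Gamma> - B) * S"
    have carr: "\<Gamma> \<in> carrier_mat n l'" "B \<in> carrier_mat n l'" "S \<in> carrier_mat l' n"
      by (simp_all add: \<Gamma>_def B_def S_def)
    have \<Gamma>B: "\<Gamma> - B \<in> carrier_mat n l'" using carr(2) by (rule minus_carrier_mat)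
    have D: "D \<in> carrier_mat n n"
      unfolding D_def by (intro add_carrier_mat mult_carrier_mat[OF \<Gamma>B carr(3)])
    have \<Gamma>s: "\<Gamma> *\<^sub>v s \<in> pow_kernel n k M" "last_seq n M (\<Gamma> *\<^sub>v s) j = (if j < l' then s $ j else 0)"
      if "s \<in> carrier_vec l'" for s j
      unfolding \<Gamma>_def using \<gamma> less that by (intro last_seq_mat_mult_vec[OF n M]; simp)+
    have Bs: "B *\<^sub>v s \<in> pow_kernel n k M'" "last_seq n M' (B *\<^sub>v s) j = (if j < l' then s $ j else 0)"
      if "s \<in> carrier_vec l'" for s j
      unfolding B_def using b that by (intro last_seq_mat_mult_vec[OF n M']; simp)+
    have Dy: "D *\<^sub>v y = y + (\<Gamma> *\<^sub>v s - B *\<^sub>v s)" "D *\<^sub>v y \<in> pow_kernel n k M"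
        "last_seq n M (D *\<^sub>v y) j = (if j < l' then last_seq n M' y j else 0)"
      if y: "y \<in> pow_kernel n k M'" and s_def: "s = vec l' (last_seq n M' y)" for y s j
    proof -
      have yc: "y \<in> carrier_vec n" using y by (simp add: pow_kernel_def)
      have s: "s \<in> carrier_vec l'" by (simp add: s_def)
      have "S *\<^sub>v y = s"
      proof (rule eq_vecI)
        fix i assume "i < dim_vec s"
        then have i: "i < l'" using s by simp
        have "row S i = row (M' ^\<^sub>m i) (n - 1)"
          using i n carrier_matD[OF pow_carrier_mat[OF M', of i]] by (intro eq_vecI) (simp_all add: S_def)
        then show "(S *\<^sub>v y) $ i = s $ i"
          using i n carr carrier_matD[OF pow_carrier_mat[OF M', of i]] by (simp add: s_def last_seq_def)
      qed (use carr s in simp)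
      then show D1: "D *\<^sub>v y = y + (\<Gamma> *\<^sub>v s - B *\<^sub>v s)"
        using carr yc s \<Gamma>B mult_carrier_mat[OF \<Gamma>B carr(3)]
        by (simp add: D_def add_mult_distrib_mat_vec[of _ n n] assoc_mult_mat_vec[of _ n l' _ n]
            minus_mult_distrib_mat_vec[of _ n l'])
      \<comment> \<open>What remains of \<open>y\<close> has zero sequence, so the powers of
        \<open>M\<close> and \<open>M'\<close> agree on it and it lies in both kernels.\<close>
      define \<kappa> where "\<kappa> = y + (- 1) \<cdot>\<^sub>v (B *\<^sub>v s)"
      have Bc: "B *\<^sub>v s \<in> carrier_vec n" "\<Gamma> *\<^sub>v s \<in> carrier_vec n" using carr s by auto
      have \<kappa>: "\<kappa> \<in> pow_kernel n k M'"
        unfolding \<kappa>_def by (intro pow_kernel_subspace(1,2)[OF M'] y Bs(1) s)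
      then have \<kappa>c: "\<kappa> \<in> carrier_vec n" by (simp add: pow_kernel_def)
      have "last_seq n M' \<kappa> j = last_seq n M' y j - last_seq n M' (B *\<^sub>v s) j" for j
        using last_seq_linear(1)[OF n M' yc, of "(- 1) \<cdot>\<^sub>v (B *\<^sub>v s)" j]
          last_seq_linear(2)[OF n M' Bc(1) Bc(1), of "- 1" j] Bc by (simp add: \<kappa>_def)
      then have z: "last_seq n M' \<kappa> j = 0" for j
        using Bs(2)[OF s, of j] l'(1)[OF y, of j] by (auto simp: s_def)
      have same': "M' ^\<^sub>m j *\<^sub>v \<kappa> = M ^\<^sub>m j *\<^sub>v \<kappa>" for j
        by (rule pow_mult_vec_same_columns[OF n M M' same \<kappa>c z])
      have \<kappa>M: "\<kappa> \<in> pow_kernel n k M" "last_seq n M \<kappa> j = 0" for j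
        using \<kappa> z[of j] by (simp_all add: pow_kernel_def last_seq_def same')
      have D2: "D *\<^sub>v y = \<kappa> + \<Gamma> *\<^sub>v s"
        unfolding D1 \<kappa>_def by (rule add_minus_vec_swap[OF yc Bc(2,1)])
      show "D *\<^sub>v y \<in> pow_kernel n k M"
        unfolding D2 by (intro pow_kernel_subspace(1)[OF M] \<Gamma>s(1) s \<kappa>M)
      show "last_seq n M (D *\<^sub>v y) j = (if j < l' then last_seq n M' y j else 0)"
        unfolding D2 using \<kappa>M(2)[of j] \<Gamma>s(2)[OF s, of j]
        by (subst last_seq_linear[OF n M \<kappa>c Bc(2)]) (simp add: s_def)
    qed
    have gx: "g *\<^sub>v x \<in> pow_kernel n k M'" if "x \<in> pow_kernel n k M" for x
    proof -
      have x: "x \<in> carrier_vec n" "M ^\<^sub>m k *\<^sub>v x = 0\<^sub>v n" using that by (simp_all add: pow_kernel_def)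
      have "M' ^\<^sub>m k *\<^sub>v (g *\<^sub>v x) = (M' ^\<^sub>m k * g) *\<^sub>v x"
        by (rule assoc_mult_mat_vec[symmetric, OF pow_carrier_mat[OF M'] g(1) x(1)])
      also have "M' ^\<^sub>m k * g = g * M ^\<^sub>m k"
        by (rule pow_mat_intertwine[OF M M' g(1) g(3), symmetric])
      also have "(g * M ^\<^sub>m k) *\<^sub>v x = g *\<^sub>v (M ^\<^sub>m k *\<^sub>v x)"
        by (rule assoc_mult_mat_vec[OF g(1) pow_carrier_mat[OF M] x(1)])
      finally have "M' ^\<^sub>m k *\<^sub>v (g *\<^sub>v x) = 0\<^sub>v n"
        unfolding x(2) mult_mat_vec_zero[OF g(1)] .
      then show ?thesis
        using mult_mat_vec_carrier[OF g(1) x(1)] by (simp add: pow_kernel_def)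
    qed
    have Dg: "(D * g) *\<^sub>v x = D *\<^sub>v (g *\<^sub>v x)" if "x \<in> pow_kernel n k M" for x
      using that assoc_mult_mat_vec[OF D g(1)] by (simp add: pow_kernel_def)
    have "\<exists>x\<in>pow_kernel n k M. (D * g) *\<^sub>v x = \<gamma> l'"
    proof (rule injective_on_subspace_imp_surjective)
      show "D * g \<in> carrier_mat n n" using D g(1) by simp
      show "x = 0\<^sub>v n" if x: "x \<in> pow_kernel n k M" and "(D * g) *\<^sub>v x = 0\<^sub>v n" for x
      proof -
        let ?y = "g *\<^sub>v x"
        have Dz: "D *\<^sub>v ?y = 0\<^sub>v n" using that by (simp add: Dg)
        have "last_seq n M (D *\<^sub>v ?y) j = 0" for j
          using n pow_carrier_mat[OF M, of j] unfolding Dz by (simp add: last_seq_def mult_mat_vec_zero)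
        then have "last_seq n M' ?y j = 0" if "j < l'" for j
          using Dy(3)[OF gx[OF x] refl, of j] that by simp
        then have s: "vec l' (last_seq n M' ?y) = 0\<^sub>v l'" by auto
        have yc: "?y \<in> carrier_vec n" using gx[OF x] by (simp add: pow_kernel_def)
        have "?y = 0\<^sub>v n"
          using Dy(1)[OF gx[OF x] refl] yc carr unfolding Dz s by (simp add: mult_mat_vec_zero)
        moreover obtain h where "h \<in> carrier_mat n n" "h * g = 1\<^sub>m n"
          using det_nonzero_inverse[OF g(1,2)] by metis
        ultimately show ?thesis
          using x g(1) assoc_mult_mat_vec[of h n n g n x] by (simp add: pow_kernel_def mult_mat_vec_zero)
      qed
      show "(D * g) *\<^sub>v x \<in> pow_kernel n k M" if "x \<in> pow_kernel n k M" for x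
        using Dy(2)[OF gx[OF that] refl] that by (simp add: Dg)
      show "pow_kernel n k M \<subseteq> carrier_vec n" by (auto simp: pow_kernel_def)
    qed (fact pow_kernel_subspace(1,2)[OF M] \<gamma>(1))+
    then obtain x where x: "x \<in> pow_kernel n k M" "(D * g) *\<^sub>v x = \<gamma> l'" by blast
    then have "last_seq n M (\<gamma> l') l' = 0"
      using Dy(3)[OF gx[OF x(1)] refl, of l'] by (simp add: Dg)
    with \<gamma>(2)[OF less, of l'] show False by simp
  qed
  obtain x' where "x' \<in> pow_kernel n k M'"
    "\<And>j. last_seq n M' x' j = (if j < l' then last_seq n M x j else 0)"
    using l'(2)[of "last_seq n M x"] by blast
  then show ?thesis using l(1)[OF x] \<open>l \<le> l'\<close> by (intro bexI[of _ x']) (auto simp: not_less)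
qed

section \<open>Jordan chains and their assembly\<close>

lemma mult_jordan_block_index:
  assumes P: "P \<in> carrier_mat n k" and ij: "i < n" "j < k"
  shows "(P * jordan_block k a) $$ (i, j) = a * P $$ (i, j) + (if j = 0 then 0 else P $$ (i, j - 1 :: nat) :: complex)"
proof -
  have "(P * jordan_block k a) $$ (i, j) = (\<Sum>r<k. P $$ (i, r) * (if r = j then a else if Suc r = j then 1 else 0))"
    using P ij by (auto simp: scalar_prod_def atLeast0LessThan jordan_block_def intro!: sum.cong)
  also have "\<dots> = (\<Sum>r<k. if r = j then P $$ (i, r) * a else 0) + (\<Sum>r<k. if Suc r = j then P $$ (i, r) else 0)"
    by (subst sum.distrib[symmetric], rule sum.cong) auto
  also have "(\<Sum>r<k. if r = j then P $$ (i, r) * a else 0) = a * P $$ (i, j)"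
    using ij by simp
  also have "(\<Sum>r<k. if Suc r = j then P $$ (i, r) else 0) = (if j = 0 then 0 else P $$ (i, j - 1))"
    using ij by (cases j) auto
  finally show ?thesis .
qed

text \<open>As \<open>jordan_block\<close> is upper triangular, the equation for \<open>P\<close>
  says that its columns form a chain under \<open>A - a\<close> generated by the last one. Only this
  generator is transferred; its iterates under \<open>A' - a\<close> are the columns of
  \<open>Z\<close>.\<close>

lemma jordan_block_transfer:
  fixes A A' g P :: "complex mat"
  assumes n: "0 < n" and A: "A \<in> carrier_mat n n" and A': "A' \<in> carrier_mat n n"
    and same: "\<And>i j. i < n \<Longrightarrow> j < n - 1 \<Longrightarrow> A' $$ (i, j) = A $$ (i, j)"
    and g: "g \<in> carrier_mat n n" "det g \<noteq> 0" "g * A = A' * g"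
    and P: "P \<in> carrier_mat n k" "A * P = P * jordan_block k a"
  shows "\<exists>Z\<in>carrier_mat n k. A' * Z = Z * jordan_block k a \<and> (\<forall>j<k. Z $$ (n - 1, j) = P $$ (n - 1, j))"
proof (cases "k = 0")
  case True
  then show ?thesis using P(1) A' by (intro bexI[of _ P]) (auto intro!: eq_matI)
next
  case False
  define N where "N = A + (- a) \<cdot>\<^sub>m 1\<^sub>m n"
  define N' where "N' = A' + (- a) \<cdot>\<^sub>m 1\<^sub>m n"
  have N: "N \<in> carrier_mat n n" and N': "N' \<in> carrier_mat n n" by (simp_all add: N_def N'_def)
  have gN: "g * N = N' * g"
    using A A' g by (simp add: N_def N'_def distrib_square[of _ n])
  have sameN: "N' $$ (i, j) = N $$ (i, j)" if "i < n" "j < n - 1" for i j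
    using same[OF that] that by (simp add: N_def N'_def)
  have mult_N: "M *\<^sub>v x + (- a) \<cdot>\<^sub>v x = (M + (- a) \<cdot>\<^sub>m 1\<^sub>m n) *\<^sub>v x"
    if "M \<in> carrier_mat n n" "x \<in> carrier_vec n" for M x
    using that by (simp add: add_mult_distrib_mat_vec[of _ n n] smult_one_mult_vec)
  have colP: "col P j \<in> carrier_vec n" for j using P by (simp add: carrier_vecI)
  have NP: "N *\<^sub>v col P j = (if j = 0 then 0\<^sub>v n else col P (j - 1))" if j: "j < k" for j
  proof (rule eq_vecI)
    fix i assume "i < dim_vec (if j = 0 then 0\<^sub>v n else col P (j - 1))"
    then have i: "i < n" using colP P by (auto split: if_splits)
    have "(A *\<^sub>v col P j) $ i = (A * P) $$ (i, j)" using i j A P(1) by simp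
    then have "(N *\<^sub>v col P j) $ i = (A * P) $$ (i, j) - a * P $$ (i, j)"
      unfolding N_def mult_N[OF A colP, symmetric] using i j P(1) A by simp
    then show "(N *\<^sub>v col P j) $ i = (if j = 0 then 0\<^sub>v n else col P (j - 1)) $ i"
      using i j P(1) unfolding P(2) mult_jordan_block_index[OF P(1) i j] by simp
  qed (use N P in simp)
  define b where "b = col P (k - 1)"
  have b: "b \<in> carrier_vec n" by (simp add: b_def colP)
  have Nb: "N ^\<^sub>m t *\<^sub>v b = col P (k - 1 - t)" if "t < k" for t
    using that
  proof (induction t)
    case (Suc t)
    then show ?case
      using pow_mult_vec_Suc(2)[OF N b, of t] NP[of "k - 1 - t"] by simp
  qed (use b N in \<open>simp add: pow_mat_0_square[of _ n] b_def\<close>)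
  have "N ^\<^sub>m k *\<^sub>v b = N *\<^sub>v (N ^\<^sub>m (k - 1) *\<^sub>v b)"
    using pow_mult_vec_Suc(2)[OF N b, of "k - 1"] False by simp
  then have "b \<in> pow_kernel n k N"
    using b Nb[of "k - 1"] NP[of 0] False by (simp add: pow_kernel_def)
  then obtain b' where b': "b' \<in> pow_kernel n k N'" "\<And>j. last_seq n N' b' j = last_seq n N b j"
    using last_seq_transfer[OF n N N' sameN g(1,2) gN] by blast
  have b'c: "b' \<in> carrier_vec n" using b' by (simp add: pow_kernel_def)
  define Z where "Z = mat n k (\<lambda>(i, j). (N' ^\<^sub>m (k - 1 - j) *\<^sub>v b') $ i)"
  have Z: "Z \<in> carrier_mat n k" by (simp add: Z_def)
  have colZ: "col Z j = N' ^\<^sub>m (k - 1 - j) *\<^sub>v b'" if "j < k" for j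
    using that carrier_matD[OF pow_carrier_mat[OF N', of "k - 1 - j"]]
    by (intro eq_vecI) (simp_all add: Z_def)
  have "A' * Z = Z * jordan_block k a"
  proof (rule eq_matI)
    fix i j assume "i < dim_row (Z * jordan_block k a)" "j < dim_col (Z * jordan_block k a)"
    then have ij: "i < n" "j < k" using Z by auto
    have "N' *\<^sub>v col Z j = (if j = 0 then 0\<^sub>v n else col Z (j - 1))"
      using pow_mult_vec_Suc(2)[OF N' b'c, of "k - 1 - j"] b'(1) ij
      by (auto simp: colZ pow_kernel_def Suc_diff_Suc)
    moreover have "N' *\<^sub>v col Z j = A' *\<^sub>v col Z j + (- a) \<cdot>\<^sub>v col Z j"
      unfolding N'_def using Z by (intro mult_N[OF A', symmetric]) (simp add: carrier_vecI)
    ultimately have "(A' *\<^sub>v col Z j + (- a) \<cdot>\<^sub>v col Z j) $ i = (if j = 0 then 0\<^sub>v n else col Z (j - 1)) $ i"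
      by simp
    then have "(A' * Z) $$ (i, j) - a * Z $$ (i, j) = (if j = 0 then 0 else Z $$ (i, j - 1))"
      using ij Z A' by (auto split: if_splits)
    then show "(A' * Z) $$ (i, j) = (Z * jordan_block k a) $$ (i, j)"
      unfolding mult_jordan_block_index[OF Z ij] by (simp add: algebra_simps)
  qed (use Z A' in auto)
  moreover have "Z $$ (n - 1, j) = P $$ (n - 1, j)" if "j < k" for j
    using b'(2)[of "k - 1 - j"] Nb[of "k - 1 - j"] that n P(1)
    by (simp add: Z_def last_seq_def)
  ultimately show ?thesis using Z by blast
qed

definition hcat :: "nat \<Rightarrow> nat \<Rightarrow> nat \<Rightarrow> complex mat \<Rightarrow> complex mat \<Rightarrow> complex mat" where
  "hcat n k m P Q = mat n (k + m) (\<lambda>(i, j). if j < k then P $$ (i, j) else Q $$ (i, j - k))"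

lemma mult_hcat:
  assumes "A \<in> carrier_mat n n" "P \<in> carrier_mat n k" "Q \<in> carrier_mat n m"
  shows "A * hcat n k m P Q = hcat n k m (A * P) (A * Q)"
  using assms by (intro eq_matI) (auto simp: hcat_def scalar_prod_def intro!: sum.cong)

lemma hcat_mult_diag:
  assumes "P \<in> carrier_mat n k" "Q \<in> carrier_mat n m" "J \<in> carrier_mat k k" "K \<in> carrier_mat m m"
  shows "hcat n k m P Q * four_block_mat J (0\<^sub>m k m) (0\<^sub>m m k) K = hcat n k m (P * J) (Q * K)"
proof (rule eq_matI)
  fix i j
  assume "i < dim_row (hcat n k m (P * J) (Q * K))" "j < dim_col (hcat n k m (P * J) (Q * K))"
  then have ij: "i < n" "j < k + m" by (auto simp: hcat_def)
  let ?F = "four_block_mat J (0\<^sub>m k m) (0\<^sub>m m k) K" and ?H = "hcat n k m P Q"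
  have "(?H * ?F) $$ (i, j) = (\<Sum>r<k + m. ?H $$ (i, r) * ?F $$ (r, j))"
    using ij assms by (simp add: hcat_def scalar_prod_def atLeast0LessThan)
  also have "(\<Sum>r<k + m. f r) = (\<Sum>r<k. f r) + (\<Sum>r<m. f (k + r))" for f :: "nat \<Rightarrow> complex"
    by (induction m) (simp_all add: add.assoc)
  also have "(\<Sum>r<k. ?H $$ (i, r) * ?F $$ (r, j)) + (\<Sum>r<m. ?H $$ (i, k + r) * ?F $$ (k + r, j))
      = hcat n k m (P * J) (Q * K) $$ (i, j)"
    using ij assms by (auto simp: hcat_def scalar_prod_def atLeast0LessThan)
  finally show "(?H * ?F) $$ (i, j) = hcat n k m (P * J) (Q * K) $$ (i, j)" .
qed (use assms in \<open>auto simp: hcat_def\<close>)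

lemma hcat_inject:
  assumes "P \<in> carrier_mat n k" "P' \<in> carrier_mat n k" "Q \<in> carrier_mat n m" "Q' \<in> carrier_mat n m"
    and eq: "hcat n k m P Q = hcat n k m P' Q'"
  shows "P = P'" "Q = Q'"
proof -
  show "P = P'"
  proof (rule eq_matI)
    fix i j assume "i < dim_row P'" "j < dim_col P'"
    then show "P $$ (i, j) = P' $$ (i, j)"
      using assms(1-4) arg_cong[OF eq, of "\<lambda>M. M $$ (i, j)"] by (auto simp: hcat_def)
  qed (use assms in auto)
  show "Q = Q'"
  proof (rule eq_matI)
    fix i j assume "i < dim_row Q'" "j < dim_col Q'"
    then show "Q $$ (i, j) = Q' $$ (i, j)"
      using assms(1-4) arg_cong[OF eq, of "\<lambda>M. M $$ (i, k + j)"] by (auto simp: hcat_def)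
  qed (use assms in auto)
qed

lemma jordan_matrix_transfer:
  fixes A A' g P :: "complex mat"
  assumes n: "0 < n" and A: "A \<in> carrier_mat n n" and A': "A' \<in> carrier_mat n n"
    and same: "\<And>i j. i < n \<Longrightarrow> j < n - 1 \<Longrightarrow> A' $$ (i, j) = A $$ (i, j)"
    and g: "g \<in> carrier_mat n n" "det g \<noteq> 0" "g * A = A' * g"
    and "P \<in> carrier_mat n (sum_list (map fst bs))" "A * P = P * jordan_matrix bs"
  shows "\<exists>Z\<in>carrier_mat n (sum_list (map fst bs)). A' * Z = Z * jordan_matrix bs \<and>
    (\<forall>j<sum_list (map fst bs). Z $$ (n - 1, j) = P $$ (n - 1, j))"
  using assms(8,9)
proof (induction bs arbitrary: P)
  case Nil
  then show ?case using A' by (intro bexI[of _ P]) (auto intro!: eq_matI)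
next
  case (Cons b bs)
  obtain k a where b: "b = (k, a)" by (cases b)
  define m where "m = sum_list (map fst bs)"
  define P1 where "P1 = mat n k (\<lambda>(i, j). P $$ (i, j))"
  define P2 where "P2 = mat n m (\<lambda>(i, j). P $$ (i, k + j))"
  let ?J = "jordan_block k a" and ?K = "jordan_matrix bs"
  have carr: "P1 \<in> carrier_mat n k" "P2 \<in> carrier_mat n m" "?J \<in> carrier_mat k k" "?K \<in> carrier_mat m m"
    by (simp_all add: P1_def P2_def m_def)
  have P: "P = hcat n k m P1 P2"
    using Cons.prems(1) by (intro eq_matI) (auto simp: hcat_def P1_def P2_def b m_def)
  have J: "jordan_matrix (b # bs) = four_block_mat ?J (0\<^sub>m k m) (0\<^sub>m m k) ?K"
    by (simp add: b jordan_matrix_Cons m_def)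
  have "hcat n k m (A * P1) (A * P2) = hcat n k m (P1 * ?J) (P2 * ?K)"
    using Cons.prems(2) unfolding P J
    by (simp only: mult_hcat[OF A carr(1,2)] hcat_mult_diag[OF carr])
  then have eqs: "A * P1 = P1 * ?J" "A * P2 = P2 * ?K"
    using A carr by (intro hcat_inject[of "A * P1" n k "P1 * ?J" "A * P2" m "P2 * ?K"]; simp)+
  obtain Z1 where Z1: "Z1 \<in> carrier_mat n k" "A' * Z1 = Z1 * ?J" "\<forall>j<k. Z1 $$ (n - 1, j) = P1 $$ (n - 1, j)"
    using jordan_block_transfer[OF n A A' same g carr(1) eqs(1)] by blast
  obtain Z2 where Z2: "Z2 \<in> carrier_mat n m" "A' * Z2 = Z2 * ?K" "\<forall>j<m. Z2 $$ (n - 1, j) = P2 $$ (n - 1, j)"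
    using Cons.IH[of P2] carr(2) eqs(2) unfolding m_def by blast
  show ?case
  proof (intro bexI[of _ "hcat n k m Z1 Z2"] conjI allI impI)
    show "A' * hcat n k m Z1 Z2 = hcat n k m Z1 Z2 * jordan_matrix (b # bs)"
      unfolding J mult_hcat[OF A' Z1(1) Z2(1)] hcat_mult_diag[OF Z1(1) Z2(1) carr(3,4)] Z1(2) Z2(2) ..
    show "hcat n k m Z1 Z2 $$ (n - 1, j) = P $$ (n - 1, j)" if "j < sum_list (map fst (b # bs))" for j
      using that n Z1(3) Z2(3) unfolding P by (auto simp: hcat_def b m_def)
  qed (simp add: hcat_def b m_def)
qed

lemma last_unit_mult_index:
  assumes "M \<in> carrier_mat n m" "i < n" "j < m"
  shows "(last_unit n * M) $$ (i, j) = (if i = n - 1 then M $$ (n - 1, j) else 0)"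
proof -
  have "(last_unit n * M) $$ (i, j) = (\<Sum>r<n. last_unit n $$ (i, r) * M $$ (r, j))"
    using assms carrier_matD[OF last_unit_carrier[of n]] by (simp add: scalar_prod_def atLeast0LessThan)
  also have "\<dots> = (\<Sum>r<n. if r = n - 1 then if i = n - 1 then M $$ (r, j) else 0 else 0)"
    using assms(2) by (intro sum.cong) (simp_all add: last_unit_def)
  also have "\<dots> = (if i = n - 1 then M $$ (n - 1, j) else 0)"
    using assms(2) by simp
  finally show ?thesis .
qed

lemma last_unit_mult_eq_iff:
  assumes "0 < n" "M \<in> carrier_mat n m" "M' \<in> carrier_mat n m"
  shows "last_unit n * M = last_unit n * M' \<longleftrightarrow> (\<forall>j<m. M $$ (n - 1, j) = M' $$ (n - 1, j))"
proof
  assume eq: "last_unit n * M = last_unit n * M'"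
  show "\<forall>j<m. M $$ (n - 1, j) = M' $$ (n - 1, j)"
  proof (intro allI impI)
    fix j assume "j < m"
    then show "M $$ (n - 1, j) = M' $$ (n - 1, j)"
      using arg_cong[OF eq, of "\<lambda>X. X $$ (n - 1, j)"] assms
      by (simp add: last_unit_mult_index[of _ n m] del: index_mult_mat(1))
  qed
next
  assume *: "\<forall>j<m. M $$ (n - 1, j) = M' $$ (n - 1, j)"
  show "last_unit n * M = last_unit n * M'"
  proof (rule eq_matI)
    fix i j assume "i < dim_row (last_unit n * M')" "j < dim_col (last_unit n * M')"
    then have "i < n" "j < m" using assms carrier_matD[OF last_unit_carrier[of n]] by auto
    then show "(last_unit n * M) $$ (i, j) = (last_unit n * M') $$ (i, j)"
      using * assms by (simp add: last_unit_mult_index[of _ n m] del: index_mult_mat(1))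
  qed (use assms in auto)
qed

text \<open>Let \<open>P\<close> consist of Jordan chains of \<open>A\<close>, let \<open>Z\<close>
  be its transfer to \<open>A'\<close>, and let \<open>Q\<close> be the inverse of \<open>P\<close>.
  Then \<open>Z * Q\<close> intertwines, and it fixes \<phi> because \<open>Z\<close> and
  \<open>P\<close> share their last row. Nothing makes \<open>Z\<close> invertible here.\<close>

lemma ex_intertwiner_last_row:
  fixes A A' g :: "complex mat"
  assumes n: "0 < n" and A: "A \<in> carrier_mat n n" and A': "A' \<in> carrier_mat n n"
    and same: "\<And>i j. i < n \<Longrightarrow> j < n - 1 \<Longrightarrow> A' $$ (i, j) = A $$ (i, j)"
    and g: "g \<in> carrier_mat n n" "det g \<noteq> 0" "g * A = A' * g"
  shows "\<exists>Z\<in>carrier_mat n n. Z * A = A' * Z \<and> last_unit n * Z = last_unit n"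
proof -
  obtain as where "char_poly A = (\<Prod>a\<leftarrow>as. [:- a, 1:])"
    using char_poly_factorized[OF A] by blast
  then obtain bs where "similar_mat A (jordan_matrix bs)"
    using jordan_nf_exists[OF A] by (auto simp: jordan_nf_def)
  then obtain P Q where "similar_mat_wit A (jordan_matrix bs) P Q"
    by (auto simp: similar_mat_def)
  note PQ = similar_mat_witD2[OF A this]
  let ?J = "jordan_matrix bs"
  have m: "sum_list (map fst bs) = n" using carrier_matD(1)[OF PQ(5)] by simp
  have "A * P = P * ?J"
    using PQ by (simp add: assoc_square[of _ n])
  then obtain Z where Z: "Z \<in> carrier_mat n n" "A' * Z = Z * ?J" "\<forall>j<n. Z $$ (n - 1, j) = P $$ (n - 1, j)"
    using jordan_matrix_transfer[OF n A A' same g, of P bs] PQ(6) unfolding m by blast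
  have "?J * Q = Q * A"
  proof -
    have "Q * A = Q * P * (?J * Q)"
      unfolding PQ(3) using PQ(5-7) by (simp add: assoc_square[of _ n])
    then show ?thesis unfolding PQ(2) using PQ(5,7) by simp
  qed
  then have "Z * Q * A = A' * (Z * Q)"
    using assoc_square[OF Z(1) PQ(7) A] assoc_square[OF Z(1) PQ(5,7)] assoc_square[OF A' Z(1) PQ(7)] Z(2)
    by simp
  moreover have "last_unit n * Z = last_unit n * P"
    using last_unit_mult_eq_iff[OF n Z(1) PQ(6)] Z(3) by simp
  then have "last_unit n * (Z * Q) = last_unit n * P * Q"
    using Z(1) PQ(7) by (simp add: assoc_square[of _ n, symmetric])
  then have "last_unit n * (Z * Q) = last_unit n"
    using PQ(1,6,7) by (simp add: assoc_square[of _ n])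
  ultimately show ?thesis using Z(1) PQ(7) by (intro bexI[of _ "Z * Q"]) auto
qed

text \<open>The intertwiners \<open>Z\<close> from \<open>A\<close> to \<open>B\<close> and
  \<open>Y\<close> from \<open>B\<close> to \<open>A\<close> fix \<phi> but may be singular. The
  product \<open>Y * h\<close> commutes with \<open>A\<close> and has the last row of
  \<open>h\<close>, which is the correction needed for combining \<open>Z\<close> with
  \<open>h\<close>.\<close>

lemma similar_same_columns:
  fixes A B h :: "complex mat"
  assumes n: "0 < n" and A: "A \<in> carrier_mat n n" and B: "B \<in> carrier_mat n n"
    and same: "\<And>i j. i < n \<Longrightarrow> j < n - 1 \<Longrightarrow> B $$ (i, j) = A $$ (i, j)"
    and h: "h \<in> carrier_mat n n" "det h \<noteq> 0" "h * A = B * h"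
  obtains q where "q \<in> carrier_mat n n" "det q \<noteq> 0" "q * A = B * q" "last_unit n * q = last_unit n"
proof -
  obtain h' where h': "h' \<in> carrier_mat n n" "h * h' = 1\<^sub>m n" "h' * h = 1\<^sub>m n"
    using det_nonzero_inverse[OF h(1,2)] by blast
  have "h' * B * h * h' = h' * h * A * h'"
    using A B h h'(1) by (simp add: assoc_square[of _ n])
  then have h'B: "h' * B = A * h'"
    using A B h(1) h' by (simp add: assoc_square[of _ n])
  obtain Z where Z: "Z \<in> carrier_mat n n" "Z * A = B * Z" "last_unit n * Z = last_unit n"
    using ex_intertwiner_last_row[OF n A B same h] by blast
  obtain Y where Y: "Y \<in> carrier_mat n n" "Y * B = A * Y" "last_unit n * Y = last_unit n"
    using ex_intertwiner_last_row[OF n B A same[symmetric] h'(1) inverse_det_nonzero[OF h'(1) h(1) h'(3)] h'B]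
    by blast
  have "Y * h * A = Y * B * h" using A B h Y(1) by (simp add: assoc_square[of _ n])
  then have X: "Y * h * A = A * (Y * h)" using A B h Y by (simp add: assoc_square[of _ n])
  have E: "last_unit n * (Y * h) = last_unit n * h"
    using h(1) Y by (simp add: assoc_square[of _ n, symmetric])
  show thesis
    using intertwiner_fixing_last_row[OF A B h(1) Z(1) _ h(2,3) Z(2,3) X E] h(1) Y(1) that by auto
qed

section \<open>Jordan forms\<close>

lemma similar_mat_block_swap:
  fixes A B :: "complex mat"
  assumes A: "A \<in> carrier_mat n n" and B: "B \<in> carrier_mat m m"
  shows "similar_mat (four_block_mat A (0\<^sub>m n m) (0\<^sub>m m n) B) (four_block_mat B (0\<^sub>m m n) (0\<^sub>m n m) A)"
proof -
  define S where "S k l = four_block_mat (0\<^sub>m k l) (1\<^sub>m k) (1\<^sub>m l) (0\<^sub>m l k :: complex mat)" for k l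
  let ?D = "four_block_mat B (0\<^sub>m m n) (0\<^sub>m n m) A"
  have SS: "S k l * S l k = 1\<^sub>m (k + l)" for k l
    unfolding S_def by (subst mult_four_block_mat[of _ k l _ k _ l _ _ k _ l]) auto
  have "S n m * ?D = four_block_mat (0\<^sub>m n m) A B (0\<^sub>m m n)"
    unfolding S_def using A B by (subst mult_four_block_mat[of _ n m _ n _ m _ _ m _ n]) auto
  then have "S n m * ?D * S m n = four_block_mat A (0\<^sub>m n m) (0\<^sub>m m n) B"
    unfolding S_def using A B by (simp, subst mult_four_block_mat[of _ n m _ n _ m _ _ n _ m]) auto
  moreover have "{four_block_mat A (0\<^sub>m n m) (0\<^sub>m m n) B, ?D, S n m, S m n} \<subseteq> carrier_mat (n + m) (n + m)"
    using A B by (auto simp: S_def add.commute[of n m])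
  ultimately show ?thesis
    using SS[of n m] SS[of m n] by (intro similar_matI[of _ _ "S n m" "S m n" "n + m"]) (auto simp: add.commute[of m n])
qed

text \<open>A Jordan normal form comes with its blocks in arbitrary order, whereas
  \<open>jordan_form\<close> groups them by eigenvalue and sorts them by size. Each induction step
  moves one block past a group of others by a block swap.\<close>

lemma similar_mat_diag_block_mat_permute:
  fixes As :: "complex mat list"
  assumes "mset As = mset Bs" "\<forall>A\<in>set As. square_mat A"
  shows "similar_mat (diag_block_mat As) (diag_block_mat Bs)"
  using assms
proof (induction As arbitrary: Bs)
  case Nil
  then show ?case by (auto intro: similar_mat_refl[of _ 0])
next
  case (Cons A As)
  have "A \<in> set Bs" using Cons.prems(1) by (metis list.set_intros(1) set_mset_mset)
  then obtain Cs Ds where Bs: "Bs = Cs @ A # Ds" by (auto simp: in_set_conv_decomp)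
  have IH: "similar_mat (diag_block_mat As) (diag_block_mat (Cs @ Ds))"
    using Cons Bs by (intro Cons.IH) auto
  let ?d = diag_block_mat
  have allsq: "\<forall>X\<in>set Cs \<union> set Ds. square_mat X"
    using Cons.prems(2) mset_eq_setD[OF Cons.prems(1)] unfolding Bs by (metis Un_iff list.set_intros(2) set_append)
  have sq: "square_mat A" "square_mat (?d As)" "square_mat (?d Cs)" "square_mat (?d Ds)"
    using Cons.prems(2) allsq by (blast intro: diag_block_mat_square list.set_intros)+
  define n where "n = dim_row A"
  define m where "m = dim_row (?d As)"
  define c where "c = dim_row (?d Cs)"
  define d where "d = dim_row (?d Ds)"
  have carr: "A \<in> carrier_mat n n" "?d As \<in> carrier_mat m m" "?d Cs \<in> carrier_mat c c" "?d Ds \<in> carrier_mat d d"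
    using sq by (auto simp: n_def m_def c_def d_def)
  have "m = c + d"
    using similar_matD[OF IH] carr by (fastforce simp: diag_block_mat_append Let_def)
  have eqs: "?d (A # Cs) = four_block_mat A (0\<^sub>m n c) (0\<^sub>m c n) (?d Cs)"
    "?d (Cs @ [A]) = four_block_mat (?d Cs) (0\<^sub>m c n) (0\<^sub>m n c) A"
    using carr by (simp_all add: Let_def diag_block_mat_last)
  have carr': "?d (A # Cs) \<in> carrier_mat (n + c) (n + c)" "?d (Cs @ [A]) \<in> carrier_mat (n + c) (n + c)"
    using four_block_carrier_mat[OF carr(1,3)] four_block_carrier_mat[OF carr(3,1)]
    unfolding eqs by (simp_all add: add.commute[of c n])
  have "similar_mat (?d (A # As)) (?d (A # Cs @ Ds))"
    using similar_mat_four_block_0_0[OF similar_mat_refl[OF carr(1)] IH carr(1,2)] carr \<open>m = c + d\<close>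
    by (simp add: Let_def diag_block_mat_append)
  moreover have "?d (A # Cs @ Ds) = ?d ((A # Cs) @ Ds)" by simp
  moreover have "similar_mat (?d ((A # Cs) @ Ds)) (?d ((Cs @ [A]) @ Ds))"
  proof -
    have sim: "similar_mat (?d (A # Cs)) (?d (Cs @ [A]))"
      unfolding eqs by (rule similar_mat_block_swap[OF carr(1,3)])
    show ?thesis
      unfolding diag_block_mat_append[of "A # Cs"] diag_block_mat_append[of "Cs @ [A]"] Let_def
      using similar_mat_four_block_0_0[OF sim similar_mat_refl[OF carr(4)] carr'(1) carr(4)]
      by (simp only: carrier_matD[OF carr'(1)] carrier_matD[OF carr'(2)] carrier_matD[OF carr(4)])
  qed
  ultimately show ?case
    unfolding Bs by (metis append.assoc append_Cons append_Nil similar_mat_trans)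
qed

definition block_list :: "jordan_data \<Rightarrow> (nat \<times> complex) list" where
  "block_list bs = concat (map (\<lambda>(a, kls). concat (map (\<lambda>(k, l). replicate l (k, a)) kls)) bs)"

lemma diag_block_mat_concat:
  "diag_block_mat (concat Ms) = diag_block_mat (map diag_block_mat Ms)"
  by (induction Ms) (auto simp: diag_block_mat_append Let_def)

lemma jordan_part_eq_diag:
  "jordan_part a kls = diag_block_mat (map (\<lambda>(k, a). lower_jordan_block k a)
    (concat (map (\<lambda>(k, l). replicate l (k, a)) kls)))"
  unfolding map_concat diag_block_mat_concat jordan_part_def map_map
  by (rule arg_cong[of _ _ diag_block_mat], rule map_cong[OF refl])
     (auto simp: jordan_blocks_def map_replicate)

lemma jordan_form_eq_diag:
  "jordan_form bs = diag_block_mat (map (\<lambda>(k, a). lower_jordan_block k a) (block_list bs))"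
  unfolding jordan_form_def block_list_def map_concat[of _ "map _ bs"] diag_block_mat_concat map_map
  by (rule arg_cong[of _ _ diag_block_mat], rule map_cong[OF refl]) (auto simp: jordan_part_eq_diag)

lemma transpose_jordan_matrix:
  "transpose_mat (jordan_matrix ns) = diag_block_mat (map (\<lambda>(k, a). lower_jordan_block k a) ns)"
proof (induction ns)
  case (Cons b ns)
  obtain k a where b: "b = (k, a)" by (cases b)
  let ?m = "sum_list (map fst ns)" and ?D = "diag_block_mat (map (\<lambda>(k, a). lower_jordan_block k a) ns)"
  have D: "?D \<in> carrier_mat ?m ?m" unfolding Cons.IH[symmetric] by simp
  have L: "lower_jordan_block k a \<in> carrier_mat k k" by (simp add: lower_jordan_block_def)
  have "transpose_mat (jordan_matrix (b # ns)) = four_block_mat (transpose_mat (jordan_block k a))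
    (0\<^sub>m k ?m) (0\<^sub>m ?m k) (transpose_mat (jordan_matrix ns))"
    unfolding b jordan_matrix_Cons by (subst transpose_four_block_mat) auto
  also have "\<dots> = diag_block_mat (map (\<lambda>(k, a). lower_jordan_block k a) (b # ns))"
    using carrier_matD[OF D] carrier_matD[OF L]
    unfolding Cons.IH b by (simp add: Let_def lower_jordan_block_def[symmetric])
  finally show ?case .
qed (simp add: jordan_matrix_def)

lemma square_lower_jordan_block: "lower_jordan_block k a \<in> carrier_mat k k"
  by (simp add: lower_jordan_block_def)

lemma sum_list_block_list: "sum_list (map fst (block_list bs)) = sum_list (part_sizes bs)"
proof -
  have "sum_list (map fst (concat (map (\<lambda>(k, l). replicate l (k, a)) kls))) = part_size kls"
    for a :: complex and kls
    by (induction kls) (auto simp: part_size_def sum_list_replicate map_replicate mult.commute)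
  then show ?thesis
    by (induction bs) (auto simp: block_list_def part_sizes_def)
qed

lemma jordan_form_carrier:
  assumes "is_jordan_data n bs"
  shows "jordan_form bs \<in> carrier_mat n n"
proof -
  have "jordan_matrix (block_list bs) \<in> carrier_mat (sum_list (map fst (block_list bs))) (sum_list (map fst (block_list bs)))"
    by simp
  then show ?thesis
    using assms unfolding jordan_form_eq_diag transpose_jordan_matrix[symmetric] sum_list_block_list
    by (simp add: is_jordan_data_def)
qed

lemma count_list_replicate: "count_list (replicate m y) x = (if x = y then m else 0)"
  by (induction m) auto

text \<open>Each eigenvalue is listed once, with its distinct block sizes in increasing order; the
  multiplicity of a size is the number of occurrences of the pair in \<open>ns\<close>.\<close>

lemma ex_jordan_data:
  assumes "ns \<noteq> []" "0 \<notin> fst ` set ns"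
  shows "\<exists>bs. is_jordan_data (sum_list (map fst ns)) bs \<and> mset (block_list bs) = mset ns"
proof -
  define ks where "ks a = sorted_list_of_set {k. (k, a) \<in> set ns}" for a
  define kls where "kls a = map (\<lambda>k. (k, count_list ns (k, a))) (ks a)" for a
  define bs where "bs = map (\<lambda>a. (a, kls a)) (remdups (map snd ns))"
  have fin: "finite {k. (k, a) \<in> set ns}" for a
    by (rule finite_subset[of _ "fst ` set ns"]) force+
  have set_ks: "set (ks a) = {k. (k, a) \<in> set ns}" "distinct (ks a)" "sorted_wrt (<) (ks a)" for a
    using fin by (simp_all add: ks_def)
  have count: "count_list (block_list bs) x = count_list ns x" for x
  proof -
    obtain k a where x: "x = (k, a)" by (cases x)
    have *: "count_list (concat (map (\<lambda>(k, l). replicate l (k, b)) (kls b))) (k, a)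
        = (if b = a then count_list ns (k, a) else 0)" for b
    proof -
      have "count_list (concat (map (\<lambda>(k, l). replicate l (k, b)) (kls b))) (k, a)
        = (\<Sum>k'\<leftarrow>ks b. count_list (replicate (count_list ns (k', b)) (k', b)) (k, a))"
        by (simp add: kls_def count_list_concat o_def)
      also have "\<dots> = (\<Sum>k'\<in>set (ks b). count_list (replicate (count_list ns (k', b)) (k', b)) (k, a))"
        by (rule sum_list_distinct_conv_sum_set[OF set_ks(2)])
      also have "\<dots> = (\<Sum>k'\<in>set (ks b). if k' = k then if b = a then count_list ns (k, a) else 0 else 0)"
        by (intro sum.cong) (auto simp: count_list_replicate)
      also have "\<dots> = (if b = a then count_list ns (k, a) else 0)"
        using fin[of a] by (auto simp: set_ks count_list_0_iff)
      finally show ?thesis .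
    qed
    have "count_list (block_list bs) (k, a)
      = (\<Sum>b\<leftarrow>remdups (map snd ns). if b = a then count_list ns (k, a) else 0)"
      by (simp add: block_list_def bs_def count_list_concat o_def *[simplified count_list_concat o_def map_map])
    also have "\<dots> = (\<Sum>b\<in>set (map snd ns). if b = a then count_list ns (k, a) else 0)"
      by (subst sum_list_distinct_conv_sum_set) simp_all
    also have "\<dots> = count_list ns (k, a)"
      by (force simp: count_list_0_iff)
    finally show ?thesis by (simp add: x)
  qed
  then have mset: "mset (block_list bs) = mset ns"
    by (intro multiset_eqI) (simp add: count_mset)
  have "sum_list (map fst (block_list bs)) = sum_list (map fst ns)"
    using arg_cong[OF mset, of "\<lambda>M. sum_mset (image_mset fst M)"]
    by (metis mset_map sum_mset_sum_list)
  moreover have "is_jordan_data (sum_list (part_sizes bs)) bs"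
    unfolding is_jordan_data_def
  proof (intro conjI)
    show "bs \<noteq> []" using assms(1) by (simp add: bs_def)
    show "distinct (map fst bs)" by (simp add: bs_def o_def)
    have "kls a \<noteq> [] \<and> sorted_wrt (<) (map fst (kls a)) \<and> (\<forall>(k, l)\<in>set (kls a). 1 \<le> k \<and> 1 \<le> l)"
      if "a \<in> snd ` set ns" for a
    proof (intro conjI)
      show "kls a \<noteq> []" using that set_ks(1)[of a] by (force simp: kls_def)
      show "sorted_wrt (<) (map fst (kls a))" using set_ks(3)[of a] by (simp add: kls_def o_def)
      show "\<forall>(k, l)\<in>set (kls a). 1 \<le> k \<and> 1 \<le> l"
        using assms(2) by (force simp: kls_def set_ks count_list_0_iff Suc_le_eq)
    qed
    then show "\<forall>(a, kls)\<in>set bs. kls \<noteq> [] \<and> sorted_wrt (<) (map fst kls) \<and> (\<forall>(k, l)\<in>set kls. 1 \<le> k \<and> 1 \<le> l)"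
      by (auto simp: bs_def)
  qed simp
  ultimately show ?thesis
    using mset by (auto simp: sum_list_block_list)
qed

text \<open>The existence theorem yields upper triangular blocks. It is applied to the transpose of
  \<open>A\<close>; transposing back makes the blocks lower triangular, and they are then
  sorted.\<close>

lemma similar_jordan_form:
  assumes n: "0 < n" and A: "A \<in> carrier_mat n n"
  shows "\<exists>bs. is_jordan_data n bs \<and> similar_mat A (jordan_form bs)"
proof -
  let ?d = "\<lambda>ns. diag_block_mat (map (\<lambda>(k, a). lower_jordan_block k a) ns)"
  have AT: "transpose_mat A \<in> carrier_mat n n" using A by simp
  obtain as where "char_poly (transpose_mat A) = (\<Prod>a\<leftarrow>as. [:- a, 1:])"
    using char_poly_factorized[OF AT] by blast
  then obtain ns where ns: "0 \<notin> fst ` set ns" "similar_mat (transpose_mat A) (jordan_matrix ns)"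
    using jordan_nf_exists[OF AT] by (auto simp: jordan_nf_def)
  then obtain P Q where "similar_mat_wit (transpose_mat A) (jordan_matrix ns) P Q"
    by (auto simp: similar_mat_def)
  note PQ = similar_mat_witD2[OF AT this]
  have dim: "sum_list (map fst ns) = n" using carrier_matD(1)[OF PQ(5)] by simp
  have "similar_mat A (?d ns)"
  proof (rule similar_matI)
    have "A = transpose_mat (P * jordan_matrix ns * Q)"
      using PQ(3) by (metis transpose_transpose)
    also have "\<dots> = transpose_mat Q * (transpose_mat (jordan_matrix ns) * transpose_mat P)"
      using PQ(5-7) by (simp add: transpose_mult[of _ n n _ n])
    finally show "A = transpose_mat Q * ?d ns * transpose_mat P"
      using PQ(5-7) unfolding transpose_jordan_matrix[symmetric] by (simp add: assoc_square[of _ n])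
    show "transpose_mat Q * transpose_mat P = 1\<^sub>m n" "transpose_mat P * transpose_mat Q = 1\<^sub>m n"
      using PQ by (simp_all add: transpose_mult[of _ n n _ n, symmetric])
    show "{A, ?d ns, transpose_mat Q, transpose_mat P} \<subseteq> carrier_mat n n"
      using A PQ(5-7) unfolding transpose_jordan_matrix[symmetric] by simp
  qed
  moreover obtain bs where bs: "is_jordan_data n bs" "mset (block_list bs) = mset ns"
    using ex_jordan_data[of ns] ns(1) dim n by fastforce
  have "similar_mat (?d ns) (jordan_form bs)"
    unfolding jordan_form_eq_diag using carrier_matD[OF square_lower_jordan_block]
    by (intro similar_mat_diag_block_mat_permute) (simp add: bs(2), auto)
  ultimately show ?thesis using bs(1) similar_mat_trans by blast
qed

section \<open>Polynomials evaluated at a Jordan form\<close>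

lemma mat_poly_four_block:
  assumes A: "A \<in> carrier_mat n n" and B: "B \<in> carrier_mat m m"
  shows "mat_poly (n + m) (four_block_mat A (0\<^sub>m n m) (0\<^sub>m m n) B) cs
    = four_block_mat (mat_poly n A cs) (0\<^sub>m n m) (0\<^sub>m m n) (mat_poly m B cs)"
proof (induction cs)
  case (Cons c cs)
  note carr = mat_poly_carrier[OF A, of cs] mat_poly_carrier[OF B, of cs]
  have "c \<cdot>\<^sub>m 1\<^sub>m (n + m) = four_block_mat (c \<cdot>\<^sub>m 1\<^sub>m n) (0\<^sub>m n m) (0\<^sub>m m n) (c \<cdot>\<^sub>m 1\<^sub>m m)"
    by (auto intro!: eq_matI)
  then show ?case
    using A B carr left_mult_zero_mat[OF carr(1), of m] left_mult_zero_mat[OF carr(2), of n]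
    by (simp add: Cons mult_four_block_mat[OF A zero_carrier_mat zero_carrier_mat B carr(1) zero_carrier_mat zero_carrier_mat carr(2)]
        add_four_block_mat[of _ n n _ m _ m])
qed (auto intro!: eq_matI)

lemma mat_poly_diag_block:
  assumes "\<forall>M\<in>set Ms. M \<in> carrier_mat (dim_row M) (dim_row M)"
  shows "diag_block_mat Ms \<in> carrier_mat (sum_list (map dim_row Ms)) (sum_list (map dim_row Ms)) \<and>
    mat_poly (sum_list (map dim_row Ms)) (diag_block_mat Ms) cs
      = diag_block_mat (map (\<lambda>M. mat_poly (dim_row M) M cs) Ms)"
  using assms
proof (induction Ms)
  case Nil
  have "mat_poly 0 (0\<^sub>m 0 0) cs = 0\<^sub>m 0 0"
    using carrier_matD[OF mat_poly_carrier[of "0\<^sub>m 0 0" 0 cs]] by (intro eq_matI) auto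
  then show ?case by simp
next
  case (Cons M Ms)
  let ?m = "sum_list (map dim_row Ms)"
  have M: "M \<in> carrier_mat (dim_row M) (dim_row M)" using Cons.prems by simp
  have IH: "diag_block_mat Ms \<in> carrier_mat ?m ?m"
    "mat_poly ?m (diag_block_mat Ms) cs = diag_block_mat (map (\<lambda>M. mat_poly (dim_row M) M cs) Ms)"
    using Cons by auto
  have eq: "diag_block_mat (M # Ms) = four_block_mat M (0\<^sub>m (dim_row M) ?m) (0\<^sub>m ?m (dim_row M)) (diag_block_mat Ms)"
    using carrier_matD[OF IH(1)] carrier_matD[OF M] by (simp add: Let_def)
  let ?f = "\<lambda>M. mat_poly (dim_row M) M cs"
  note carr = mat_poly_carrier[OF M, of cs] mat_poly_carrier[OF IH(1), of cs]
  have "diag_block_mat (map ?f (M # Ms))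
    = four_block_mat (?f M) (0\<^sub>m (dim_row M) ?m) (0\<^sub>m ?m (dim_row M)) (mat_poly ?m (diag_block_mat Ms) cs)"
    using carrier_matD[OF carr(1)] carrier_matD[OF carr(2)] unfolding IH(2) by (simp only: list.map diag_block_mat.simps Let_def)
  then have "mat_poly (dim_row M + ?m) (diag_block_mat (M # Ms)) cs = diag_block_mat (map ?f (M # Ms))"
    unfolding eq mat_poly_four_block[OF M IH(1)] by simp
  moreover have "diag_block_mat (M # Ms) \<in> carrier_mat (dim_row M + ?m) (dim_row M + ?m)"
    unfolding eq by (rule four_block_carrier_mat[OF M IH(1)])
  ultimately show ?case by (simp only: list.map sum_list.Cons)
qed

text \<open>The coefficient of \<open>(x - a)^s\<close> in the Taylor expansion of the polynomial at
  \<open>a\<close>; the recursion comes from \<open>x q = (x - a) q + a q\<close>.\<close>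

fun toeplitz_coeff :: "complex \<Rightarrow> complex list \<Rightarrow> nat \<Rightarrow> complex" where
  "toeplitz_coeff a [] s = 0"
| "toeplitz_coeff a (c # cs) s = (if s = 0 then c else toeplitz_coeff a cs (s - 1)) + a * toeplitz_coeff a cs s"

text \<open>The block is \<open>a + N\<close> with \<open>N\<close> the nilpotent shift, so a
  polynomial in it is the lower triangular Toeplitz matrix of the Taylor coefficients at
  \<open>a\<close>.\<close>

lemma mat_poly_lower_jordan_block:
  assumes "i < k" "j < k"
  shows "mat_poly k (lower_jordan_block k a) cs $$ (i, j) = (if j \<le> i then toeplitz_coeff a cs (i - j) else 0)"
  using assms
proof (induction cs arbitrary: i j)
  case (Cons c cs)
  let ?L = "lower_jordan_block k a"
  note L = square_lower_jordan_block[of k a]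
  note p = mat_poly_carrier[OF L, of cs]
  let ?p = "mat_poly k ?L cs"
  have "(?L * ?p) $$ (i, j) = (\<Sum>r<k. ?L $$ (i, r) * ?p $$ (r, j))"
    using Cons.prems carrier_matD[OF L] carrier_matD[OF p] by (simp add: scalar_prod_def atLeast0LessThan)
  also have "\<dots> = (\<Sum>r<k. if r = i then a * ?p $$ (r, j) else 0) + (\<Sum>r<k. if Suc r = i then ?p $$ (r, j) else 0)"
    unfolding sum.distrib[symmetric] using Cons.prems
    by (intro sum.cong refl) (simp add: lower_jordan_block_def)
  also have "(\<Sum>r<k. if r = i then a * ?p $$ (r, j) else 0) = a * ?p $$ (i, j)"
    using Cons.prems by simp
  also have "(\<Sum>r<k. if Suc r = i then ?p $$ (r, j) else 0) = (if i = 0 then 0 else ?p $$ (i - 1, j))"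
    using Cons.prems by (cases i) auto
  finally have "mat_poly k ?L (c # cs) $$ (i, j)
    = (if i = j then c else 0) + (a * ?p $$ (i, j) + (if i = 0 then 0 else ?p $$ (i - 1, j)))"
    using Cons.prems carrier_matD[OF L] carrier_matD[OF p] by (simp del: index_mult_mat(1))
  then have *: "mat_poly k ?L (c # cs) $$ (i, j)
    = (if i = j then c else 0) + (a * (if j \<le> i then toeplitz_coeff a cs (i - j) else 0) +
       (if i = 0 then 0 else if j \<le> i - 1 then toeplitz_coeff a cs (i - 1 - j) else 0))"
    using Cons.prems Cons.IH[of i j] Cons.IH[of "i - 1" j] by (simp del: mat_poly.simps)
  consider "i < j" | "i = j" | "j < i" by linarith
  then show ?case
  proof cases
    case 3
    then have "i - 1 - j = i - j - 1" "i \<noteq> 0" "j \<le> i - 1" "i - j \<noteq> 0" by auto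
    with 3 show ?thesis unfolding * by simp
  next
    case 2
    then have "i = 0 \<or> \<not> j \<le> i - 1" by linarith
    with 2 show ?thesis unfolding * by auto
  qed (simp add: * del: mat_poly.simps)
qed simp

text \<open>The bottom row for size \<open>k\<close> contains all Taylor coefficients of order below
  \<open>k\<close>, hence everything that occurs in a block of size at most \<open>k\<close> with
  the same eigenvalue.\<close>

lemma mat_poly_lower_jordan_block_eq_0:
  assumes k: "0 < k" and row: "\<forall>c<k. mat_poly k (lower_jordan_block k a) cs $$ (k - 1, c) = 0" and k': "k' \<le> k"
  shows "mat_poly k' (lower_jordan_block k' a) cs = 0\<^sub>m k' k'"
proof (rule eq_matI)
  have z: "toeplitz_coeff a cs s = 0" if "s < k" for s
  proof -
    have "k - 1 - (k - 1 - s) = s" "k - 1 - s \<le> k - 1" using that by linarith+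
    then show ?thesis
      using row[rule_format, of "k - 1 - s"] k mat_poly_lower_jordan_block[of "k - 1" k "k - 1 - s" a cs] by simp
  qed
  fix i j assume "i < dim_row (0\<^sub>m k' k' :: complex mat)" "j < dim_col (0\<^sub>m k' k' :: complex mat)"
  then show "mat_poly k' (lower_jordan_block k' a) cs $$ (i, j) = 0\<^sub>m k' k' $$ (i, j)"
    using k' z by (simp add: mat_poly_lower_jordan_block)
qed (use mat_poly_carrier[OF square_lower_jordan_block, of k' a cs] in auto)

lemma diag_block_mat_last_row:
  assumes "dim_row M = Suc m" "c < dim_col M"
  shows "diag_block_mat (Ms @ [M]) $$ (dim_row (diag_block_mat (Ms @ [M])) - 1, dim_col (diag_block_mat Ms) + c)
    = M $$ (m, c)"
  using assms by (simp add: diag_block_mat_last Let_def)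

lemma diag_block_mat_eq_0:
  assumes "\<And>M. M \<in> set Ms \<Longrightarrow> \<exists>nr nc. M = (0\<^sub>m nr nc :: complex mat)"
  shows "\<exists>nr nc. diag_block_mat Ms = 0\<^sub>m nr nc"
  using assms
proof (induction Ms)
  case (Cons M Ms)
  obtain nr' nc' where "M = 0\<^sub>m nr' nc'" using Cons.prems[of M] by auto
  moreover have "\<exists>nr nc. diag_block_mat Ms = 0\<^sub>m nr nc" by (rule Cons.IH) (simp add: Cons.prems)
  then obtain nr nc where "diag_block_mat Ms = 0\<^sub>m nr nc" by blast
  ultimately show ?case by (auto simp: Let_def)
qed auto

text \<open>The blocks occupy disjoint sets of columns, so nothing can cancel in the sum of their
  bottom rows. \<open>I\<close> holds the 1-based end positions of the blocks, whence
  \<open>Suc r\<close>.\<close>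

lemma diag_block_mat_end_rows:
  fixes Ms :: "complex mat list"
  assumes "\<And>M. M \<in> set Ms \<Longrightarrow> M \<in> carrier_mat (dim_row M) (dim_row M) \<and> 0 < dim_row M"
    and "N = sum_list (map dim_row Ms)"
    and "I = {sum_list (take j (map dim_row Ms)) |j. 1 \<le> j \<and> j \<le> length Ms}"
    and "\<And>c. c < N \<Longrightarrow> (\<Sum>r<N. if Suc r \<in> I then diag_block_mat Ms $$ (r, c) else 0) = 0"
    and "M \<in> set Ms" "c < dim_row M"
  shows "M $$ (dim_row M - 1, c) = 0"
  using assms
proof (induction Ms arbitrary: N I)
  case (Cons A Ms)
  define s where "s = dim_row A"
  define N' where "N' = sum_list (map dim_row Ms)"
  define I' where "I' = {sum_list (take j (map dim_row Ms)) |j. 1 \<le> j \<and> j \<le> length Ms}"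
  let ?D = "diag_block_mat Ms"
  have A: "A \<in> carrier_mat s s" "0 < s" using Cons.prems(1)[of A] by (auto simp: s_def)
  have N: "N = s + N'" using Cons.prems(2) by (simp add: s_def N'_def)
  have D: "?D \<in> carrier_mat N' N'"
    using mat_poly_diag_block[of Ms] Cons.prems(1) by (auto simp: N'_def)
  have eq: "diag_block_mat (A # Ms) = four_block_mat A (0\<^sub>m s N') (0\<^sub>m N' s) ?D"
    using carrier_matD[OF D] carrier_matD[OF A(1)] by (simp add: Let_def)
  have I: "x \<in> I \<longleftrightarrow> x = s \<or> (\<exists>y\<in>I'. x = s + y)" for x
  proof
    assume "x \<in> I"
    then obtain j where j: "x = sum_list (take j (map dim_row (A # Ms)))" "1 \<le> j" "j \<le> length (A # Ms)"
      using Cons.prems(3) by blast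
    then obtain i where i: "j = Suc i" by (cases j) auto
    show "x = s \<or> (\<exists>y\<in>I'. x = s + y)"
    proof (cases i)
      case 0
      then show ?thesis using j(1) i by (simp add: s_def)
    next
      case (Suc i')
      then have "sum_list (take i (map dim_row Ms)) \<in> I'" using j(3) i unfolding I'_def by fastforce
      then show ?thesis using j(1) i by (auto simp: s_def)
    qed
  next
    assume "x = s \<or> (\<exists>y\<in>I'. x = s + y)"
    then obtain i where i: "x = s + sum_list (take i (map dim_row Ms))" "i \<le> length Ms"
    proof
      assume "x = s"
      then show thesis by (intro that[of 0]) simp_all
    next
      assume "\<exists>y\<in>I'. x = s + y"
      then show thesis unfolding I'_def using that by blast
    qed
    then show "x \<in> I" unfolding Cons.prems(3)
      by (intro CollectI exI[of _ "Suc i"]) (simp add: s_def)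
  qed
  \<comment> \<open>Blocks are nonempty, so the end of a later block cannot fall inside the first
    one.\<close>
  have pos: "0 < x" if x: "x \<in> I'" for x
  proof -
    obtain j where j: "x = sum_list (take j (map dim_row Ms))" "1 \<le> j" "j \<le> length Ms"
      using x unfolding I'_def by blast
    obtain i where i: "j = Suc i" using j(2) by (cases j) auto
    obtain B Bs where B: "Ms = B # Bs" using j(3) i by (cases Ms) auto
    then have "0 < dim_row B" using Cons.prems(1)[of B] by simp
    then show ?thesis using j(1) unfolding i B by simp
  qed
  have mem: "Suc r \<in> I \<longleftrightarrow> Suc r = s" if "r < s" for r
  proof -
    have "Suc r \<noteq> s + y" if "y \<in> I'" for y using pos[OF that] \<open>r < s\<close> by simp
    then show ?thesis unfolding I by blast
  qed
  have mem': "Suc (s + r) \<in> I \<longleftrightarrow> Suc r \<in> I'" for r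
  proof -
    have "Suc (s + r) = s + y \<longleftrightarrow> y = Suc r" for y by auto
    then show ?thesis unfolding I by simp
  qed
  have split: "(\<Sum>r<s + m. g r) = (\<Sum>r<s. g r) + (\<Sum>r<m. g (s + r))" for g :: "nat \<Rightarrow> complex" and m
    by (induction m) (simp_all add: add.assoc)
  let ?F = "four_block_mat A (0\<^sub>m s N') (0\<^sub>m N' s) ?D"
  have sum: "(\<Sum>r<s. if Suc r \<in> I then ?F $$ (r, c) else 0) + (\<Sum>r<N'. if Suc (s + r) \<in> I then ?F $$ (s + r, c) else 0) = 0"
    if "c < s + N'" for c
    using Cons.prems(4)[of c] that unfolding N eq split .
  have F: "r < s \<Longrightarrow> c < s \<Longrightarrow> ?F $$ (r, c) = A $$ (r, c)" "r < N' \<Longrightarrow> c < s \<Longrightarrow> ?F $$ (s + r, c) = 0"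
    "r < s \<Longrightarrow> c < N' \<Longrightarrow> ?F $$ (r, s + c) = 0" "r < N' \<Longrightarrow> c < N' \<Longrightarrow> ?F $$ (s + r, s + c) = ?D $$ (r, c)" for r c
    using carrier_matD[OF D] carrier_matD[OF A(1)] by simp_all
  show ?case
  proof (cases "M = A")
    case True
    then have c: "c < s" using Cons.prems(6) s_def by simp
    have "(\<Sum>r<s. if Suc r \<in> I then ?F $$ (r, c) else 0) = (\<Sum>r<s. if r = s - 1 then A $$ (r, c) else 0)"
      using c by (intro sum.cong refl) (auto simp: mem F(1))
    moreover have "(\<Sum>r<N'. if Suc (s + r) \<in> I then ?F $$ (s + r, c) else 0) = 0"
      using c by (intro sum.neutral) (simp add: F(2))
    ultimately have "A $$ (s - 1, c) = 0"
      using sum[of c] c A(2) by simp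
    then show ?thesis by (simp add: True s_def[symmetric])
  next
    case False
    then have M: "M \<in> set Ms" using Cons.prems(5) by simp
    have "(\<Sum>r<N'. if Suc r \<in> I' then ?D $$ (r, c) else 0) = 0" if "c < N'" for c
    proof -
      have "(\<Sum>r<s. if Suc r \<in> I then ?F $$ (r, s + c) else 0) = 0"
        using that by (intro sum.neutral) (simp add: F(3))
      moreover have "(\<Sum>r<N'. if Suc (s + r) \<in> I then ?F $$ (s + r, s + c) else 0)
          = (\<Sum>r<N'. if Suc r \<in> I' then ?D $$ (r, c) else 0)"
        using that by (intro sum.cong refl) (simp add: mem' F(4))
      ultimately show ?thesis using sum[of "s + c"] that by simp
    qed
    then show ?thesis
      using Cons.prems(1) by (intro Cons.IH[OF _ N'_def I'_def _ M Cons.prems(6)]) simp_all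
  qed
qed simp

lemma jordan_part_carrier: "jordan_part a kls \<in> carrier_mat (part_size kls) (part_size kls)"
proof -
  have "sum_list (map fst (concat (map (\<lambda>(k, l). replicate l (k, a)) kls))) = part_size kls"
    by (induction kls) (auto simp: part_size_def sum_list_replicate map_replicate mult.commute)
  then show ?thesis
    unfolding jordan_part_eq_diag transpose_jordan_matrix[symmetric]
    by (metis jordan_matrix_carrier transpose_carrier_mat)
qed

text \<open>The sizes increase, so the bottom row belongs to the last and largest block. Its
  vanishing kills every Taylor coefficient that occurs in any block of the part.\<close>

lemma mat_poly_jordan_part_eq_0:
  assumes kls: "kls \<noteq> []" "sorted_wrt (<) (map fst kls)" "\<forall>(k, l)\<in>set kls. 1 \<le> k \<and> 1 \<le> l"
  defines "s \<equiv> part_size kls"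
  assumes row: "\<And>c. c < s \<Longrightarrow> mat_poly s (jordan_part a kls) cs $$ (s - 1, c) = 0"
  shows "0 < s \<and> mat_poly s (jordan_part a kls) cs = 0\<^sub>m s s"
proof -
  obtain kls' k l where kls': "kls = kls' @ [(k, l)]" using kls(1) by (metis rev_exhaust surj_pair)
  have kl: "1 \<le> k" "1 \<le> l" using kls(3) by (auto simp: kls')
  let ?L = "\<lambda>(k, a). lower_jordan_block k a"
  define bl where "bl = concat (map (\<lambda>(k, l). replicate l (k, a)) kls)"
  define bl' where "bl' = concat (map (\<lambda>(k, l). replicate l (k, a)) kls') @ replicate (l - 1) (k, a)"
  have bl: "bl = bl' @ [(k, a)]"
    using kl by (cases l) (simp_all add: bl_def bl'_def kls' replicate_append_same)
  have le: "k' \<le> k \<and> a' = a" if "(k', a') \<in> set bl" for k' a'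
    using that kls(2) by (auto simp: bl_def kls' sorted_wrt_append split: if_splits intro: less_imp_le)
  have dims: "dim_row (?L x) = fst x" for x
    using carrier_matD[OF square_lower_jordan_block] by (cases x) simp
  have sq: "\<forall>M\<in>set (map ?L bl). M \<in> carrier_mat (dim_row M) (dim_row M)"
    using dims by (auto simp: lower_jordan_block_def)
  have s: "sum_list (map dim_row (map ?L bl)) = s"
    using mat_poly_diag_block[OF sq] carrier_matD(1)[OF jordan_part_carrier[of a kls]]
    unfolding s_def jordan_part_eq_diag bl_def[symmetric] by (metis carrier_matD(1))
  let ?q = "\<lambda>(k, a). mat_poly k (lower_jordan_block k a) cs"
  have poly: "mat_poly s (jordan_part a kls) cs = diag_block_mat (map ?q bl)"
  proof -
    have "map (\<lambda>M. mat_poly (dim_row M) M cs) (map ?L bl) = map ?q bl"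
      unfolding map_map by (rule map_cong[OF refl])
        (simp add: carrier_matD[OF square_lower_jordan_block] case_prod_beta)
    then show ?thesis
      using mat_poly_diag_block[OF sq, of cs] unfolding s jordan_part_eq_diag bl_def[symmetric] by (simp only:)
  qed
  have q: "?q (k, a) \<in> carrier_mat k k" by (simp add: square_lower_jordan_block)
  have card: "diag_block_mat (map ?q bl) \<in> carrier_mat s s"
    unfolding poly[symmetric] s_def by (rule mat_poly_carrier[OF jordan_part_carrier])
  have dcol: "dim_col (diag_block_mat (map ?q bl')) + k = s"
    using carrier_matD(2)[OF card] carrier_matD(2)[OF q] by (simp add: bl diag_block_mat_last Let_def)
  have row0: "\<forall>c<k. mat_poly k (lower_jordan_block k a) cs $$ (k - 1, c) = 0"
  proof (intro allI impI)
    fix c assume c: "c < k"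
    let ?D = "diag_block_mat (map ?q bl' @ [?q (k, a)])"
    have D: "?D = diag_block_mat (map ?q bl)" by (simp add: bl)
    have "?D $$ (dim_row ?D - 1, dim_col (diag_block_mat (map ?q bl')) + c) = ?q (k, a) $$ (k - 1, c)"
      by (rule diag_block_mat_last_row) (use carrier_matD[OF q] c kl in simp_all)
    moreover have "?D $$ (dim_row ?D - 1, dim_col (diag_block_mat (map ?q bl')) + c) = 0"
      unfolding D carrier_matD(1)[OF card] using c dcol unfolding poly[symmetric] by (intro row) simp
    ultimately show "mat_poly k (lower_jordan_block k a) cs $$ (k - 1, c) = 0" by simp
  qed
  have "\<exists>nr nc. diag_block_mat (map ?q bl) = 0\<^sub>m nr nc"
  proof (rule diag_block_mat_eq_0)
    fix M assume "M \<in> set (map ?q bl)"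
    then obtain k' a' where x: "(k', a') \<in> set bl" "M = mat_poly k' (lower_jordan_block k' a') cs" by auto
    then have "k' \<le> k" "a' = a" using le by auto
    then have "M = 0\<^sub>m k' k'"
      using mat_poly_lower_jordan_block_eq_0[OF _ row0] kl x(2) by simp
    then show "\<exists>nr nc. M = 0\<^sub>m nr nc" by blast
  qed
  then obtain nr nc where z: "diag_block_mat (map ?q bl) = 0\<^sub>m nr nc" by blast
  have "nr = s" "nc = s" using card unfolding z by auto
  then have "diag_block_mat (map ?q bl) = 0\<^sub>m s s" using z by simp
  then show ?thesis using dcol kl unfolding poly by simp
qed

text \<open>The row in question is the sum of the bottom rows of all parts. Disjoint columns
  separate the parts, and each part vanishes because of its own bottom row.\<close>

lemma mat_poly_jordan_form_eq_0:
  assumes bs: "is_jordan_data n bs"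
    and row: "\<And>c. c < n \<Longrightarrow> (g_index n (index_set bs) * mat_poly n (jordan_form bs) cs) $$ (n - 1, c) = 0"
  shows "mat_poly n (jordan_form bs) cs = 0\<^sub>m n n"
proof -
  let ?P = "\<lambda>(a, kls). jordan_part a kls"
  let ?Q = "\<lambda>(a, kls). mat_poly (part_size kls) (jordan_part a kls) cs"
  have dims: "dim_row (?P x) = part_size (snd x)" "dim_row (?Q x) = part_size (snd x)" "dim_col (?Q x) = part_size (snd x)" for x
    using carrier_matD[OF jordan_part_carrier] carrier_matD[OF mat_poly_carrier[OF jordan_part_carrier]]
    by (auto simp: case_prod_beta)
  have sq: "\<forall>M\<in>set (map ?P bs). M \<in> carrier_mat (dim_row M) (dim_row M)"
    using dims jordan_part_carrier by (auto simp: case_prod_beta)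
  have sizes: "map dim_row (map ?P bs) = part_sizes bs" "map dim_row (map ?Q bs) = part_sizes bs"
    using dims by (auto simp: part_sizes_def case_prod_beta)
  have n: "sum_list (part_sizes bs) = n" "bs \<noteq> []" using bs by (simp_all add: is_jordan_data_def)
  have poly: "mat_poly n (jordan_form bs) cs = diag_block_mat (map ?Q bs)"
  proof -
    have "map (\<lambda>M. mat_poly (dim_row M) M cs) (map ?P bs) = map ?Q bs"
      unfolding map_map by (rule map_cong[OF refl]) (simp add: carrier_matD[OF jordan_part_carrier] case_prod_beta)
    then show ?thesis
      using mat_poly_diag_block[OF sq, of cs] unfolding sizes n jordan_form_def by (simp only:)
  qed
  note carr = mat_poly_carrier[OF jordan_form_carrier[OF bs], of cs]
  \<comment> \<open>The entry of \<open>g_index\<close> at position \<open>(n - 1, n - 1)\<close> is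
    a diagonal 1; since \<open>n\<close> is an end position, it agrees with the indicator of
    \<open>index_set\<close>.\<close>
  have n_mem: "n \<in> index_set bs"
    unfolding index_set_def using n
    by (intro CollectI exI[of _ "length bs"]) (auto simp: part_sizes_def Suc_le_eq)
  have sum: "(\<Sum>r<n. if Suc r \<in> index_set bs then diag_block_mat (map ?Q bs) $$ (r, c) else 0) = 0" if "c < n" for c
  proof -
    have "(g_index n (index_set bs) * mat_poly n (jordan_form bs) cs) $$ (n - 1, c)
      = (\<Sum>r<n. g_index n (index_set bs) $$ (n - 1, r) * mat_poly n (jordan_form bs) cs $$ (r, c))"
      using that carrier_matD[OF carr] by (simp add: scalar_prod_def atLeast0LessThan g_index_def)
    also have "\<dots> = (\<Sum>r<n. if Suc r \<in> index_set bs then mat_poly n (jordan_form bs) cs $$ (r, c) else 0)"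
      using that n_mem by (intro sum.cong refl) (auto simp: g_index_def)
    finally show ?thesis using row[OF that] unfolding poly by simp
  qed
  have pos: "kls \<noteq> [] \<and> sorted_wrt (<) (map fst kls) \<and> (\<forall>(k, l)\<in>set kls. 1 \<le> k \<and> 1 \<le> l)"
    if "(a, kls) \<in> set bs" for a kls
    using bs that unfolding is_jordan_data_def by blast
  have ps: "0 < part_size kls" if mem: "(a, kls) \<in> set bs" for a kls
  proof -
    obtain k l kls' where kls: "kls = (k, l) # kls'"
      using pos[OF mem] by (metis neq_Nil_conv surj_pair)
    then have "1 \<le> k" "1 \<le> l" using pos[OF mem] by auto
    then show ?thesis by (simp add: part_size_def kls)
  qed
  have "\<exists>nr nc. diag_block_mat (map ?Q bs) = 0\<^sub>m nr nc"
  proof (rule diag_block_mat_eq_0)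
    fix M assume "M \<in> set (map ?Q bs)"
    then obtain a kls where M: "(a, kls) \<in> set bs" "M = ?Q (a, kls)" by auto
    have "M $$ (dim_row M - 1, c) = 0" if "c < dim_row M" for c
    proof (rule diag_block_mat_end_rows[OF _ _ _ sum])
      show "n = sum_list (map dim_row (map ?Q bs))" unfolding sizes n ..
      show "index_set bs = {sum_list (take j (map dim_row (map ?Q bs))) |j. 1 \<le> j \<and> j \<le> length (map ?Q bs)}"
        unfolding sizes index_set_def by simp
      show "M \<in> set (map ?Q bs)" by fact
      fix X assume "X \<in> set (map ?Q bs)"
      then show "X \<in> carrier_mat (dim_row X) (dim_row X) \<and> 0 < dim_row X"
        using ps mat_poly_carrier[OF jordan_part_carrier]
      by (auto simp: carrier_matD[OF mat_poly_carrier[OF jordan_part_carrier]])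
    qed (use that in auto)
    then show "\<exists>nr nc. M = 0\<^sub>m nr nc"
      using mat_poly_jordan_part_eq_0[of kls a cs] pos[OF M(1)] dims[of "(a, kls)"] unfolding M(2) by auto
  qed
  then obtain nr nc where z: "diag_block_mat (map ?Q bs) = 0\<^sub>m nr nc" by blast
  have "nr = n" "nc = n" using carr unfolding poly z by auto
  then show ?thesis using z unfolding poly by simp
qed

section \<open>Krylov matrices\<close>

text \<open>If \<open>R * A = B * R\<close>, the rows are \<phi> \<open>B^i R\<close>. The factor
  \<open>R\<close> thus allows a conjugate \<open>B\<close> to be studied through powers of a fixed
  matrix \<open>A\<close>.\<close>

definition krylov :: "nat \<Rightarrow> nat \<Rightarrow> complex mat \<Rightarrow> complex mat \<Rightarrow> complex mat" where
  "krylov n d R A = mat d n (\<lambda>(i, j). (R * A ^\<^sub>m i) $$ (n - 1, j))"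

text \<open>The Gram determinant of the rows of \<open>K\<close> makes their linear independence an open condition,
  and \<open>right_inverse\<close> depends continuously on \<open>K\<close> where it does not vanish.\<close>

definition gram :: "nat \<Rightarrow> nat \<Rightarrow> complex mat \<Rightarrow> complex mat" where
  "gram n d K = K * mat n d (\<lambda>(i, j). cnj (K $$ (j, i)))"

definition right_inverse :: "nat \<Rightarrow> nat \<Rightarrow> complex mat \<Rightarrow> complex mat" where
  "right_inverse n d K = mat n d (\<lambda>(i, j). cnj (K $$ (j, i))) * (inverse (det (gram n d K)) \<cdot>\<^sub>m adj_mat (gram n d K))"

lemma krylov_carrier [simp]: "krylov n d R A \<in> carrier_mat d n"
  by (simp add: krylov_def)

lemma gram_carrier [simp]: "K \<in> carrier_mat d n \<Longrightarrow> gram n d K \<in> carrier_mat d d"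
  unfolding gram_def by (rule mult_carrier_mat) auto

lemma right_inverse_carrier:
  assumes "K \<in> carrier_mat d n"
  shows "right_inverse n d K \<in> carrier_mat n d"
  unfolding right_inverse_def using adj_mat(1)[OF gram_carrier[OF assms]]
  by (intro mult_carrier_mat[of _ n d]) simp_all

lemma mult_right_inverse:
  assumes K: "K \<in> carrier_mat d n" and det: "det (gram n d K) \<noteq> 0"
  shows "K * right_inverse n d K = 1\<^sub>m d"
proof -
  let ?K' = "mat n d (\<lambda>(i, j). cnj (K $$ (j, i)))" and ?G = "gram n d K"
  note G = gram_carrier[OF K]
  have "K * right_inverse n d K = ?G * (inverse (det ?G) \<cdot>\<^sub>m adj_mat ?G)"
    unfolding right_inverse_def gram_def[symmetric] using K adj_mat(1)[OF G]
    by (subst assoc_mult_mat[of _ d n _ d _ d, symmetric]) (auto simp: gram_def)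
  also have "\<dots> = inverse (det ?G) \<cdot>\<^sub>m (?G * adj_mat ?G)"
    using G adj_mat(1)[OF G] by (simp add: mult_smult_distrib[of _ d d _ d])
  also have "\<dots> = 1\<^sub>m d"
    unfolding adj_mat(2)[OF G] using det by (intro eq_matI) auto
  finally show ?thesis .
qed

text \<open>Let \<open>y\<close> be the adjoint of \<open>K\<close> applied to a kernel vector
  \<open>x\<close> of the Gram matrix. Then \<open>K y = 0\<close>, and pairing with
  \<open>x\<close> shows that \<open>y\<close> has norm zero; conjugating \<open>y = 0\<close> gives
  a linear relation among the rows of \<open>K\<close>.\<close>

lemma det_gram_nonzero:
  assumes K: "K \<in> carrier_mat d n"
    and indep: "\<And>x. x \<in> carrier_vec d \<Longrightarrow> (\<And>j. j < n \<Longrightarrow> (\<Sum>i<d. x $ i * K $$ (i, j)) = 0) \<Longrightarrow> x = 0\<^sub>v d"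
  shows "det (gram n d K) \<noteq> 0"
proof
  assume "det (gram n d K) = 0"
  then obtain x where x: "x \<in> carrier_vec d" "x \<noteq> 0\<^sub>v d" "gram n d K *\<^sub>v x = 0\<^sub>v d"
    using det_0_iff_vec_prod_zero[OF gram_carrier[OF K]] by blast
  let ?K' = "mat n d (\<lambda>(i, j). cnj (K $$ (j, i)))"
  define y where "y = ?K' *\<^sub>v x"
  have y: "y \<in> carrier_vec n" by (simp add: y_def carrier_vecI)
  have y_index: "y $ j = (\<Sum>i<d. cnj (K $$ (i, j)) * x $ i)" if "j < n" for j
    using that x(1) by (simp add: y_def scalar_prod_def atLeast0LessThan)
  have "K *\<^sub>v y = 0\<^sub>v d"
    using x(3) K x(1) unfolding y_def gram_def by (subst assoc_mult_mat_vec[symmetric, of _ d n _ d]) auto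
  then have "(K *\<^sub>v y) $ i = 0" if "i < d" for i using that by simp
  then have Ky: "(\<Sum>j<n. K $$ (i, j) * y $ j) = 0" if "i < d" for i
    using that carrier_matD[OF K] carrier_vecD[OF y] by (simp add: scalar_prod_def atLeast0LessThan)
  have "(\<Sum>j<n. y $ j * cnj (y $ j)) = (\<Sum>j<n. \<Sum>i<d. cnj (x $ i) * (K $$ (i, j) * y $ j))"
    by (intro sum.cong refl) (simp add: y_index sum_distrib_left mult_ac)
  also have "\<dots> = (\<Sum>i<d. cnj (x $ i) * (\<Sum>j<n. K $$ (i, j) * y $ j))"
    by (subst sum.swap) (simp add: sum_distrib_left)
  also have "\<dots> = 0" by (simp add: Ky)
  finally have "complex_of_real (\<Sum>j<n. (cmod (y $ j))\<^sup>2) = 0"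
    by (simp only: of_real_sum complex_norm_square)
  then have "(\<Sum>j<n. (cmod (y $ j))\<^sup>2) = 0" by (simp only: of_real_eq_0_iff)
  then have y0: "y $ j = 0" if "j < n" for j
    using that by (subst (asm) sum_nonneg_eq_0_iff) auto
  have "vec d (\<lambda>i. cnj (x $ i)) = 0\<^sub>v d"
  proof (rule indep)
    fix j assume j: "j < n"
    have "(\<Sum>i<d. vec d (\<lambda>i. cnj (x $ i)) $ i * K $$ (i, j)) = cnj (y $ j)"
      using j by (simp add: y_index mult.commute)
    then show "(\<Sum>i<d. vec d (\<lambda>i. cnj (x $ i)) $ i * K $$ (i, j)) = 0"
      using y0[OF j] by simp
  qed simp
  then have "cnj (x $ i) = 0" if "i < d" for i
    using that by (metis index_vec index_zero_vec(1))
  then have "x = 0\<^sub>v d" using x(1) by (intro eq_vecI) auto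
  with x(2) show False ..
qed

text \<open>Column \<open>d - 1\<close> of a right inverse of a Krylov matrix pairs to 1 with its
  last row and to 0 with the others, as is required of the vector \<open>u\<close> in
  \<open>cyclic\<close>.\<close>

definition last_column :: "nat \<Rightarrow> nat \<Rightarrow> complex mat \<Rightarrow> complex mat" where
  "last_column n d V = mat n n (\<lambda>(i, j). if j = n - 1 then V $$ (i, d - 1) else 0)"

lemma last_column_carrier [simp]: "last_column n d V \<in> carrier_mat n n"
  by (simp add: last_column_def)

lemma index_mult_mat_sum:
  "A \<in> carrier_mat nr n \<Longrightarrow> B \<in> carrier_mat n nc \<Longrightarrow> i < nr \<Longrightarrow> j < nc \<Longrightarrow>
    (A * B) $$ (i, j) = (\<Sum>r<n. A $$ (i, r) * (B $$ (r, j) :: complex))"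
  by (simp add: scalar_prod_def atLeast0LessThan)

lemma krylov_right_inverse_cyclic:
  assumes n: "0 < n" and d: "0 < d" and R: "R \<in> carrier_mat n n" and A: "A \<in> carrier_mat n n"
    and V: "V \<in> carrier_mat n d" "krylov n d R A * V = 1\<^sub>m d" and i: "i < d"
  shows "last_unit n * (R * A ^\<^sub>m i) * last_column n d V = (if i = d - 1 then last_unit n else 0\<^sub>m n n)"
    (is "?lhs = ?rhs")
proof (rule eq_matI)
  have X: "R * A ^\<^sub>m i \<in> carrier_mat n n" using R A by simp
  have XL: "R * A ^\<^sub>m i * last_column n d V \<in> carrier_mat n n" using X by simp
  have "?rhs \<in> carrier_mat n n" by simp
  moreover fix r c assume "r < dim_row ?rhs" "c < dim_col ?rhs"
  ultimately have rc: "r < n" "c < n" by auto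
  have "?lhs $$ (r, c) = (if r = n - 1 then (R * A ^\<^sub>m i * last_column n d V) $$ (n - 1, c) else 0)"
    using last_unit_mult_index[OF XL rc] X by (simp add: assoc_square[of _ n] del: index_mult_mat(1))
  also have "(R * A ^\<^sub>m i * last_column n d V) $$ (n - 1, c) = (if c = n - 1 then (krylov n d R A * V) $$ (i, d - 1) else 0)"
  proof -
    have e1: "(R * A ^\<^sub>m i * last_column n d V) $$ (n - 1, c)
        = (\<Sum>r<n. (R * A ^\<^sub>m i) $$ (n - 1, r) * last_column n d V $$ (r, c))"
      using n rc by (intro index_mult_mat_sum[OF X last_column_carrier]) auto
    have e2: "(krylov n d R A * V) $$ (i, d - 1) = (\<Sum>r<n. krylov n d R A $$ (i, r) * V $$ (r, d - 1))"
      using d i by (intro index_mult_mat_sum[OF krylov_carrier V(1)]) auto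
    show ?thesis
      unfolding e1 e2 using rc i by (cases "c = n - 1") (auto simp: last_column_def krylov_def simp del: index_mult_mat(1))
  qed
  also have "(krylov n d R A * V) $$ (i, d - 1) = (if i = d - 1 then 1 else 0)"
    using i d V(2) by simp
  finally show "?lhs $$ (r, c) = ?rhs $$ (r, c)"
    using rc by (simp add: last_unit_def)
qed (use carrier_matD[OF last_unit_carrier[of n]] carrier_matD[OF last_column_carrier[of n]] in auto)

section \<open>Independent iterates and the minimal polynomial\<close>

lemma mat_poly_append_zero:
  "A \<in> carrier_mat n n \<Longrightarrow> mat_poly n A (cs @ [0]) = mat_poly n A cs"
  by (induction cs) (simp_all add: smult_zero_square[of _ n])

lemma mat_poly_strip_zeros:
  assumes A: "A \<in> carrier_mat n n"
  shows "\<exists>cs'. mat_poly n A cs' = mat_poly n A cs \<and> length cs' \<le> length cs \<and>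
    (cs' = [] \<longrightarrow> (\<forall>c\<in>set cs. c = 0)) \<and> (cs' \<noteq> [] \<longrightarrow> last cs' \<noteq> 0)"
proof (induction cs rule: rev_induct)
  case (snoc c cs)
  show ?case
  proof (cases "c = 0")
    case True
    obtain cs' where "mat_poly n A cs' = mat_poly n A cs" "length cs' \<le> length cs"
      "cs' = [] \<longrightarrow> (\<forall>c\<in>set cs. c = 0)" "cs' \<noteq> [] \<longrightarrow> last cs' \<noteq> 0"
      using snoc by blast
    then show ?thesis
      unfolding True mat_poly_append_zero[OF A] by (intro exI[of _ cs']) simp
  next
    case False
    then show ?thesis by (intro exI[of _ "cs @ [c]"]) simp
  qed
qed simp

text \<open>Zero leading coefficients are stripped from the relation, and a power of
  \<open>A\<close> raises its degree to \<open>d - 1\<close>. Paired with \<open>u\<close>, only the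
  leading coefficient remains, so it would have to vanish.\<close>

lemma cyclic_imp_independent:
  assumes n: "0 < n" and A: "A \<in> carrier_mat n n" and U: "cyclic n d A U"
    and cs: "length cs \<le> d" "last_unit n * mat_poly n A cs = last_unit n * 0\<^sub>m n n"
  shows "\<forall>c\<in>set cs. c = 0"
proof -
  obtain cs' where cs': "mat_poly n A cs' = mat_poly n A cs" "length cs' \<le> length cs"
    "cs' = [] \<longrightarrow> (\<forall>c\<in>set cs. c = 0)" "cs' \<noteq> [] \<longrightarrow> last cs' \<noteq> 0"
    using mat_poly_strip_zeros[OF A, of cs] by blast
  have Uc: "U \<in> carrier_mat n n" using U by (simp add: cyclic_def)
  have "cs' = []"
  proof (rule ccontr)
    assume ne: "cs' \<noteq> []"
    let ?j = "d - length cs'" and ?p = "mat_poly n A cs'"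
    have "last_unit n * A ^\<^sub>m ?j * (?p * U) = last cs' \<cdot>\<^sub>m last_unit n"
      using cyclic_mat_poly[OF A U, of cs' ?j] ne cs(1) cs'(2) by simp
    moreover have "last_unit n * A ^\<^sub>m ?j * (?p * U) = 0\<^sub>m n n"
    proof -
      have p: "?p \<in> carrier_mat n n" "A ^\<^sub>m ?j \<in> carrier_mat n n" using A by simp_all
      have "A ^\<^sub>m ?j * ?p = ?p * A ^\<^sub>m ?j"
        by (rule mat_poly_intertwine[OF A A p(2) pow_mat_Suc_left[OF A, symmetric]])
      then have "A ^\<^sub>m ?j * (?p * U) = ?p * (A ^\<^sub>m ?j * U)"
        using assoc_square[OF p(2,1) Uc] assoc_square[OF p Uc] by simp
      then have "last_unit n * A ^\<^sub>m ?j * (?p * U) = last_unit n * (?p * (A ^\<^sub>m ?j * U))"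
        using assoc_square[OF last_unit_carrier p(2) mult_carrier_square[OF p(1) Uc]] by simp
      also have "\<dots> = (last_unit n * ?p) * (A ^\<^sub>m ?j * U)"
        by (rule assoc_square[OF last_unit_carrier p(1) mult_carrier_square[OF p(2) Uc], symmetric])
      finally show ?thesis
        using p(2) Uc unfolding cs'(1) cs(2) by simp
    qed
    ultimately have eq: "last cs' \<cdot>\<^sub>m last_unit n = 0\<^sub>m n n" by simp
    show False
      using arg_cong[OF eq, of "\<lambda>M. M $$ (n - 1, n - 1)"] ne cs'(4) n by (simp add: last_unit_def)
  qed
  with cs'(3) show ?thesis by simp
qed

text \<open>Existence of \<open>u\<close> becomes the nonvanishing of a continuous function, and the
  second part supplies an explicit \<open>u\<close>, which makes a continuous choice
  possible.\<close>

lemma cyclic_iff_det_gram: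
  assumes n: "0 < n" and d: "0 < d" and A: "A \<in> carrier_mat n n"
  defines "K \<equiv> krylov n d (1\<^sub>m n) A"
  shows "(\<exists>U. cyclic n d A U) \<longleftrightarrow> det (gram n d K) \<noteq> 0"
    and "det (gram n d K) \<noteq> 0 \<Longrightarrow> cyclic n d A (last_column n d (right_inverse n d K))"
proof -
  have K: "K \<in> carrier_mat d n" by (simp add: K_def)
  show *: "cyclic n d A (last_column n d (right_inverse n d K))" if "det (gram n d K) \<noteq> 0"
    using krylov_right_inverse_cyclic[OF n d one_carrier_mat A right_inverse_carrier[OF krylov_carrier]
        mult_right_inverse[OF krylov_carrier that[unfolded K_def]]] A
    by (simp add: K_def cyclic_def)
  show "(\<exists>U. cyclic n d A U) \<longleftrightarrow> det (gram n d K) \<noteq> 0"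
  proof
    assume "\<exists>U. cyclic n d A U"
    then obtain U where U: "cyclic n d A U" by blast
    have Uc: "U \<in> carrier_mat n n" using U by (simp add: cyclic_def)
    show "det (gram n d K) \<noteq> 0"
    proof (rule det_gram_nonzero[OF K])
      fix x assume x: "x \<in> carrier_vec d" "\<And>j. j < n \<Longrightarrow> (\<Sum>i<d. x $ i * K $$ (i, j)) = 0"
      let ?cs = "list_of_vec x"
      have "last_unit n * mat_poly n A ?cs = last_unit n * 0\<^sub>m n n"
        unfolding last_unit_mult_eq_iff[OF n mat_poly_carrier[OF A] zero_carrier_mat]
      proof (intro allI impI)
        fix c assume c: "c < n"
        have "(1\<^sub>m n * mat_poly n A ?cs) $$ (n - 1, c) = (\<Sum>t<d. x $ t * K $$ (t, c))"
          using x(1) A n c by (subst mat_poly_mult_index[OF A])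
            (auto simp: list_of_vec_index K_def krylov_def simp del: index_mult_mat(1) intro!: sum.cong)
        then show "mat_poly n A ?cs $$ (n - 1, c) = 0\<^sub>m n n $$ (n - 1, c)"
          using x(2)[OF c] A c n by simp
      qed
      then have "\<forall>c\<in>set ?cs. c = 0"
        using x(1) by (intro cyclic_imp_independent[OF n A U]) simp_all
      then show "x = 0\<^sub>v d"
        using x(1) by (intro eq_vecI) (auto simp: set_list_of_vec vec_set_def)
    qed
  qed (use * in blast)
qed

lemma smult_smult_mat: "a \<cdot>\<^sub>m (b \<cdot>\<^sub>m A) = (a * b :: complex) \<cdot>\<^sub>m A"
  by (intro eq_matI) simp_all

lemma mat_poly_smult:
  "A \<in> carrier_mat n n \<Longrightarrow> mat_poly n A (map ((*) c) cs) = c \<cdot>\<^sub>m mat_poly n A cs"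
proof (induction cs)
  case (Cons b cs)
  then show ?case
    by (simp add: mult_smult_distrib[of _ n n _ n] add_smult_distrib_left_mat[of _ n n] smult_smult_mat)
qed simp

text \<open>A shortest annihilating coefficient list, divided by its leading coefficient. Minimality
  is stated for all lists of length at most \<open>d\<close>, padded ones included, since this is
  how a linear relation among the first \<open>d\<close> powers arises.\<close>

lemma ex_minimal_poly:
  assumes n: "0 < n" and A: "A \<in> carrier_mat n n"
  obtains m d where "0 < d" "length m = Suc d" "last m = 1" "mat_poly n A m = 0\<^sub>m n n"
    and "\<And>cs. length cs \<le> d \<Longrightarrow> mat_poly n A cs = 0\<^sub>m n n \<Longrightarrow> \<forall>c\<in>set cs. c = 0"
proof -
  let ?P = "\<lambda>cs. (\<exists>c\<in>set cs. c \<noteq> 0) \<and> mat_poly n A cs = 0\<^sub>m n n"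
  define cs0 where "cs0 = (ARG_MIN length cs. ?P cs)"
  obtain cs1 where "?P cs1" using ex_annihilating_poly[OF A] by blast
  then have cs0: "?P cs0" unfolding cs0_def by (rule arg_min_natI)
  have le: "length cs0 \<le> length cs" if "?P cs" for cs
    unfolding cs0_def using that by (rule arg_min_nat_le)
  have ne: "cs0 \<noteq> []" using cs0(1) by auto
  have last: "last cs0 \<noteq> 0"
  proof
    assume z: "last cs0 = 0"
    obtain cs where cs: "cs0 = cs @ [0]" using append_butlast_last_id[OF ne] z by metis
    have "?P cs"
      using cs0 unfolding cs by (simp add: mat_poly_append_zero[OF A])
    then show False using le[of cs] unfolding cs by simp
  qed
  define m where "m = map ((*) (inverse (last cs0))) cs0"
  define d where "d = length cs0 - 1"
  have len: "length cs0 = Suc d" using ne by (cases cs0) (simp_all add: d_def)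
  show thesis
  proof (rule that[of d m])
    show "0 < d"
    proof (rule ccontr)
      assume "\<not> 0 < d"
      then obtain c where c: "cs0 = [c]" using len by (cases cs0) auto
      then have eq: "c \<cdot>\<^sub>m 1\<^sub>m n = 0\<^sub>m n n" using cs0 A by simp
      show False using arg_cong[OF eq, of "\<lambda>M. M $$ (0, 0)"] n c last by simp
    qed
    show "length m = Suc d" by (simp add: m_def len)
    show "last m = 1" using ne last by (simp add: m_def last_map)
    show "mat_poly n A m = 0\<^sub>m n n" using cs0 by (simp add: m_def mat_poly_smult[OF A])
    show "\<forall>c\<in>set cs. c = 0" if "length cs \<le> d" "mat_poly n A cs = 0\<^sub>m n n" for cs
      using le[of cs] that len by auto
  qed
qed

section \<open>Coadjoint orbits as conjugacy classes\<close>

lemma carrier_GL: "g \<in> carrier (GL n) \<longleftrightarrow> g \<in> carrier_mat n n \<and> det g \<noteq> 0"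
  using det_non_zero_imp_unit[of g n "()"] unit_imp_det_non_zero[of g n "()"]
  by (auto simp: GL_def units_of_def Units_def ring_mat_def)

lemma inverse_GL:
  assumes "g \<in> carrier_mat n n" "det g \<noteq> 0"
  shows "inv\<^bsub>GL n\<^esub> g \<in> carrier_mat n n" "g * inv\<^bsub>GL n\<^esub> g = 1\<^sub>m n" "inv\<^bsub>GL n\<^esub> g * g = 1\<^sub>m n"
proof -
  have "ring (ring_mat TYPE(complex) n ())" by (rule ring_mat)
  then have "monoid (ring_mat TYPE(complex) n ())" by (simp add: ring.is_monoid)
  then have "group (GL n)" unfolding GL_def by (rule monoid.units_group)
  then interpret group "GL n" .
  have g: "g \<in> carrier (GL n)" using assms by (simp add: carrier_GL)
  have *: "mult (GL n) = (*)" "one (GL n) = 1\<^sub>m n" by (simp_all add: GL_def units_of_def ring_mat_def)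
  show "inv\<^bsub>GL n\<^esub> g \<in> carrier_mat n n" using inv_closed[OF g] by (simp add: carrier_GL)
  show "g * inv\<^bsub>GL n\<^esub> g = 1\<^sub>m n" "inv\<^bsub>GL n\<^esub> g * g = 1\<^sub>m n"
    using r_inv[OF g] l_inv[OF g] by (simp_all add: *)
qed

lemma last_unit_eq_iff_row:
  assumes "0 < n" "g \<in> carrier_mat n n"
  shows "row g (n - 1) = unit_vec n (n - 1) \<longleftrightarrow> last_unit n * g = last_unit n"
proof -
  have "last_unit n * g = last_unit n \<longleftrightarrow> last_unit n * g = last_unit n * 1\<^sub>m n"
    by simp
  also have "\<dots> \<longleftrightarrow> (\<forall>j<n. g $$ (n - 1, j) = 1\<^sub>m n $$ (n - 1, j))"
    by (rule last_unit_mult_eq_iff[OF assms one_carrier_mat])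
  also have "\<dots> \<longleftrightarrow> row g (n - 1) = unit_vec n (n - 1)"
    using assms by (auto simp: vec_eq_iff unit_vec_def)
  finally show ?thesis ..
qed

lemma carrier_mirabolic:
  assumes "0 < n"
  shows "g \<in> carrier (mirabolic n) \<longleftrightarrow> g \<in> carrier_mat n n \<and> det g \<noteq> 0 \<and> last_unit n * g = last_unit n"
  using last_unit_eq_iff_row[OF assms, of g] by (auto simp: mirabolic_def carrier_GL)

lemma mirabolic_lie_iff:
  assumes "0 < n"
  shows "X \<in> mirabolic_lie n \<longleftrightarrow> X \<in> carrier_mat n n \<and> last_unit n * X = last_unit n * 0\<^sub>m n n"
proof (cases "X \<in> carrier_mat n n")
  case True
  then show ?thesis
    using assms last_unit_mult_eq_iff[OF assms True zero_carrier_mat] by (auto simp: mirabolic_lie_def vec_eq_iff)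
qed (simp add: mirabolic_lie_def)

lemma mat_trace_mult:
  assumes "A \<in> carrier_mat n n" "B \<in> carrier_mat n n"
  shows "mat_trace (A * B) = (\<Sum>i<n. \<Sum>j<n. A $$ (i, j) * B $$ (j, i))"
  using assms by (simp add: mat_trace_def scalar_prod_def atLeast0LessThan)

lemma mat_trace_commute:
  assumes "A \<in> carrier_mat n n" "B \<in> carrier_mat n n"
  shows "mat_trace (A * B) = mat_trace (B * A)"
  unfolding mat_trace_mult[OF assms] mat_trace_mult[OF assms(2,1)]
  by (subst sum.swap) (simp add: mult.commute)

lemma pr_apply: "Y \<in> carrier_mat n n \<Longrightarrow> pr n A Y = mat_trace (A * Y)"
  by (simp add: pr_def)

text \<open>This is the cyclicity of the trace. Conjugacy is expressed by
  \<open>g * A = B * g\<close>, the form in which the intertwiners are constructed.\<close>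

lemma coadjoint_pr:
  assumes g: "g \<in> carrier_mat n n" "det g \<noteq> 0" and A: "A \<in> carrier_mat n n" "B \<in> carrier_mat n n"
    and gA: "g * A = B * g"
  shows "coadjoint n (gl n) g (pr n A) = pr n B"
proof
  fix Y
  let ?h = "inv\<^bsub>GL n\<^esub> g"
  note h = inverse_GL[OF g]
  show "coadjoint n (gl n) g (pr n A) Y = pr n B Y"
  proof (cases "Y \<in> carrier_mat n n")
    case True
    have hYg: "?h * Y * g \<in> carrier_mat n n" using h(1) True g(1) by simp
    have "coadjoint n (gl n) g (pr n A) Y = mat_trace (A * (?h * Y) * g)"
      using True hYg h(1) g(1) A(1) by (simp add: coadjoint_def pr_apply assoc_square[of _ n])
    also have "\<dots> = mat_trace (g * (A * (?h * Y)))"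
      using True h(1) g(1) A(1) by (intro mat_trace_commute[of _ n]) simp_all
    also have "g * (A * (?h * Y)) = (g * A) * ?h * Y"
      using True h(1) g(1) A(1) by (simp add: assoc_square[of _ n])
    also have "\<dots> = B * (g * ?h) * Y"
      using A(2) g(1) h(1) unfolding gA by (simp add: assoc_square[of _ n])
    also have "\<dots> = B * Y" using A(2) h(2) by simp
    finally show ?thesis using True by (simp add: pr_apply)
  qed (simp add: coadjoint_def pr_def)
qed

definition conj_class :: "nat \<Rightarrow> complex mat \<Rightarrow> complex mat set" where
  "conj_class n A = {B \<in> carrier_mat n n. \<exists>g\<in>carrier_mat n n. det g \<noteq> 0 \<and> g * A = B * g}"

definition mirabolic_class :: "nat \<Rightarrow> complex mat \<Rightarrow> complex mat set" where
  "mirabolic_class n A = {B \<in> carrier_mat n n. \<exists>g\<in>carrier_mat n n.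
     det g \<noteq> 0 \<and> last_unit n * g = last_unit n \<and> g * A = B * g}"

lemma ex_conjugate:
  fixes g A :: "complex mat"
  assumes g: "g \<in> carrier_mat n n" "det g \<noteq> 0" and A: "A \<in> carrier_mat n n"
  shows "\<exists>B\<in>carrier_mat n n. g * A = B * g"
proof -
  note h = inverse_GL[OF g]
  have "g * A * inv\<^bsub>GL n\<^esub> g * g = g * A"
    using assoc_square[OF mult_carrier_square[OF g(1) A] h(1) g(1)] h(3) g(1) A by simp
  then show ?thesis
    using g(1) A h(1) by (intro bexI[of _ "g * A * inv\<^bsub>GL n\<^esub> g"]) simp_all
qed

lemma intertwine_compose:
  fixes A B C g h :: "complex mat"
  assumes carr: "A \<in> carrier_mat n n" "B \<in> carrier_mat n n" "C \<in> carrier_mat n n"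
      "g \<in> carrier_mat n n" "h \<in> carrier_mat n n"
    and eq: "g * A = B * g" "h * B = C * h"
  shows "h * g * A = C * (h * g)"
proof -
  have "h * g * A = h * (B * g)" unfolding eq(1)[symmetric] by (rule assoc_square[OF carr(5,4,1)])
  also have "\<dots> = C * h * g" unfolding eq(2)[symmetric] by (rule assoc_square[OF carr(5,2,4), symmetric])
  also have "\<dots> = C * (h * g)" by (rule assoc_square[OF carr(3,5,4)])
  finally show ?thesis .
qed

lemma orbit_GL_pr:
  assumes A: "A \<in> carrier_mat n n"
  shows "orbit (GL n) (coadjoint n (gl n)) (pr n A) = pr n ` conj_class n A"
proof (intro equalityI subsetI)
  fix x assume "x \<in> orbit (GL n) (coadjoint n (gl n)) (pr n A)"
  then obtain g where g: "g \<in> carrier_mat n n" "det g \<noteq> 0" "x = coadjoint n (gl n) g (pr n A)"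
    by (auto simp: orbit_def carrier_GL)
  obtain B where "B \<in> carrier_mat n n" "g * A = B * g" using ex_conjugate[OF g(1,2) A] by blast
  then show "x \<in> pr n ` conj_class n A"
    using g A by (auto simp: conj_class_def coadjoint_pr intro!: image_eqI[of _ _ B])
next
  fix x assume "x \<in> pr n ` conj_class n A"
  then obtain B g where "x = pr n B" "B \<in> carrier_mat n n" "g \<in> carrier_mat n n" "det g \<noteq> 0" "g * A = B * g"
    by (auto simp: conj_class_def)
  then show "x \<in> orbit (GL n) (coadjoint n (gl n)) (pr n A)"
    using A coadjoint_pr[of g n A B] by (auto simp: orbit_def carrier_GL intro!: exI[of _ g])
qed

lemma orbit_mirabolic_pr:
  assumes n: "0 < n" and A: "A \<in> carrier_mat n n"
  shows "orbit (mirabolic n) (coadjoint n (gl n)) (pr n A) = pr n ` mirabolic_class n A"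
proof (intro equalityI subsetI)
  fix x assume "x \<in> orbit (mirabolic n) (coadjoint n (gl n)) (pr n A)"
  then obtain g where g: "g \<in> carrier_mat n n" "det g \<noteq> 0" "last_unit n * g = last_unit n"
    "x = coadjoint n (gl n) g (pr n A)"
    by (auto simp: orbit_def carrier_mirabolic[OF n])
  obtain B where "B \<in> carrier_mat n n" "g * A = B * g" using ex_conjugate[OF g(1,2) A] by blast
  then show "x \<in> pr n ` mirabolic_class n A"
    using g A by (auto simp: mirabolic_class_def coadjoint_pr intro!: image_eqI[of _ _ B])
next
  fix x assume "x \<in> pr n ` mirabolic_class n A"
  then obtain B g where "x = pr n B" "B \<in> carrier_mat n n" "g \<in> carrier_mat n n" "det g \<noteq> 0"
    "last_unit n * g = last_unit n" "g * A = B * g"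
    by (auto simp: mirabolic_class_def)
  then show "x \<in> orbit (mirabolic n) (coadjoint n (gl n)) (pr n A)"
    using A coadjoint_pr[of g n A B] by (auto simp: orbit_def carrier_mirabolic[OF n] intro!: exI[of _ g])
qed

text \<open>A matrix fixing \<phi> has an inverse fixing \<phi>, so conjugation by it preserves the
  matrices with zero last row. Restriction of forms is therefore equivariant.\<close>

lemma coadjoint_moment_map:
  assumes n: "0 < n" and g: "g \<in> carrier_mat n n" "det g \<noteq> 0" "last_unit n * g = last_unit n"
  shows "coadjoint n (mirabolic_lie n) g (moment_map n h) = moment_map n (coadjoint n (gl n) g h)"
proof
  fix X
  let ?k = "inv\<^bsub>GL n\<^esub> g"
  note k = inverse_GL[OF g(1,2)]
  show "coadjoint n (mirabolic_lie n) g (moment_map n h) X = moment_map n (coadjoint n (gl n) g h) X"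
  proof (cases "X \<in> mirabolic_lie n")
    case True
    then have X: "X \<in> carrier_mat n n" "last_unit n * X = last_unit n * 0\<^sub>m n n"
      using mirabolic_lie_iff[OF n] by auto
    have "last_unit n * ?k = last_unit n * g * ?k" by (simp add: g(3))
    then have E: "last_unit n * ?k = last_unit n" using g(1) k by (simp add: assoc_square[of _ n])
    have "last_unit n * (?k * X * g) = last_unit n * ?k * X * g"
      using X(1) g(1) k(1) by (simp add: assoc_square[of _ n])
    also have "\<dots> = last_unit n * 0\<^sub>m n n"
      using g(1) unfolding E X(2) by simp
    finally have "?k * X * g \<in> mirabolic_lie n"
      using X(1) g(1) k(1) by (simp add: mirabolic_lie_iff[OF n])
    then show ?thesis using True X(1) by (simp add: coadjoint_def moment_map_def)
  qed (simp add: coadjoint_def moment_map_def)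
qed

lemma orbit_mirabolic_moment:
  assumes n: "0 < n" and A: "A \<in> carrier_mat n n"
  shows "orbit (mirabolic n) (coadjoint n (mirabolic_lie n)) (moment_map n (pr n A))
    = moment_map n ` pr n ` mirabolic_class n A"
  unfolding orbit_mirabolic_pr[OF n A, symmetric] orbit_def setcompr_eq_image image_image
  by (rule image_cong[OF refl], rule coadjoint_moment_map[OF n]) (simp_all add: carrier_mirabolic[OF n])

lemma mirabolic_class_subset: "mirabolic_class n A \<subseteq> conj_class n A"
  unfolding mirabolic_class_def conj_class_def by blast

lemma conj_class_trans:
  assumes A: "A \<in> carrier_mat n n" and "B \<in> conj_class n A" "C \<in> conj_class n B"
  shows "C \<in> conj_class n A"
proof -
  obtain g h where *: "B \<in> carrier_mat n n" "C \<in> carrier_mat n n" "g \<in> carrier_mat n n" "h \<in> carrier_mat n n"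
    "det g \<noteq> 0" "det h \<noteq> 0" "g * A = B * g" "h * B = C * h"
    using assms(2,3) by (auto simp: conj_class_def)
  have "h * g * A = C * (h * g)"
    by (rule intertwine_compose[OF A *(1-4,7,8)])
  then show ?thesis using * by (auto simp: conj_class_def det_mult[of _ n] intro!: bexI[of _ "h * g"])
qed

lemma mirabolic_class_trans:
  assumes A: "A \<in> carrier_mat n n" and "B \<in> mirabolic_class n A" "C \<in> mirabolic_class n B"
  shows "C \<in> mirabolic_class n A"
proof -
  obtain g h where *: "B \<in> carrier_mat n n" "C \<in> carrier_mat n n" "g \<in> carrier_mat n n" "h \<in> carrier_mat n n"
    "det g \<noteq> 0" "det h \<noteq> 0" "g * A = B * g" "h * B = C * h"
    "last_unit n * g = last_unit n" "last_unit n * h = last_unit n"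
    using assms(2,3) by (auto simp: mirabolic_class_def)
  have "h * g * A = C * (h * g)"
    by (rule intertwine_compose[OF A *(1-4,7,8)])
  moreover have "last_unit n * (h * g) = last_unit n"
    using assoc_square[OF last_unit_carrier *(4,3)] *(9,10) by simp
  ultimately show ?thesis
    using * by (auto simp: mirabolic_class_def det_mult[of _ n] intro!: bexI[of _ "h * g"])
qed

lemma mirabolic_class_sym:
  assumes A: "A \<in> carrier_mat n n" and B: "B \<in> mirabolic_class n A"
  shows "A \<in> mirabolic_class n B"
proof -
  obtain g where g: "B \<in> carrier_mat n n" "g \<in> carrier_mat n n" "det g \<noteq> 0"
    "g * A = B * g" "last_unit n * g = last_unit n"
    using B by (auto simp: mirabolic_class_def)
  let ?h = "inv\<^bsub>GL n\<^esub> g"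
  note h = inverse_GL[OF g(2,3)]
  have "?h * B = ?h * (B * g) * ?h" using g(1,2) h by (simp add: assoc_square[of _ n])
  also have "\<dots> = ?h * g * A * ?h" unfolding g(4)[symmetric] using assoc_square[OF h(1) g(2) A] by simp
  also have "\<dots> = A * ?h" using A unfolding h(3) by simp
  finally have "?h * B = A * ?h" .
  moreover have "last_unit n * ?h = last_unit n * g * ?h" by (simp add: g(5))
  then have "last_unit n * ?h = last_unit n" using g(2) h by (simp add: assoc_square[of _ n])
  moreover have "det ?h \<noteq> 0" using inverse_det_nonzero[OF h(1) g(2) h(3)] .
  ultimately show ?thesis using A h(1) by (auto simp: mirabolic_class_def)
qed

lemma mirabolic_class_refl: "A \<in> carrier_mat n n \<Longrightarrow> A \<in> mirabolic_class n A"
  by (auto simp: mirabolic_class_def intro!: bexI[of _ "1\<^sub>m n"])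

lemma mirabolic_class_eq:
  assumes "A \<in> carrier_mat n n" "B \<in> mirabolic_class n A"
  shows "mirabolic_class n B = mirabolic_class n A"
  using assms mirabolic_class_trans mirabolic_class_sym
  by (metis (no_types, lifting) mem_Collect_eq mirabolic_class_def subsetI subset_antisym)

section \<open>Linear forms and their matrices\<close>

definition elementary :: "nat \<Rightarrow> nat \<Rightarrow> nat \<Rightarrow> complex mat" where
  "elementary n i j = mat n n (\<lambda>(r, c). if r = i \<and> c = j then 1 else 0)"

lemma elementary_carrier [simp]: "elementary n i j \<in> carrier_mat n n"
  by (simp add: elementary_def)

lemma elementary_mirabolic_lie: "i < n \<Longrightarrow> i \<noteq> n - 1 \<Longrightarrow> elementary n i j \<in> mirabolic_lie n"
  by (auto simp: mirabolic_lie_def elementary_def vec_eq_iff)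

lemma pr_elementary:
  assumes A: "A \<in> carrier_mat n n" and ij: "i < n" "j < n"
  shows "pr n A (elementary n j i) = A $$ (i, j)"
proof -
  have "pr n A (elementary n j i) = (\<Sum>r<n. \<Sum>c<n. A $$ (r, c) * elementary n j i $$ (c, r))"
    using mat_trace_mult[OF A elementary_carrier] by (simp add: pr_apply)
  also have "\<dots> = (\<Sum>r<n. \<Sum>c<n. if c = j then if r = i then A $$ (r, c) else 0 else 0)"
    by (intro sum.cong refl) (auto simp: elementary_def)
  also have "\<dots> = A $$ (i, j)"
    using ij by simp
  finally show ?thesis .
qed

lemma mirabolic_lie_index:
  "X \<in> mirabolic_lie n \<longleftrightarrow> X \<in> gl n \<and> (\<forall>j<n. X $$ (n - 1, j) = 0)"
proof -
  have "row X (n - 1) = 0\<^sub>v n \<longleftrightarrow> (\<forall>j<n. X $$ (n - 1, j) = 0)" if X: "X \<in> gl n"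
  proof
    assume eq: "row X (n - 1) = 0\<^sub>v n"
    show "\<forall>j<n. X $$ (n - 1, j) = 0"
    proof (intro allI impI)
      fix j assume "j < n"
      then show "X $$ (n - 1, j) = 0"
        using arg_cong[OF eq, of "\<lambda>v. v $ j"] carrier_matD(2)[OF X] by (simp add: row_def)
    qed
  next
    assume "\<forall>j<n. X $$ (n - 1, j) = 0"
    then show "row X (n - 1) = 0\<^sub>v n"
      using carrier_matD(2)[OF X] by (intro eq_vecI) (simp_all add: row_def)
  qed
  then show ?thesis by (auto simp: mirabolic_lie_def)
qed

text \<open>The trace pairs the last column of \<open>A\<close> with the last row of
  \<open>X\<close>, which is zero on \<open>mirabolic_lie n\<close>; elementary matrices outside
  that row detect all other entries.\<close>

lemma moment_map_pr_eq_iff: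
  assumes n: "0 < n" and A: "A \<in> carrier_mat n n" and B: "B \<in> carrier_mat n n"
  shows "moment_map n (pr n A) = moment_map n (pr n B) \<longleftrightarrow> (\<forall>i<n. \<forall>j<n - 1. A $$ (i, j) = B $$ (i, j))"
proof
  assume eq: "moment_map n (pr n A) = moment_map n (pr n B)"
  show "\<forall>i<n. \<forall>j<n - 1. A $$ (i, j) = B $$ (i, j)"
  proof (intro allI impI)
    fix i j assume ij: "i < n" "j < n - 1"
    then have "elementary n j i \<in> mirabolic_lie n" by (intro elementary_mirabolic_lie) auto
    then have "pr n A (elementary n j i) = pr n B (elementary n j i)"
      using fun_cong[OF eq, of "elementary n j i"] by (simp add: moment_map_def)
    then show "A $$ (i, j) = B $$ (i, j)"
      using ij by (simp add: pr_elementary[OF A] pr_elementary[OF B])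
  qed
next
  assume eq: "\<forall>i<n. \<forall>j<n - 1. A $$ (i, j) = B $$ (i, j)"
  have "pr n A X = pr n B X" if X: "X \<in> mirabolic_lie n" for X
  proof -
    have Xc: "X \<in> carrier_mat n n" "\<And>j. j < n \<Longrightarrow> X $$ (n - 1, j) = 0"
      using X by (simp_all add: mirabolic_lie_index)
    have *: "A $$ (i, j) * X $$ (j, i) = B $$ (i, j) * X $$ (j, i)" if "i < n" "j < n" for i j
    proof (cases "j = n - 1")
      case False
      then have "A $$ (i, j) = B $$ (i, j)" using eq that by simp
      then show ?thesis by simp
    next
      case True
      then have "X $$ (j, i) = 0" using Xc(2)[OF that(1)] by simp
      then show ?thesis by simp
    qed
    show ?thesis
      unfolding pr_apply[OF Xc(1)] mat_trace_mult[OF A Xc(1)] mat_trace_mult[OF B Xc(1)]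
      by (intro sum.cong refl *) simp_all
  qed
  then show "moment_map n (pr n A) = moment_map n (pr n B)"
    by (auto simp: moment_map_def)
qed

lemma pr_linear_dual:
  assumes A: "A \<in> carrier_mat n n"
  shows "pr n A \<in> linear_dual (gl n)"
  unfolding linear_dual_def
proof (intro CollectI conjI ballI allI)
  show "pr n A \<in> extensional (gl n)" by (simp add: pr_def)
  fix X Y :: "complex mat" and c assume X: "X \<in> gl n"
  show "pr n A (c \<cdot>\<^sub>m X) = c * pr n A X"
    using X by (simp add: pr_apply[of _ n] mat_trace_mult[OF A] sum_distrib_left mult_ac)
  assume Y: "Y \<in> gl n"
  show "pr n A (X + Y) = pr n A X + pr n A Y"
    using X Y by (simp add: pr_apply[of _ n] mat_trace_mult[OF A] distrib_left sum.distrib)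
qed

lemma linear_dual_eq_pr:
  assumes h: "h \<in> linear_dual (gl n)"
  shows "\<exists>A\<in>carrier_mat n n. h = pr n A"
proof -
  have ext: "h \<in> extensional (gl n)" and add: "\<And>X Y. X \<in> gl n \<Longrightarrow> Y \<in> gl n \<Longrightarrow> h (X + Y) = h X + h Y"
    and smult: "\<And>c X. X \<in> gl n \<Longrightarrow> h (c \<cdot>\<^sub>m X) = c * h X"
    using h by (auto simp: linear_dual_def)
  define A where "A = mat n n (\<lambda>(i, j). h (elementary n j i))"
  have A: "A \<in> carrier_mat n n" by (simp add: A_def)
  have "h X = pr n A X" if X: "X \<in> gl n" for X
  proof -
    \<comment> \<open>Adding the positions of \<open>S\<close> one by one expands \<open>X\<close>
      into elementary matrices.\<close>
    define part where "part S = mat n n (\<lambda>(i, j). if (i, j) \<in> S then X $$ (i, j) else 0)" for S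
    have partial_sum: "h (part S) = (\<Sum>(i, j)\<in>S. X $$ (i, j) * h (elementary n i j))" if "finite S" for S
      using that
    proof induction
      case empty
      have "part {} = 0 \<cdot>\<^sub>m X" using X by (auto simp: part_def intro!: eq_matI)
      then show ?case using smult[OF X, of 0] by simp
    next
      case (insert p S)
      obtain i j where p: "p = (i, j)" by (cases p)
      have "part (insert p S) = part S + X $$ (i, j) \<cdot>\<^sub>m elementary n i j"
        using insert(2) by (auto simp: part_def elementary_def p intro!: eq_matI)
      moreover have "part S \<in> gl n" by (simp add: part_def)
      ultimately show ?case
        using insert by (simp add: add smult p)
    qed
    have "part ({..<n} \<times> {..<n}) = X" using X by (auto simp: part_def intro!: eq_matI)
    then have "h X = (\<Sum>i<n. \<Sum>j<n. X $$ (i, j) * h (elementary n i j))"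
      using partial_sum[of "{..<n} \<times> {..<n}"] by (simp add: sum.cartesian_product)
    also have "\<dots> = (\<Sum>i<n. \<Sum>j<n. A $$ (j, i) * X $$ (i, j))"
      by (intro sum.cong refl) (simp add: A_def mult.commute)
    also have "\<dots> = pr n A X"
      by (subst sum.swap) (simp add: pr_apply[OF X] mat_trace_mult[OF A X])
    finally show ?thesis .
  qed
  then have "h = pr n A"
    using ext by (intro extensionalityI[of _ "gl n"]) (auto simp: pr_def)
  then show ?thesis using A by blast
qed

lemma mirabolic_lie_closed:
  assumes "X \<in> mirabolic_lie n"
  shows "X \<in> gl n" "Y \<in> mirabolic_lie n \<Longrightarrow> X + Y \<in> mirabolic_lie n" "c \<cdot>\<^sub>m X \<in> mirabolic_lie n"
proof -
  have X: "X \<in> gl n" "\<And>j. j < n \<Longrightarrow> X $$ (n - 1, j) = 0" using assms by (simp_all add: mirabolic_lie_index)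
  show "X \<in> gl n" by fact
  show "X + Y \<in> mirabolic_lie n" if "Y \<in> mirabolic_lie n"
    using that X by (auto simp: mirabolic_lie_index)
  show "c \<cdot>\<^sub>m X \<in> mirabolic_lie n"
    using X by (simp add: mirabolic_lie_index)
qed

lemma moment_map_linear_dual:
  assumes "h \<in> linear_dual (gl n)"
  shows "moment_map n h \<in> linear_dual (mirabolic_lie n)"
  using assms by (simp add: linear_dual_def moment_map_def mirabolic_lie_closed)

section \<open>Continuity\<close>

lemma continuous_map_iff_tendsto:
  "continuous_map X euclidean f \<longleftrightarrow> (\<forall>x\<in>topspace X. (f \<longlongrightarrow> f x) (atin X x))"
  by (simp add: continuous_map_atin)

lemma continuous_map_mult:
  fixes f g :: "'a \<Rightarrow> complex"
  assumes "continuous_map X euclidean f" "continuous_map X euclidean g"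
  shows "continuous_map X euclidean (\<lambda>x. f x * g x)"
  using assms unfolding continuous_map_iff_tendsto by (intro ballI tendsto_mult) auto

lemma continuous_map_prod_complex:
  fixes f :: "'a \<Rightarrow> 'b \<Rightarrow> complex"
  assumes "\<And>i. i \<in> I \<Longrightarrow> continuous_map X euclidean (\<lambda>x. f x i)"
  shows "continuous_map X euclidean (\<lambda>x. \<Prod>i\<in>I. f x i)"
  using assms unfolding continuous_map_iff_tendsto by (intro ballI tendsto_prod) auto

lemma continuous_map_inverse_complex:
  fixes f :: "'a \<Rightarrow> complex"
  assumes "continuous_map X euclidean f" "\<And>x. x \<in> topspace X \<Longrightarrow> f x \<noteq> 0"
  shows "continuous_map X euclidean (\<lambda>x. inverse (f x))"
  using assms unfolding continuous_map_iff_tendsto by (intro ballI tendsto_inverse) auto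

lemma continuous_map_cnj:
  assumes "continuous_map X euclidean f"
  shows "continuous_map X euclidean (\<lambda>x. cnj (f x))"
  using assms unfolding continuous_map_iff_tendsto by (intro ballI tendsto_cnj) auto

text \<open>The dimensions are required at every point, also outside the topological space, so that
  formulas for entries can be rewritten unconditionally.\<close>

definition continuous_mat :: "'a topology \<Rightarrow> nat \<Rightarrow> nat \<Rightarrow> ('a \<Rightarrow> complex mat) \<Rightarrow> bool" where
  "continuous_mat X nr nc M \<longleftrightarrow> (\<forall>x. M x \<in> carrier_mat nr nc) \<and>
     (\<forall>i<nr. \<forall>j<nc. continuous_map X euclidean (\<lambda>x. M x $$ (i, j)))"

lemma continuous_matI:
  assumes "\<And>x. M x \<in> carrier_mat nr nc"
    and "\<And>i j. i < nr \<Longrightarrow> j < nc \<Longrightarrow> continuous_map X euclidean (\<lambda>x. M x $$ (i, j))"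
  shows "continuous_mat X nr nc M"
  using assms by (simp add: continuous_mat_def)

lemma continuous_matD:
  assumes "continuous_mat X nr nc M"
  shows "M x \<in> carrier_mat nr nc" "i < nr \<Longrightarrow> j < nc \<Longrightarrow> continuous_map X euclidean (\<lambda>x. M x $$ (i, j))"
  using assms by (auto simp: continuous_mat_def)

lemma continuous_mat_const: "A \<in> carrier_mat nr nc \<Longrightarrow> continuous_mat X nr nc (\<lambda>x. A)"
  by (simp add: continuous_mat_def)

lemma continuous_mat_mat:
  assumes "\<And>i j. i < nr \<Longrightarrow> j < nc \<Longrightarrow> continuous_map X euclidean (\<lambda>x. f x i j)"
  shows "continuous_mat X nr nc (\<lambda>x. mat nr nc (\<lambda>(i, j). f x i j))"
  using assms by (intro continuous_matI) simp_all

lemma continuous_mat_add: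
  assumes M: "continuous_mat X nr nc M" and N: "continuous_mat X nr nc N"
  shows "continuous_mat X nr nc (\<lambda>x. M x + N x)"
proof (rule continuous_matI)
  fix i j assume ij: "i < nr" "j < nc"
  have "(M x + N x) $$ (i, j) = M x $$ (i, j) + N x $$ (i, j)" for x
    using ij carrier_matD[OF continuous_matD(1)[OF N]] by simp
  then show "continuous_map X euclidean (\<lambda>x. (M x + N x) $$ (i, j))"
    using ij by (simp add: continuous_map_add continuous_matD(2)[OF M] continuous_matD(2)[OF N])
qed (use continuous_matD(1)[OF M] continuous_matD(1)[OF N] in auto)

lemma continuous_mat_mult:
  assumes M: "continuous_mat X nr n M" and N: "continuous_mat X n nc N"
  shows "continuous_mat X nr nc (\<lambda>x. M x * N x)"
proof (rule continuous_matI)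
  fix i j assume ij: "i < nr" "j < nc"
  have eq: "(M x * N x) $$ (i, j) = (\<Sum>r<n. M x $$ (i, r) * N x $$ (r, j))" for x
    by (rule index_mult_mat_sum[OF continuous_matD(1)[OF M] continuous_matD(1)[OF N] ij])
  show "continuous_map X euclidean (\<lambda>x. (M x * N x) $$ (i, j))"
    unfolding eq using ij
    by (intro continuous_map_sum continuous_map_mult continuous_matD(2)[OF M] continuous_matD(2)[OF N]) auto
next
  show "M x * N x \<in> carrier_mat nr nc" for x
    using continuous_matD(1)[OF M] continuous_matD(1)[OF N] by (rule mult_carrier_mat)
qed

lemma continuous_mat_smult:
  assumes f: "continuous_map X euclidean f" and M: "continuous_mat X nr nc M"
  shows "continuous_mat X nr nc (\<lambda>x. f x \<cdot>\<^sub>m M x)"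
proof (rule continuous_matI)
  fix i j assume ij: "i < nr" "j < nc"
  have "(f x \<cdot>\<^sub>m M x) $$ (i, j) = f x * M x $$ (i, j)" for x
    using ij carrier_matD[OF continuous_matD(1)[OF M]] by simp
  then show "continuous_map X euclidean (\<lambda>x. (f x \<cdot>\<^sub>m M x) $$ (i, j))"
    using ij by (simp add: continuous_map_mult f continuous_matD(2)[OF M])
qed (use continuous_matD(1)[OF M] in auto)

lemma continuous_mat_uminus:
  assumes M: "continuous_mat X nr nc M"
  shows "continuous_mat X nr nc (\<lambda>x. - M x)"
proof -
  have "- M x = (- 1) \<cdot>\<^sub>m M x" for x by (intro eq_matI) auto
  then show ?thesis using continuous_mat_smult[OF _ M, of "\<lambda>x. - 1"] by simp
qed

lemma continuous_mat_pow:
  assumes M: "continuous_mat X n n M"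
  shows "continuous_mat X n n (\<lambda>x. M x ^\<^sub>m k)"
proof (induction k)
  case 0
  have "M x ^\<^sub>m 0 = 1\<^sub>m n" for x by (rule pow_mat_0_square[OF continuous_matD(1)[OF M]])
  then show ?case by (simp add: continuous_mat_const)
next
  case (Suc k)
  then show ?case using continuous_mat_mult[OF Suc M] by simp
qed

lemma continuous_mat_poly:
  assumes M: "continuous_mat X n n M"
  shows "continuous_mat X n n (\<lambda>x. mat_poly n (M x) cs)"
proof (induction cs)
  case (Cons c cs)
  show ?case
    unfolding mat_poly.simps by (intro continuous_mat_add continuous_mat_mult[where n = n] M Cons continuous_mat_const) simp
qed (simp add: continuous_mat_const)

lemma continuous_map_det:
  assumes M: "continuous_mat X n n M"
  shows "continuous_map X euclidean (\<lambda>x. det (M x))"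
proof -
  have "det (M x) = (\<Sum>p | p permutes {0..<n}. of_int (sign p) * (\<Prod>i = 0..<n. M x $$ (i, p i)))" for x
    by (rule det_def'[OF continuous_matD(1)[OF M]])
  moreover have perm: "p i < n" if "p permutes {0..<n}" "i < n" for p i
    using permutes_in_image[OF that(1), of i] that(2) by simp
  have "continuous_map X euclidean
    (\<lambda>x. \<Sum>p | p permutes {0..<n}. of_int (sign p) * (\<Prod>i = 0..<n. M x $$ (i, p i)))"
    by (intro continuous_map_sum continuous_map_mult continuous_map_prod_complex continuous_matD(2)[OF M])
       (use perm in \<open>auto simp: finite_permutations\<close>)
  ultimately show ?thesis by simp
qed

lemma continuous_mat_adj:
  assumes M: "continuous_mat X n n M"
  shows "continuous_mat X n n (\<lambda>x. adj_mat (M x))"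
proof (rule continuous_matI)
  fix i j assume ij: "i < n" "j < n"
  note dims = carrier_matD[OF continuous_matD(1)[OF M]]
  have eq: "adj_mat (M x) $$ (i, j) = (- 1) ^ (j + i) * det (mat_delete (M x) j i)" for x
    using ij dims by (simp add: adj_mat_def cofactor_def)
  have "continuous_mat X (n - 1) (n - 1) (\<lambda>x. mat_delete (M x) j i)"
    unfolding mat_delete_def dims using ij
    by (intro continuous_mat_mat continuous_matD(2)[OF M]) auto
  then show "continuous_map X euclidean (\<lambda>x. adj_mat (M x) $$ (i, j))"
    unfolding eq by (intro continuous_map_mult continuous_map_det) simp_all
qed (rule adj_mat(1)[OF continuous_matD(1)[OF M]])

lemma continuous_mat_krylov:
  assumes R: "continuous_mat X n n R" and A: "continuous_mat X n n A" and n: "0 < n"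
  shows "continuous_mat X d n (\<lambda>x. krylov n d (R x) (A x))"
  unfolding krylov_def using n
  by (intro continuous_mat_mat continuous_matD(2)[OF continuous_mat_mult[OF R continuous_mat_pow[OF A]]]) auto

lemma continuous_mat_gram:
  assumes K: "continuous_mat X d n K"
  shows "continuous_mat X d d (\<lambda>x. gram n d (K x))"
  unfolding gram_def
  by (intro continuous_mat_mult[OF K] continuous_mat_mat continuous_map_cnj continuous_matD(2)[OF K])

lemma continuous_mat_right_inverse:
  assumes K: "continuous_mat X d n K" and nz: "\<And>x. x \<in> topspace X \<Longrightarrow> det (gram n d (K x)) \<noteq> 0"
  shows "continuous_mat X n d (\<lambda>x. right_inverse n d (K x))"
  unfolding right_inverse_def
  by (intro continuous_mat_mult[where n = d] continuous_mat_mat continuous_map_cnj continuous_matD(2)[OF K]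
      continuous_mat_smult continuous_map_inverse_complex continuous_map_det[where n = d] continuous_mat_gram[OF K]
      continuous_mat_adj nz)

lemma continuous_mat_last_column:
  assumes V: "continuous_mat X n d V" and d: "0 < d"
  shows "continuous_mat X n n (\<lambda>x. last_column n d (V x))"
  unfolding last_column_def
proof (rule continuous_mat_mat)
  fix i j assume "i < n" "j < n"
  then show "continuous_map X euclidean (\<lambda>x. if j = n - 1 then V x $$ (i, d - 1) else 0)"
    using d continuous_matD(2)[OF V, of i "d - 1"] by (cases "j = n - 1") simp_all
qed

lemma continuous_map_pr:
  assumes M: "continuous_mat X n n M"
  shows "continuous_map X (dual_topology (gl n)) (\<lambda>x. pr n (M x))"
  unfolding dual_topology_def continuous_map_in_subtopology continuous_map_componentwise
proof (intro conjI ballI)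
  fix Z assume Z: "Z \<in> gl n"
  have eq: "pr n (M x) Z = (\<Sum>i<n. \<Sum>j<n. M x $$ (i, j) * Z $$ (j, i))" for x
    using pr_apply[OF Z] mat_trace_mult[OF continuous_matD(1)[OF M] Z] by simp
  show "continuous_map X euclidean (\<lambda>x. pr n (M x) Z)"
    unfolding eq by (intro continuous_map_sum continuous_map_mult continuous_matD(2)[OF M]) auto
qed (use pr_linear_dual[OF continuous_matD(1)[OF M]] in \<open>auto simp: pr_def\<close>)

lemma continuous_map_dual_apply:
  assumes "Z \<in> V"
  shows "continuous_map (dual_topology V) euclidean (\<lambda>h. h Z)"
  unfolding dual_topology_def
  by (intro continuous_map_from_subtopology continuous_map_product_projection[OF assms])

lemma topspace_dual_topology: "topspace (dual_topology V) = linear_dual V"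
  by (auto simp: dual_topology_def linear_dual_def PiE_def)

lemma continuous_map_moment_map:
  "continuous_map (dual_topology (gl n)) (dual_topology (mirabolic_lie n)) (moment_map n)"
  unfolding dual_topology_def[of "mirabolic_lie n"] continuous_map_in_subtopology continuous_map_componentwise
proof (intro conjI ballI)
  fix Z assume Z: "Z \<in> mirabolic_lie n"
  then show "continuous_map (dual_topology (gl n)) euclidean (\<lambda>x. moment_map n x Z)"
    using continuous_map_dual_apply[OF mirabolic_lie_closed(1)[OF Z]] by (simp add: moment_map_def)
qed (auto simp: moment_map_def topspace_dual_topology intro: moment_map_linear_dual[unfolded moment_map_def])

text \<open>The matrix with vanishing last column whose form restricts to \<open>b\<close>.\<close>

definition form_mat :: "nat \<Rightarrow> (complex mat \<Rightarrow> complex) \<Rightarrow> complex mat" where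
  "form_mat n b = mat n n (\<lambda>(i, j). if j < n - 1 then b (elementary n j i) else 0)"

lemma form_mat_carrier [simp]: "form_mat n b \<in> carrier_mat n n"
  by (simp add: form_mat_def)

lemma continuous_mat_form_mat: "continuous_mat (dual_topology (mirabolic_lie n)) n n (form_mat n)"
  unfolding form_mat_def
proof (rule continuous_mat_mat)
  fix i j assume ij: "i < n" "j < n"
  show "continuous_map (dual_topology (mirabolic_lie n)) euclidean
    (\<lambda>b. if j < n - 1 then b (elementary n j i) else 0)"
  proof (cases "j < n - 1")
    case True
    then have "elementary n j i \<in> mirabolic_lie n" using ij by (intro elementary_mirabolic_lie) auto
    then show ?thesis using True continuous_map_dual_apply by simp
  qed simp
qed

lemma form_mat_moment_map:
  assumes A: "A \<in> carrier_mat n n"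
  shows "form_mat n (moment_map n (pr n A)) = mat n n (\<lambda>(i, j). if j < n - 1 then A $$ (i, j) else 0)"
proof (rule eq_matI)
  fix i j assume "i < dim_row (mat n n (\<lambda>(i, j). if j < n - 1 then A $$ (i, j) else 0))"
    "j < dim_col (mat n n (\<lambda>(i, j). if j < n - 1 then A $$ (i, j) else 0))"
  then have ij: "i < n" "j < n" by auto
  have "elementary n j i \<in> mirabolic_lie n" if "j < n - 1"
    using ij that by (intro elementary_mirabolic_lie) auto
  then show "form_mat n (moment_map n (pr n A)) $$ (i, j) = mat n n (\<lambda>(i, j). if j < n - 1 then A $$ (i, j) else 0) $$ (i, j)"
    using ij pr_elementary[OF A ij] by (simp add: form_mat_def moment_map_def)
qed (simp_all add: form_mat_def)

lemma mult_last_unit_index: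
  assumes "0 < n" "M \<in> carrier_mat n n" "i < n" "j < n"
  shows "(M * last_unit n) $$ (i, j) = (if j = n - 1 then M $$ (i, n - 1) else 0)"
proof -
  have "(M * last_unit n) $$ (i, j) = (\<Sum>r<n. M $$ (i, r) * last_unit n $$ (r, j))"
    by (rule index_mult_mat_sum[OF assms(2) last_unit_carrier assms(3,4)])
  also have "\<dots> = (\<Sum>r<n. if r = n - 1 then if j = n - 1 then M $$ (i, r) else 0 else 0)"
    using assms(4) by (intro sum.cong refl) (simp add: last_unit_def)
  also have "\<dots> = (if j = n - 1 then M $$ (i, n - 1) else 0)"
    using assms(1) by simp
  finally show ?thesis .
qed

lemma form_mat_decompose:
  assumes n: "0 < n" and A: "A \<in> carrier_mat n n"
  shows "A = form_mat n (moment_map n (pr n A)) + A * last_unit n"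
proof (rule eq_matI)
  fix i j
  let ?F = "form_mat n (moment_map n (pr n A))"
  assume "i < dim_row (?F + A * last_unit n)" "j < dim_col (?F + A * last_unit n)"
  then have ij: "i < n" "j < n" using A carrier_matD[OF last_unit_carrier[of n]] by auto
  have "(?F + A * last_unit n) $$ (i, j) = ?F $$ (i, j) + (A * last_unit n) $$ (i, j)"
    using ij A carrier_matD[OF last_unit_carrier[of n]] by (intro index_add_mat) auto
  then show "A $$ (i, j) = (?F + A * last_unit n) $$ (i, j)"
    using ij mult_last_unit_index[OF n A ij] by (auto simp: form_mat_moment_map[OF A] simp del: index_add_mat index_mult_mat)
qed (use A carrier_matD[OF last_unit_carrier[of n]] in \<open>auto simp: form_mat_def\<close>)

section \<open>The open orbit\<close>

lemma is_jordan_data_pos: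
  assumes "is_jordan_data n bs"
  shows "0 < n"
proof -
  obtain a kls bs' where bs: "bs = (a, kls) # bs'" using assms by (cases bs) (auto simp: is_jordan_data_def)
  then obtain k l kls' where kls: "kls = (k, l) # kls'" using assms by (cases kls) (auto simp: is_jordan_data_def)
  have "1 \<le> k" "1 \<le> l" using assms by (simp_all add: is_jordan_data_def bs kls)
  then have "0 < part_size kls" by (simp add: part_size_def kls)
  moreover have "part_size kls \<le> n" using assms by (auto simp: is_jordan_data_def part_sizes_def bs)
  ultimately show ?thesis by simp
qed

lemma det_g_index: "det (g_index n I) = 1"
proof -
  have "det (g_index n I) = prod_list (diag_mat (g_index n I))"
    by (rule det_lower_triangular[of n]) (auto simp: g_index_def)
  also have "diag_mat (g_index n I) = replicate n 1"
    by (intro nth_equalityI) (auto simp: diag_mat_def g_index_def)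
  finally show ?thesis by simp
qed

text \<open>Since \<phi> \<open>B^i R\<close> equals \<phi> \<open>R A^i\<close>, a dual vector for
  the latter rows becomes one for \<phi> \<open>B^i\<close> after multiplication by
  \<open>R\<close>.\<close>

lemma cyclic_of_krylov:
  assumes n: "0 < n" and d: "0 < d" and R: "R \<in> carrier_mat n n" and A: "A \<in> carrier_mat n n"
    and B: "B \<in> carrier_mat n n" "R * A = B * R"
    and V: "V \<in> carrier_mat n d" "krylov n d R A * V = 1\<^sub>m d"
  shows "cyclic n d B (R * last_column n d V)"
  unfolding cyclic_def
proof (intro conjI allI impI)
  let ?L = "last_column n d V"
  show "R * ?L \<in> carrier_mat n n" using R by simp
  fix i assume i: "i < d"
  have "last_unit n * B ^\<^sub>m i * (R * ?L) = last_unit n * (B ^\<^sub>m i * R) * ?L"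
    using R B(1) by (simp add: assoc_square[of _ n])
  also have "B ^\<^sub>m i * R = R * A ^\<^sub>m i"
    by (rule pow_mat_intertwine[OF A B(1) R B(2), symmetric])
  finally show "last_unit n * B ^\<^sub>m i * (R * ?L) = (if i = d - 1 then last_unit n else 0\<^sub>m n n)"
    unfolding krylov_right_inverse_cyclic[OF n d R A V i] .
qed

text \<open>Deleting and restoring the last column are both changes that \<open>cyclic\<close> does
  not notice. Hence cyclicity is a condition on the restricted form.\<close>

lemma cyclic_form_mat:
  assumes n: "0 < n" and A: "A \<in> carrier_mat n n"
  shows "cyclic n d (form_mat n (moment_map n (pr n A))) U \<longleftrightarrow> cyclic n d A U"
proof
  let ?F = "form_mat n (moment_map n (pr n A))"
  show "cyclic n d A U" if "cyclic n d ?F U"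
    using cyclic_same_columns[OF form_mat_carrier A that] form_mat_decompose[OF n A] by simp
  have AE: "A * last_unit n \<in> carrier_mat n n" using A by simp
  have idx: "A $$ (i, j) = ?F $$ (i, j) + (A * last_unit n) $$ (i, j)" if "i < n" "j < n" for i j
    using arg_cong[OF form_mat_decompose[OF n A], of "\<lambda>M. M $$ (i, j)"] that carrier_matD[OF AE]
    by (simp del: index_mult_mat)
  have "A + (- A) * last_unit n = A + - (A * last_unit n)"
    using A carrier_matD[OF last_unit_carrier[of n]] by (subst uminus_mult_left_mat) auto
  also have "\<dots> = ?F"
    using carrier_matD[OF form_mat_carrier[of n "moment_map n (pr n A)"]] carrier_matD[OF AE] A
    by (intro eq_matI) (simp_all add: idx del: index_mult_mat)
  finally have "A + (- A) * last_unit n = ?F" .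
  moreover assume "cyclic n d A U"
  then have "cyclic n d (A + (- A) * last_unit n) U" using A by (intro cyclic_same_columns) auto
  ultimately show "cyclic n d ?F U" by simp
qed

text \<open>\<open>m\<close> is the coefficient list, constant term first, of the minimal polynomial
  of the Jordan form, and \<open>d\<close> is its degree.\<close>

locale jordan_orbit =
  fixes n :: nat and bs :: jordan_data and d :: nat and m :: "complex list"
  assumes data: "is_jordan_data n bs"
    and d_pos: "0 < d" and m_length: "length m = Suc d" and m_last: "last m = 1"
    and m_annihilates: "mat_poly n (jordan_form bs) m = 0\<^sub>m n n"
    and m_minimal: "\<And>cs. length cs \<le> d \<Longrightarrow> mat_poly n (jordan_form bs) cs = 0\<^sub>m n n \<Longrightarrow> \<forall>c\<in>set cs. c = 0"
begin

abbreviation "\<xi> \<equiv> jordan_form bs"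
abbreviation "g \<equiv> g_index n (index_set bs)"

lemma n_pos: "0 < n" using is_jordan_data_pos[OF data] .

lemma \<xi>_carrier: "\<xi> \<in> carrier_mat n n" by (rule jordan_form_carrier[OF data])

lemma g_carrier: "g \<in> carrier_mat n n" by (simp add: g_index_def)

text \<open>A relation among the rows \<phi> \<open>g \<xi>^i\<close> with \<open>i < d\<close> is a
  polynomial \<open>p\<close> of degree below \<open>d\<close> such that the last row of
  \<open>g p(\<xi>)\<close> vanishes. Then \<open>p(\<xi>) = 0\<close>, and minimality makes the
  relation trivial.\<close>

lemma ex_krylov_right_inverse:
  obtains V where "V \<in> carrier_mat n d" "krylov n d g \<xi> * V = 1\<^sub>m d"
proof -
  let ?K = "krylov n d g \<xi>"
  have "det (gram n d ?K) \<noteq> 0"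
  proof (rule det_gram_nonzero[OF krylov_carrier])
    fix x assume x: "x \<in> carrier_vec d" "\<And>j. j < n \<Longrightarrow> (\<Sum>i<d. x $ i * ?K $$ (i, j)) = 0"
    have "mat_poly n \<xi> (list_of_vec x) = 0\<^sub>m n n"
    proof (rule mat_poly_jordan_form_eq_0[OF data])
      fix c assume c: "c < n"
      have "(g * mat_poly n \<xi> (list_of_vec x)) $$ (n - 1, c)
        = (\<Sum>t<length (list_of_vec x). list_of_vec x ! t * (g * \<xi> ^\<^sub>m t) $$ (n - 1, c))"
        using n_pos c by (intro mat_poly_mult_index[OF \<xi>_carrier g_carrier]) auto
      also have "\<dots> = (\<Sum>t<d. x $ t * ?K $$ (t, c))"
        using x(1) c by (intro sum.cong) (auto simp: list_of_vec_index krylov_def simp del: index_mult_mat(1))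
      finally show "(g * mat_poly n \<xi> (list_of_vec x)) $$ (n - 1, c) = 0"
        using x(2)[OF c] by simp
    qed
    then have "\<forall>c\<in>set (list_of_vec x). c = 0" using x(1) by (intro m_minimal) simp_all
    then show "x = 0\<^sub>v d" using x(1) by (intro eq_vecI) (auto simp: set_list_of_vec vec_set_def)
  qed
  then show thesis
    using that[OF right_inverse_carrier[OF krylov_carrier] mult_right_inverse[OF krylov_carrier]] by blast
qed

definition "base = g * \<xi> * inv\<^bsub>GL n\<^esub> g"

lemma g_inverse: "inv\<^bsub>GL n\<^esub> g \<in> carrier_mat n n" "g * inv\<^bsub>GL n\<^esub> g = 1\<^sub>m n" "inv\<^bsub>GL n\<^esub> g * g = 1\<^sub>m n"
  using inverse_GL[OF g_carrier] by (simp_all add: det_g_index)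

lemma base_carrier: "base \<in> carrier_mat n n"
  using g_carrier g_inverse \<xi>_carrier by (simp add: base_def)

lemma base_eq: "g * \<xi> = base * g"
proof -
  have "base * g = g * \<xi> * (inv\<^bsub>GL n\<^esub> g * g)"
    unfolding base_def by (rule assoc_square[OF mult_carrier_square[OF g_carrier \<xi>_carrier] g_inverse(1) g_carrier])
  then show ?thesis using g_carrier \<xi>_carrier by (simp add: g_inverse)
qed

lemma coadjoint_g_index: "coadjoint n (gl n) g (pr n \<xi>) = pr n base"
  by (rule coadjoint_pr[OF g_carrier _ \<xi>_carrier base_carrier base_eq]) (simp add: det_g_index)

lemma base_cyclic: "\<exists>U. cyclic n d base U"
proof -
  obtain V where "V \<in> carrier_mat n d" "krylov n d g \<xi> * V = 1\<^sub>m d" by (rule ex_krylov_right_inverse)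
  then show ?thesis using cyclic_of_krylov[OF n_pos d_pos g_carrier \<xi>_carrier base_carrier base_eq] by blast
qed

lemma conj_class_annihilated:
  assumes "A \<in> conj_class n \<xi>"
  shows "mat_poly n A m = 0\<^sub>m n n"
proof -
  obtain h where h: "A \<in> carrier_mat n n" "h \<in> carrier_mat n n" "det h \<noteq> 0" "h * \<xi> = A * h"
    using assms by (auto simp: conj_class_def)
  note k = inverse_GL[OF h(2,3)]
  have "mat_poly n A m * h * inv\<^bsub>GL n\<^esub> h = h * mat_poly n \<xi> m * inv\<^bsub>GL n\<^esub> h"
    using mat_poly_intertwine[OF \<xi>_carrier h(1,2,4)] by simp
  also have "\<dots> = 0\<^sub>m n n" unfolding m_annihilates using h(2) k(1) by simp
  finally show ?thesis
    using assoc_square[OF mat_poly_carrier[OF h(1)] h(2) k(1), of m] h(1) by (simp add: k(2))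
qed

lemma base_conj_class: "base \<in> conj_class n \<xi>"
  using base_carrier base_eq g_carrier det_g_index[of n "index_set bs"] unfolding conj_class_def by force

lemma mirabolic_class_conj_class: "A \<in> conj_class n \<xi> \<Longrightarrow> mirabolic_class n A \<subseteq> conj_class n \<xi>"
  using conj_class_trans[OF \<xi>_carrier] mirabolic_class_subset by blast

text \<open>Conjugation by a matrix fixing \<phi> preserves cyclicity. Conversely, cyclic matrices
  in one conjugacy class are both annihilated by \<open>m\<close>, from which divided differences
  produce a conjugating matrix in the mirabolic group.\<close>

lemma mirabolic_class_base: "mirabolic_class n base = {A \<in> conj_class n \<xi>. \<exists>U. cyclic n d A U}"
proof (intro equalityI subsetI)
  fix A assume A: "A \<in> mirabolic_class n base"
  obtain U where "cyclic n d base U" using base_cyclic by blast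
  moreover obtain q where "A \<in> carrier_mat n n" "q \<in> carrier_mat n n" "q * base = A * q" "last_unit n * q = last_unit n"
    using A unfolding mirabolic_class_def by blast
  ultimately have "cyclic n d A (q * U)" using base_carrier by (intro cyclic_conjugate)
  then show "A \<in> {A \<in> conj_class n \<xi>. \<exists>U. cyclic n d A U}"
    using A mirabolic_class_conj_class[OF base_conj_class] by blast
next
  fix A assume "A \<in> {A \<in> conj_class n \<xi>. \<exists>U. cyclic n d A U}"
  then obtain U h where U: "cyclic n d A U"
    and h: "A \<in> carrier_mat n n" "h \<in> carrier_mat n n" "det h \<noteq> 0" "h * \<xi> = A * h"
    unfolding conj_class_def by blast
  obtain U' where U': "cyclic n d base U'" using base_cyclic by blast
  let ?k = "inv\<^bsub>GL n\<^esub> g"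
  have "?k * base = ?k * g * (\<xi> * ?k)"
    using g_carrier \<xi>_carrier g_inverse(1) by (simp add: base_def assoc_square[of _ n])
  then have "?k * base = \<xi> * ?k" using \<xi>_carrier g_inverse by simp
  then have conj: "h * ?k * base = A * (h * ?k)"
    by (rule intertwine_compose[OF base_carrier \<xi>_carrier h(1) g_inverse(1) h(2) _ h(4)])
  have "det (h * ?k) \<noteq> 0"
    using h(3) inverse_det_nonzero[OF g_inverse(1) g_carrier g_inverse(3)] h(2) g_inverse(1)
    by (simp add: det_mult[of _ n])
  then obtain q where "q \<in> carrier_mat n n" "det q \<noteq> 0" "q * base = A * q" "last_unit n * q = last_unit n"
    using cyclic_similar[OF base_carrier h(1) mult_carrier_square[OF h(2) g_inverse(1)] _ conj U' U
        conj_class_annihilated[OF base_conj_class] m_length m_last d_pos] by blast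
  then show "A \<in> mirabolic_class n base" using h(1) unfolding mirabolic_class_def by blast
qed

definition "orbit_image = moment_map n ` pr n ` conj_class n \<xi>"
definition "open_orbit = moment_map n ` pr n ` mirabolic_class n base"

lemma conj_class_carrier: "A \<in> conj_class n \<xi> \<Longrightarrow> A \<in> carrier_mat n n"
  by (simp add: conj_class_def)

text \<open>Cyclicity is visible in the restricted form, so the full preimage of the open orbit is
  the single class of \<open>base\<close>. This is why the reduced space is a point.\<close>

lemma moment_map_mem_open_orbit_iff:
  assumes A: "A \<in> conj_class n \<xi>"
  shows "moment_map n (pr n A) \<in> open_orbit \<longleftrightarrow> A \<in> mirabolic_class n base"
proof
  assume "moment_map n (pr n A) \<in> open_orbit"
  then obtain B where B: "B \<in> mirabolic_class n base" "moment_map n (pr n A) = moment_map n (pr n B)"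
    by (auto simp: open_orbit_def)
  then obtain U where "B \<in> carrier_mat n n" "cyclic n d B U"
    unfolding mirabolic_class_base using conj_class_carrier by blast
  then have "cyclic n d A U"
    using cyclic_form_mat[OF n_pos, of A d U] cyclic_form_mat[OF n_pos, of B d U] conj_class_carrier[OF A] B(2) by simp
  then show "A \<in> mirabolic_class n base" using A unfolding mirabolic_class_base by blast
qed (simp add: open_orbit_def)

text \<open>On the open orbit, \<open>lift\<close> recovers the forgotten last column.\<close>

definition "lift b = form_mat n b + - (mat_poly n (form_mat n b) m *
   last_column n d (right_inverse n d (krylov n d (1\<^sub>m n) (form_mat n b))))"

lemma det_gram_form_mat:
  assumes A: "A \<in> conj_class n \<xi>"
  shows "det (gram n d (krylov n d (1\<^sub>m n) (form_mat n (moment_map n (pr n A))))) \<noteq> 0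
    \<longleftrightarrow> A \<in> mirabolic_class n base"
  unfolding cyclic_iff_det_gram(1)[OF n_pos d_pos form_mat_carrier, symmetric]
    cyclic_form_mat[OF n_pos conj_class_carrier[OF A]] mirabolic_class_base
  using A by simp

lemma lift_moment_map:
  assumes A: "A \<in> mirabolic_class n base"
  shows "lift (moment_map n (pr n A)) = A"
proof -
  let ?F = "form_mat n (moment_map n (pr n A))"
  let ?U = "last_column n d (right_inverse n d (krylov n d (1\<^sub>m n) ?F))"
  have AC: "A \<in> conj_class n \<xi>" using A unfolding mirabolic_class_base by blast
  note Ac = conj_class_carrier[OF AC]
  have U: "cyclic n d ?F ?U"
    using A det_gram_form_mat[OF AC] by (intro cyclic_iff_det_gram(2)[OF n_pos d_pos form_mat_carrier]) simp
  have "A * last_unit n = - (mat_poly n ?F m * ?U)"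
    by (rule last_column_reconstruct[OF Ac form_mat_carrier Ac form_mat_decompose[OF n_pos Ac] U
          conj_class_annihilated[OF AC] m_length m_last d_pos])
  then show ?thesis
    unfolding lift_def using form_mat_decompose[OF n_pos Ac] by simp
qed

end

section \<open>Openness, density and the homeomorphism over the open orbit\<close>

context jordan_orbit
begin

definition "image_topology = subtopology (dual_topology (mirabolic_lie n)) orbit_image"

lemma orbit_image_linear_dual: "orbit_image \<subseteq> linear_dual (mirabolic_lie n)"
  using moment_map_linear_dual[OF pr_linear_dual] conj_class_carrier by (auto simp: orbit_image_def)

lemma topspace_image_topology: "topspace image_topology = orbit_image"
  using orbit_image_linear_dual by (auto simp: image_topology_def topspace_dual_topology)

lemma open_orbit_subset: "open_orbit \<subseteq> orbit_image"
  using mirabolic_class_conj_class[OF base_conj_class] by (auto simp: open_orbit_def orbit_image_def)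

lemma open_orbit_eq:
  "open_orbit = {b \<in> orbit_image. det (gram n d (krylov n d (1\<^sub>m n) (form_mat n b))) \<noteq> 0}"
proof (rule Set.set_eqI)
  fix b
  show "b \<in> open_orbit \<longleftrightarrow> b \<in> {b \<in> orbit_image. det (gram n d (krylov n d (1\<^sub>m n) (form_mat n b))) \<noteq> 0}"
  proof (cases "b \<in> orbit_image")
    case True
    then obtain A where A: "A \<in> conj_class n \<xi>" "b = moment_map n (pr n A)"
      unfolding orbit_image_def by blast
    then show ?thesis using True moment_map_mem_open_orbit_iff[OF A(1)] det_gram_form_mat[OF A(1)] by simp
  qed (use open_orbit_subset in blast)
qed

lemma openin_open_orbit: "openin image_topology open_orbit"
proof -
  have "continuous_map image_topology euclidean
    (\<lambda>b. det (gram n d (krylov n d (1\<^sub>m n) (form_mat n b))))"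
    unfolding image_topology_def
    by (intro continuous_map_from_subtopology continuous_map_det[where n = d] continuous_mat_gram
        continuous_mat_krylov continuous_mat_const continuous_mat_form_mat n_pos) simp
  from openin_continuous_map_preimage[OF this, of "UNIV - {0}"]
  show ?thesis
    by (simp add: open_orbit_eq topspace_image_topology open_delete)
qed

text \<open>This is density: the curve \<open>B t\<close> of conjugates of \<xi> passes through
  \<open>A\<close> at \<open>t = 0\<close>, stays in the class where \<open>R t\<close> is
  invertible, and is cyclic for all but finitely many of these \<open>t\<close>.\<close>

lemma approximate_by_cyclic:
  assumes A: "A \<in> conj_class n \<xi>" and W: "openin image_topology W" "moment_map n (pr n A) \<in> W"
  shows "open_orbit \<inter> W \<noteq> {}"
proof -
  obtain h where Ac: "A \<in> carrier_mat n n" and h: "h \<in> carrier_mat n n" "det h \<noteq> 0" "h * \<xi> = A * h"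
    using A unfolding conj_class_def by blast
  \<comment> \<open>\<open>R t\<close> arises from \<open>h\<close> by adding \<open>t\<close> times the last row of \<open>g\<close> to the last row. Its Krylov matrix
    has independent rows unless \<open>t\<close> is a root of a nonzero polynomial.\<close>
  define R where "R t = h + t \<cdot>\<^sub>m (last_unit n * g)" for t :: complex
  have R: "R t \<in> carrier_mat n n" for t using h(1) g_carrier by (simp add: R_def)
  define D where "D = {t. det (R t) \<noteq> 0}"
  define k where "k t = inverse (det (R t)) \<cdot>\<^sub>m adj_mat (R t)" for t
  define B where "B t = R t * \<xi> * k t" for t
  have k: "k t \<in> carrier_mat n n" for t using adj_mat(1)[OF R] by (simp add: k_def)
  have kR: "k t * R t = 1\<^sub>m n" if "t \<in> D" for t
    using that adj_mat(3)[OF R, of t] mult_smult_assoc_mat[OF adj_mat(1)[OF R] R, of "inverse (det (R t))" t t]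
    by (auto simp: k_def D_def intro!: eq_matI)
  have B: "B t \<in> carrier_mat n n" for t using R k \<xi>_carrier by (simp add: B_def)
  have RB: "R t * \<xi> = B t * R t" if "t \<in> D" for t
    using assoc_square[OF mult_carrier_square[OF R \<xi>_carrier] k R, of t t t] kR[OF that] R \<xi>_carrier
    by (simp add: B_def)
  have BC: "B t \<in> conj_class n \<xi>" if "t \<in> D" for t
    using that B R RB unfolding conj_class_def D_def by blast
  have contR: "continuous_mat euclidean n n R"
    unfolding R_def using h(1) g_carrier
    by (intro continuous_mat_add continuous_mat_smult continuous_mat_const) (simp_all add: continuous_map_id[unfolded id_def])
  have contR': "continuous_mat (top_of_set D) n n R"
    using contR unfolding continuous_mat_def by (auto intro: continuous_on_subset)
  have "continuous_mat (top_of_set D) n n B"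
    unfolding B_def k_def
    by (intro continuous_mat_mult[where n = n] continuous_mat_smult continuous_mat_adj continuous_map_inverse_complex
        continuous_map_det[where n = n] contR' continuous_mat_const \<xi>_carrier) (simp add: D_def)
  then have "continuous_map (top_of_set D) (dual_topology (mirabolic_lie n)) (moment_map n \<circ> (\<lambda>t. pr n (B t)))"
    by (intro continuous_map_compose[OF continuous_map_pr continuous_map_moment_map])
  then have cont: "continuous_map (top_of_set D) image_topology (\<lambda>t. moment_map n (pr n (B t)))"
    unfolding image_topology_def using BC
    by (intro continuous_map_into_subtopology) (auto simp: o_def orbit_image_def)
  have "openin (top_of_set D) {t \<in> D. moment_map n (pr n (B t)) \<in> W}"
    using openin_continuous_map_preimage[OF cont W(1)] by simp
  moreover have "open D"
    using openin_continuous_map_preimage[OF continuous_map_det[OF contR], of "UNIV - {0}"]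
    by (simp add: D_def open_delete)
  ultimately have op: "open {t \<in> D. moment_map n (pr n (B t)) \<in> W}"
    by (rule openin_open_trans)
  have R0: "R 0 = h" using h(1) g_carrier by (simp add: R_def smult_zero_square[of _ n])
  then have D0: "0 \<in> D" using h(2) by (simp add: D_def)
  have "h * k 0 = 1\<^sub>m n"
    using mat_mult_left_right_inverse[OF k R kR[OF D0]] by (simp add: R0)
  then have "B 0 = A"
    using assoc_square[OF Ac h(1) k, of 0] Ac unfolding B_def R0 h(3) by simp
  with D0 W(2) have "0 \<in> {t \<in> D. moment_map n (pr n (B t)) \<in> W}" by simp
  then have inf: "infinite {t \<in> D. moment_map n (pr n (B t)) \<in> W}"
    using op by (intro infinite_openin[of UNIV _ 0]) (simp_all add: islimpt_UNIV)
  \<comment> \<open>Since \<open>V\<close> is a right inverse of the Krylov matrix of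
    \<open>g\<close>, that of \<open>R t\<close> times \<open>V\<close> equals
    \<open>?M + t\<close>, which is singular for finitely many \<open>t\<close> only. Otherwise,
    with \<open>N\<close> its inverse, \<open>V * N\<close> is a right inverse of the Krylov matrix
    of \<open>R t\<close>.\<close>
  obtain V where V: "V \<in> carrier_mat n d" "krylov n d g \<xi> * V = 1\<^sub>m d" by (rule ex_krylov_right_inverse)
  let ?M = "krylov n d h \<xi> * V"
  have M: "?M \<in> carrier_mat d d" using mult_carrier_mat[OF krylov_carrier V(1)] .
  obtain t where t: "t \<in> D" "moment_map n (pr n (B t)) \<in> W" "det (?M + t \<cdot>\<^sub>m 1\<^sub>m d) \<noteq> 0"
    using infinite_imp_nonempty[OF Diff_infinite_finite[OF finite_det_add_smult_one[OF M] inf]] by blast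
  have "krylov n d (R t) \<xi> = krylov n d h \<xi> + t \<cdot>\<^sub>m krylov n d g \<xi>"
  proof (rule eq_matI)
    fix i j assume "i < dim_row (krylov n d h \<xi> + t \<cdot>\<^sub>m krylov n d g \<xi>)" "j < dim_col (krylov n d h \<xi> + t \<cdot>\<^sub>m krylov n d g \<xi>)"
    then have ij: "i < d" "j < n" by (simp_all add: krylov_def)
    let ?X = "\<xi> ^\<^sub>m i"
    have X: "?X \<in> carrier_mat n n" using \<xi>_carrier by simp
    have gX: "g * ?X \<in> carrier_mat n n" "last_unit n * (g * ?X) \<in> carrier_mat n n" using g_carrier X by simp_all
    have "R t * ?X = h * ?X + t \<cdot>\<^sub>m (last_unit n * (g * ?X))"
      using h(1) g_carrier X by (simp add: R_def distrib_square[of _ n] mult_smult_assoc_mat[of _ n n _ n] assoc_square[of _ n])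
    then have "(R t * ?X) $$ (n - 1, j) = (h * ?X) $$ (n - 1, j) + t * (last_unit n * (g * ?X)) $$ (n - 1, j)"
      using carrier_matD[OF gX(2)] n_pos ij by (simp del: index_mult_mat)
    also have "(last_unit n * (g * ?X)) $$ (n - 1, j) = (g * ?X) $$ (n - 1, j)"
      using last_unit_mult_index[OF gX(1), of "n - 1" j] n_pos ij by simp
    finally show "krylov n d (R t) \<xi> $$ (i, j) = (krylov n d h \<xi> + t \<cdot>\<^sub>m krylov n d g \<xi>) $$ (i, j)"
      using ij by (simp add: krylov_def del: index_mult_mat)
  qed (simp_all add: krylov_def)
  then have KV: "krylov n d (R t) \<xi> * V = ?M + t \<cdot>\<^sub>m 1\<^sub>m d"
    using V krylov_carrier[of n d] by (simp add: add_mult_distrib_mat[of _ d n _ _ d] mult_smult_assoc_mat[of _ d n _ d])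
  obtain N where N: "N \<in> carrier_mat d d" "(?M + t \<cdot>\<^sub>m 1\<^sub>m d) * N = 1\<^sub>m d"
    using det_nonzero_inverse[OF _ t(3), of d] M by auto
  have "krylov n d (R t) \<xi> * (V * N) = 1\<^sub>m d"
    using assoc_mult_mat[OF krylov_carrier[of n d "R t" \<xi>] V(1) N(1)] unfolding KV N(2) by simp
  then have "cyclic n d (B t) (R t * last_column n d (V * N))"
    using V(1) N(1) by (intro cyclic_of_krylov[OF n_pos d_pos R \<xi>_carrier B RB[OF t(1)]]) auto
  then have "B t \<in> mirabolic_class n base" using BC[OF t(1)] unfolding mirabolic_class_base by blast
  then have "moment_map n (pr n (B t)) \<in> open_orbit" by (simp add: open_orbit_def)
  with t(2) show ?thesis by blast
qed

lemma dense_open_orbit: "image_topology closure_of open_orbit = topspace image_topology"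
  unfolding dense_intersects_open
proof (intro allI impI)
  fix W assume W: "openin image_topology W \<and> W \<noteq> {}"
  then have "W \<subseteq> orbit_image" using openin_subset[of image_topology W] by (simp add: topspace_image_topology)
  with W obtain A where "A \<in> conj_class n \<xi>" "moment_map n (pr n A) \<in> W"
    by (auto simp: orbit_image_def)
  then show "open_orbit \<inter> W \<noteq> {}" using approximate_by_cyclic W by blast
qed

definition "fibre_topology = subtopology (dual_topology (gl n)) (pr n ` mirabolic_class n base)"
definition "open_orbit_topology = subtopology (dual_topology (mirabolic_lie n)) open_orbit"

lemma topspace_fibre_topology: "topspace fibre_topology = pr n ` mirabolic_class n base"
proof -
  have "pr n ` mirabolic_class n base \<subseteq> linear_dual (gl n)"
    using pr_linear_dual[OF conj_class_carrier] mirabolic_class_conj_class[OF base_conj_class] by blast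
  then show ?thesis
    unfolding fibre_topology_def topspace_subtopology topspace_dual_topology by (rule Int_absorb1)
qed

lemma topspace_open_orbit_topology: "topspace open_orbit_topology = open_orbit"
  using open_orbit_subset orbit_image_linear_dual by (auto simp: open_orbit_topology_def topspace_dual_topology)

text \<open>\<open>lift\<close> is a polynomial expression in the entries, their conjugates and the
  inverse of the Gram determinant, which has no zero on the open orbit; hence it is
  continuous.\<close>

lemma homeomorphic_moment_map:
  "homeomorphic_maps fibre_topology open_orbit_topology (moment_map n) (\<lambda>b. pr n (lift b))"
  unfolding homeomorphic_maps_def
proof (intro conjI ballI)
  show "continuous_map fibre_topology open_orbit_topology (moment_map n)"
    unfolding open_orbit_topology_def
    by (intro continuous_map_into_subtopology)
       (auto simp: fibre_topology_def open_orbit_def intro: continuous_map_from_subtopology continuous_map_moment_map)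
  have form: "continuous_mat open_orbit_topology n n (form_mat n)"
    using continuous_mat_form_mat[of n] unfolding continuous_mat_def open_orbit_topology_def
    by (auto intro: continuous_map_from_subtopology)
  have "continuous_mat open_orbit_topology n n lift"
    unfolding lift_def
    by (intro continuous_mat_add continuous_mat_uminus continuous_mat_mult[where n = n] continuous_mat_poly
        continuous_mat_last_column[OF _ d_pos] continuous_mat_right_inverse continuous_mat_krylov[OF _ _ n_pos]
        continuous_mat_const form) (simp_all add: topspace_open_orbit_topology open_orbit_eq)
  then have "continuous_map open_orbit_topology (dual_topology (gl n)) (\<lambda>b. pr n (lift b))"
    by (rule continuous_map_pr)
  then show "continuous_map open_orbit_topology fibre_topology (\<lambda>b. pr n (lift b))"
    unfolding fibre_topology_def
    by (intro continuous_map_into_subtopology) (auto simp: topspace_open_orbit_topology open_orbit_def lift_moment_map)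
  show "pr n (lift (moment_map n x)) = x" if "x \<in> topspace fibre_topology" for x
    using that by (auto simp: topspace_fibre_topology lift_moment_map)
  show "moment_map n (pr n (lift b)) = b" if "b \<in> topspace open_orbit_topology" for b
    using that by (auto simp: topspace_open_orbit_topology open_orbit_def lift_moment_map)
qed

text \<open>If \<open>h\<close> carries \<xi> to \<open>A\<close> and \<open>k\<close> carries it to
  \<open>B\<close>, then \<open>k\<close> times the inverse of \<open>h\<close> is the invertible
  intertwiner with which the construction starts.\<close>

lemma mirabolic_class_eq_of_moment_map_eq:
  assumes A: "A \<in> conj_class n \<xi>" and B: "B \<in> conj_class n \<xi>"
    and eq: "moment_map n (pr n A) = moment_map n (pr n B)"
  shows "mirabolic_class n A = mirabolic_class n B"
proof -
  note Ac = conj_class_carrier[OF A] and Bc = conj_class_carrier[OF B]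
  obtain h k where h: "h \<in> carrier_mat n n" "det h \<noteq> 0" "h * \<xi> = A * h"
    and k: "k \<in> carrier_mat n n" "det k \<noteq> 0" "k * \<xi> = B * k"
    using A B unfolding conj_class_def by blast
  note h' = inverse_GL[OF h(1,2)]
  let ?h = "inv\<^bsub>GL n\<^esub> h"
  have "?h * A = ?h * (A * h) * ?h" using Ac h' h(1) by (simp add: assoc_square[of _ n])
  also have "\<dots> = ?h * h * (\<xi> * ?h)" unfolding h(3)[symmetric] using h(1) h'(1) \<xi>_carrier by (simp add: assoc_square[of _ n])
  also have "\<dots> = \<xi> * ?h" using h' \<xi>_carrier by simp
  finally have hA: "?h * A = \<xi> * ?h" .
  have conj: "k * ?h * A = B * (k * ?h)"
    by (rule intertwine_compose[OF Ac \<xi>_carrier Bc h'(1) k(1) hA k(3)])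
  have det: "det (k * ?h) \<noteq> 0"
    using k h' inverse_det_nonzero[OF h'(1) h(1) h'(3)] by (simp add: det_mult[of _ n])
  have same: "B $$ (i, j) = A $$ (i, j)" if "i < n" "j < n - 1" for i j
    using eq that moment_map_pr_eq_iff[OF n_pos Ac Bc] by simp
  obtain q where "q \<in> carrier_mat n n" "det q \<noteq> 0" "q * A = B * q" "last_unit n * q = last_unit n"
    using similar_same_columns[OF n_pos Ac Bc same mult_carrier_square[OF k(1) h'(1)] det conj] by blast
  then have "B \<in> mirabolic_class n A" using Bc unfolding mirabolic_class_def by blast
  then show ?thesis using mirabolic_class_eq[OF Ac] by simp
qed

end

theorem theorem3p12:
  fixes n :: nat and bs :: jordan_data
    and f :: "complex mat \<Rightarrow> complex"
    and Of \<Omega> fibre :: "(complex mat \<Rightarrow> complex) set"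
  assumes "is_jordan_data n bs"
  defines "f \<equiv> pr n (jordan_form bs)"
  defines "Of \<equiv> orbit (GL n) (coadjoint n (gl n)) f"
  defines "\<Omega> \<equiv> orbit (mirabolic n) (coadjoint n (mirabolic_lie n))
                  (moment_map n (coadjoint n (gl n) (g_index n (index_set bs)) f))"
  defines "fibre \<equiv> {h \<in> Of. moment_map n h \<in> \<Omega>}"
  shows
    "(\<forall>Q \<in> orbits (GL n) (linear_dual (gl n)) (coadjoint n (gl n)).
        \<exists>bs'. is_jordan_data n bs' \<and> pr n (jordan_form bs') \<in> Q) \<and>
     (\<forall>A \<in> orbits (mirabolic n) Of (coadjoint n (gl n)).
        moment_map n ` A \<in>
          orbits (mirabolic n) (linear_dual (mirabolic_lie n)) (coadjoint n (mirabolic_lie n))) \<and>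
     inj_on (\<lambda>A. moment_map n ` A) (orbits (mirabolic n) Of (coadjoint n (gl n))) \<and>
     (let Y = subtopology (dual_topology (mirabolic_lie n)) (moment_map n ` Of) in
        {U \<in> orbits (mirabolic n) (moment_map n ` Of) (coadjoint n (mirabolic_lie n)).
           Y closure_of U = topspace Y} = {\<Omega>} \<and>
        openin Y \<Omega>) \<and>
     continuous_map (subtopology (dual_topology (gl n)) fibre)
       (subtopology (dual_topology (mirabolic_lie n)) \<Omega>) (moment_map n) \<and>
     proper_map (subtopology (dual_topology (gl n)) fibre)
       (subtopology (dual_topology (mirabolic_lie n)) \<Omega>) (moment_map n) \<and>
     is_singleton (orbits (mirabolic n) fibre (coadjoint n (gl n)))"
proof -
  note n = is_jordan_data_pos[OF assms(1)]
  obtain m d where md: "0 < d" "length m = Suc d" "last m = 1" "mat_poly n (jordan_form bs) m = 0\<^sub>m n n"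
    "\<And>cs. length cs \<le> d \<Longrightarrow> mat_poly n (jordan_form bs) cs = 0\<^sub>m n n \<Longrightarrow> \<forall>c\<in>set cs. c = 0"
    by (rule ex_minimal_poly[OF n jordan_form_carrier[OF assms(1)]]) (rule that)
  interpret J: jordan_orbit n bs d m
    by (rule jordan_orbit.intro[OF assms(1) md])
  let ?C = "conj_class n (jordan_form bs)" and ?M = "mirabolic_class n"
  note carr = J.conj_class_carrier
  have M_C: "?M X \<subseteq> ?C" if "X \<in> ?C" for X by (rule J.mirabolic_class_conj_class[OF that])
  have Of: "Of = pr n ` ?C"
    unfolding Of_def f_def by (rule orbit_GL_pr[OF J.\<xi>_carrier])
  have \<Omega>: "\<Omega> = J.open_orbit"
    unfolding \<Omega>_def f_def J.coadjoint_g_index J.open_orbit_def by (rule orbit_mirabolic_moment[OF n J.base_carrier])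
  have fibre: "fibre = pr n ` ?M J.base"
    unfolding fibre_def Of \<Omega> using J.moment_map_mem_open_orbit_iff M_C[OF J.base_conj_class] by blast
  have orbits_Of: "orbits (mirabolic n) Of (coadjoint n (gl n)) = (\<lambda>X. pr n ` ?M X) ` ?C"
    unfolding orbits_def Of using orbit_mirabolic_pr[OF n carr] by blast
  have orbits_image: "orbits (mirabolic n) (moment_map n ` Of) (coadjoint n (mirabolic_lie n))
      = (\<lambda>X. moment_map n ` pr n ` ?M X) ` ?C"
    unfolding orbits_def Of using orbit_mirabolic_moment[OF n carr] by blast
  \<comment> \<open>Mirabolic classes whose restricted images share a point coincide. Injectivity on
    orbits and uniqueness of the dense orbit both rest on this.\<close>
  have M_eqI: "?M X = ?M X'" if "X \<in> ?C" "X' \<in> ?C" "Y \<in> ?M X" "Y' \<in> ?M X'"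
    "moment_map n (pr n Y) = moment_map n (pr n Y')" for X X' Y Y'
    using that J.mirabolic_class_eq_of_moment_map_eq[of Y Y'] M_C mirabolic_class_eq[OF carr] by blast
  have "\<exists>bs'. is_jordan_data n bs' \<and> pr n (jordan_form bs') \<in> Q"
    if Q: "Q \<in> orbits (GL n) (linear_dual (gl n)) (coadjoint n (gl n))" for Q
  proof -
    obtain A where A: "A \<in> carrier_mat n n" "Q = pr n ` conj_class n A"
      using Q linear_dual_eq_pr orbit_GL_pr unfolding orbits_def by blast
    obtain bs' where bs': "is_jordan_data n bs'" "similar_mat A (jordan_form bs')"
      using similar_jordan_form[OF n A(1)] by blast
    obtain P R where "similar_mat_wit A (jordan_form bs') P R"
      using bs'(2) by (auto simp: similar_mat_def)
    note PR = similar_mat_witD2[OF A(1) this]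
    have "R * A = R * P * (jordan_form bs' * R)"
      unfolding PR(3) using PR(5-7) by (simp add: assoc_square[of _ n])
    then have "R * A = jordan_form bs' * R" unfolding PR(2) using PR(5,7) by simp
    then have "jordan_form bs' \<in> conj_class n A"
      using PR(5,7) inverse_det_nonzero[OF PR(7,6,2)] unfolding conj_class_def by blast
    then show ?thesis using bs'(1) A(2) by blast
  qed
  moreover have "moment_map n ` A \<in> orbits (mirabolic n) (linear_dual (mirabolic_lie n)) (coadjoint n (mirabolic_lie n))"
    if A: "A \<in> orbits (mirabolic n) Of (coadjoint n (gl n))" for A
  proof -
    obtain X where X: "X \<in> ?C" "A = pr n ` ?M X" using A unfolding orbits_Of by blast
    have "moment_map n ` A = orbit (mirabolic n) (coadjoint n (mirabolic_lie n)) (moment_map n (pr n X))"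
      unfolding X(2) by (rule orbit_mirabolic_moment[OF n carr[OF X(1)], symmetric])
    then show ?thesis
      using moment_map_linear_dual[OF pr_linear_dual[OF carr[OF X(1)]]] unfolding orbits_def by blast
  qed
  moreover have "inj_on (\<lambda>A. moment_map n ` A) (orbits (mirabolic n) Of (coadjoint n (gl n)))"
  proof (rule inj_onI)
    fix A A' assume "A \<in> orbits (mirabolic n) Of (coadjoint n (gl n))"
      "A' \<in> orbits (mirabolic n) Of (coadjoint n (gl n))" and eq: "moment_map n ` A = moment_map n ` A'"
    then obtain X X' where X: "X \<in> ?C" "A = pr n ` ?M X" "X' \<in> ?C" "A' = pr n ` ?M X'"
      unfolding orbits_Of by blast
    have "moment_map n (pr n X) \<in> moment_map n ` pr n ` ?M X'"
      using eq mirabolic_class_refl[OF carr[OF X(1)]] unfolding X by blast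
    then obtain Y where "Y \<in> ?M X'" "moment_map n (pr n X) = moment_map n (pr n Y)" by blast
    then have "?M X = ?M X'" using M_eqI[OF X(1,3) mirabolic_class_refl[OF carr[OF X(1)]]] by blast
    then show "A = A'" unfolding X by simp
  qed
  moreover have Y: "subtopology (dual_topology (mirabolic_lie n)) (moment_map n ` Of) = J.image_topology"
    by (simp add: Of J.image_topology_def J.orbit_image_def)
  have "{U \<in> orbits (mirabolic n) (moment_map n ` Of) (coadjoint n (mirabolic_lie n)).
      J.image_topology closure_of U = topspace J.image_topology} = {\<Omega>}"
  proof (intro equalityI subsetI)
    fix U assume "U \<in> {U \<in> orbits (mirabolic n) (moment_map n ` Of) (coadjoint n (mirabolic_lie n)).
      J.image_topology closure_of U = topspace J.image_topology}"
    then obtain X where X: "X \<in> ?C" "U = moment_map n ` pr n ` ?M X"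
      and dense: "J.image_topology closure_of U = topspace J.image_topology"
      unfolding orbits_image by blast
    have "J.open_orbit \<noteq> {}"
      using mirabolic_class_refl[OF J.base_carrier] unfolding J.open_orbit_def by blast
    \<comment> \<open>A dense orbit meets every nonempty open set, in particular the open
      orbit.\<close>
    then have "U \<inter> J.open_orbit \<noteq> {}"
      using dense J.openin_open_orbit unfolding dense_intersects_open by blast
    then obtain Y Y' where "Y \<in> ?M X" "Y' \<in> ?M J.base" "moment_map n (pr n Y) = moment_map n (pr n Y')"
      unfolding X(2) J.open_orbit_def by blast
    then have "?M X = ?M J.base" by (rule M_eqI[OF X(1) J.base_conj_class])
    then show "U \<in> {\<Omega>}" unfolding X(2) \<Omega> J.open_orbit_def by simp
  next
    fix U assume "U \<in> {\<Omega>}"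
    then show "U \<in> {U \<in> orbits (mirabolic n) (moment_map n ` Of) (coadjoint n (mirabolic_lie n)).
      J.image_topology closure_of U = topspace J.image_topology}"
      using J.dense_open_orbit J.base_conj_class unfolding orbits_image \<Omega> J.open_orbit_def by blast
  qed
  then have "let Y = subtopology (dual_topology (mirabolic_lie n)) (moment_map n ` Of) in
      {U \<in> orbits (mirabolic n) (moment_map n ` Of) (coadjoint n (mirabolic_lie n)).
         Y closure_of U = topspace Y} = {\<Omega>} \<and> openin Y \<Omega>"
    unfolding Let_def Y using J.openin_open_orbit unfolding \<Omega> by blast
  moreover have tops: "subtopology (dual_topology (gl n)) fibre = J.fibre_topology"
    "subtopology (dual_topology (mirabolic_lie n)) \<Omega> = J.open_orbit_topology"
    by (simp_all add: fibre \<Omega> J.fibre_topology_def J.open_orbit_topology_def)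
  have "homeomorphic_map J.fibre_topology J.open_orbit_topology (moment_map n)"
    using J.homeomorphic_moment_map by (rule homeomorphic_maps_imp_map)
  then have "continuous_map J.fibre_topology J.open_orbit_topology (moment_map n)"
    "proper_map J.fibre_topology J.open_orbit_topology (moment_map n)"
    by (rule homeomorphic_imp_continuous_map, rule homeomorphic_imp_proper_map)
  moreover have "orbits (mirabolic n) fibre (coadjoint n (gl n)) = {pr n ` ?M J.base}"
  proof -
    have "orbit (mirabolic n) (coadjoint n (gl n)) (pr n X) = pr n ` ?M J.base" if "X \<in> ?M J.base" for X
      using that orbit_mirabolic_pr[OF n carr] M_C[OF J.base_conj_class] mirabolic_class_eq[OF J.base_carrier that]
      by blast
    then show ?thesis
      using mirabolic_class_refl[OF J.base_carrier] unfolding orbits_def fibre by blast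
  qed
  then have "is_singleton (orbits (mirabolic n) fibre (coadjoint n (gl n)))"
    by (simp add: is_singleton_def)
  ultimately show ?thesis unfolding tops by blast
qed

end
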